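(* Let $\mathcal R\subset\mathbb F_q[[z]]$ be the ring of an irreducible plane curve singularity whose value semigroup is $\Gamma=\langle \upsilon s,\ \upsilon r,\ \upsilon rs+p\rangle$ with $r>s>0$, $\upsilon,p>0$, $\gcd(r,s)=1=\gcd(\upsilon,p)$, and suppose that $\mathcal R$ is presented as $$\mathcal R=\mathbb F_q[[\,x=z^{\upsilon r}+z^{\upsilon r+p}+g(z),\ y=z^{\upsilon s}\,]],\qquad g(z)\in(z^{\upsilon r+p+1}),$$ where $s\ne0$ in $\mathbb F_q$. Then the corresponding instanton slice $\mathfrak S_{\mathcal C}$, the superpolynomial $\mathscr H^{inst}_{\mathcal C}(q,t,\mathsf a)$, and the motivic superpolynomial $\mathcal H^{mot}_{\mathcal R}(q,t,\mathsf a)$ depend only on $\Gamma$ (not on the choice of $g$).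
   Context: $\mathcal O=\mathbb F_q[[z]]$; $\Gamma=\{\mathrm{ord}_z(f):0\ne f\in\mathcal R\}$; $\delta=\dim\mathcal O/\mathcal R$; $\mathfrak m_{\mathcal R}=\mathcal R\cap z\mathcal O$. The conductor $\mathfrak c=z^{2\delta}\mathcal O$ is the largest ideal of $\mathcal O$ contained in $\mathcal R$, and $\mathcal C$ is its full preimage under the surjection $\mathcal A=\mathbb F_q[[x,y]]\to\mathcal R$ ($x,y$ free variables in $\mathcal A$). The instanton slice is the set $\mathfrak S_{\mathcal C}$ of ideals $\mathcal I$ of $\mathcal A$ with $\mathcal C\subset\mathcal I\subset\mathcal A$, and $$\mathscr H^{inst}_{\mathcal C}(q,t,\mathsf a)=\sum_{\mathcal I\in\mathfrak S_{\mathcal C}}t^{\dim(\mathcal A/\mathcal I)}(1+\mathsf aq)\cdots(1+\mathsf aq^{\varrho(\mathcal I)-1}),\quad\varrho(\mathcal I)=\dim_{\mathbb F_q}\mathcal I/(x,y)\mathcal I.$$ $$\mathcal H^{mot}_{\mathcal R}(q,t,\mathsf a)=\sum_{M}t^{\dim(\mathcal O/M)}(1+\mathsf aq)\cdots(1+\mathsf aq^{\varrho(M)-1}),\quad\varrho(M)=\dim_{\mathbb F_q}M/\mathfrak m_{\mathcal R}M,$$ summed over $\mathcal R$-submodules $M\subset\mathcal O$ with $\mathcal OM=\mathcal O$. *)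

theory Defs
  imports "HOL-Computational_Algebra.Computational_Algebra" "HOL-Library.FuncSet"
begin

text \<open>
  Throughout, \<open>'a\<close> is the finite field \<open>F_q\<close>, \<open>'a fps\<close> is \<open>O = F_q[[z]]\<close>, and \<open>'a fps fps\<close> is
  \<open>A = F_q[[x,y]]\<close>: the outer variable is \<open>x\<close> and the inner one is \<open>y\<close>, so that
  \<open>fps_nth (fps_nth f i) j\<close> is the coefficient of \<open>x^i y^j\<close> in \<open>f\<close>.
\<close>

abbreviation scaleO :: "'a::comm_ring_1 \<Rightarrow> 'a fps \<Rightarrow> 'a fps" where
  "scaleO c f \<equiv> fps_const c * f"

abbreviation scaleA :: "'a::comm_ring_1 \<Rightarrow> 'a fps fps \<Rightarrow> 'a fps fps" where
  "scaleA c f \<equiv> fps_const (fps_const c) * f"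


subsection \<open>Submodules, products of submodules, dimensions of quotients\<close>

text \<open>The scalars range over a subset \<open>S\<close> of the ambient ring; an ideal is the case \<open>S = UNIV\<close>.\<close>

definition is_submodule :: "'b::comm_ring_1 set \<Rightarrow> 'b set \<Rightarrow> bool" where
  "is_submodule S M \<longleftrightarrow>
     0 \<in> M \<and> (\<forall>u\<in>M. \<forall>v\<in>M. u + v \<in> M) \<and> (\<forall>a\<in>S. \<forall>u\<in>M. a * u \<in> M)"

definition prod_set :: "'b::comm_ring_1 set \<Rightarrow> 'b set \<Rightarrow> 'b set" where
  "prod_set S M = {\<Sum>i<n. a i * u i | (n::nat) a u. \<forall>i<n. a i \<in> S \<and> u i \<in> M}"

text \<open>
  The cosets of the elements of \<open>B\<close> are pairwise distinct and form a finite basis of \<open>U / W\<close>.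
\<close>

definition quotient_basis ::
  "('k::field \<Rightarrow> 'v::ab_group_add \<Rightarrow> 'v) \<Rightarrow> 'v set \<Rightarrow> 'v set \<Rightarrow> 'v set \<Rightarrow> bool" where
  "quotient_basis scl U W B \<longleftrightarrow> finite B \<and> B \<subseteq> U \<and>
     (\<forall>u\<in>U. \<exists>!c. c \<in> B \<rightarrow>\<^sub>E UNIV \<and> u - (\<Sum>b\<in>B. scl (c b) b) \<in> W)"

text \<open>Meaningful when \<open>U / W\<close> has finite dimension; all the quotients used below do.\<close>

definition quotient_dim ::
  "('k::field \<Rightarrow> 'v::ab_group_add \<Rightarrow> 'v) \<Rightarrow> 'v set \<Rightarrow> 'v set \<Rightarrow> nat" where
  "quotient_dim scl U W = (THE n. \<exists>B. quotient_basis scl U W B \<and> card B = n)"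


subsection \<open>The ring of the singularity\<close>

text \<open>
  Substitution \<open>f \<mapsto> f(x(z), y(z))\<close> for series \<open>x\<close>, \<open>y\<close> without constant term. Since
  \<open>x^i y^j\<close> has order at least \<open>i + j\<close>, only \<open>i, j \<le> n\<close> contribute to the coefficient of \<open>z^n\<close>.
\<close>

definition subst2 :: "'a::field fps \<Rightarrow> 'a fps \<Rightarrow> 'a fps fps \<Rightarrow> 'a fps" where
  "subst2 x y f = Abs_fps (\<lambda>n. \<Sum>i\<le>n. \<Sum>j\<le>n. fps_nth (fps_nth f i) j * fps_nth (x ^ i * y ^ j) n)"

definition curve_ring :: "'a::field fps \<Rightarrow> 'a fps \<Rightarrow> 'a fps set" where
  "curve_ring x y = range (subst2 x y)"

definition value_semigroup :: "'a::field fps set \<Rightarrow> nat set" where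
  "value_semigroup R = {subdegree f | f. f \<in> R \<and> f \<noteq> 0}"

definition delta :: "'a::field fps set \<Rightarrow> nat" where
  "delta R = quotient_dim scaleO UNIV R"

text \<open>
  For the (Gorenstein) ring \<open>R\<close> of a plane branch this is the largest ideal of \<open>O\<close> contained in \<open>R\<close>.
\<close>

definition conductor :: "'a::field fps set \<Rightarrow> 'a fps set" where
  "conductor R = {f. fps_X ^ (2 * delta R) dvd f}"

definition conductor_preimage :: "'a::field fps \<Rightarrow> 'a fps \<Rightarrow> 'a fps fps set" where
  "conductor_preimage x y = subst2 x y -` conductor (curve_ring x y)"


subsection \<open>Instanton slice and superpolynomials\<close>

definition instanton_slice :: "'a::field fps \<Rightarrow> 'a fps \<Rightarrow> 'a fps fps set set" where
  "instanton_slice x y = {I. is_submodule UNIV I \<and> conductor_preimage x y \<subseteq> I}"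

definition max_ideal_A :: "'a::field fps fps set" where
  "max_ideal_A = prod_set UNIV {fps_X, fps_const fps_X}"

definition rho_A :: "'a::field fps fps set \<Rightarrow> nat" where
  "rho_A I = quotient_dim scaleA I (prod_set max_ideal_A I)"

definition max_ideal :: "'a::field fps set \<Rightarrow> 'a fps set" where
  "max_ideal R = {f \<in> R. fps_X dvd f}"

definition rho :: "'a::field fps set \<Rightarrow> 'a fps set \<Rightarrow> nat" where
  "rho R M = quotient_dim scaleO M (prod_set (max_ideal R) M)"

definition standard_modules :: "'a::field fps set \<Rightarrow> 'a fps set set" where
  "standard_modules R = {M. is_submodule R M \<and> prod_set UNIV M = UNIV}"

text \<open>
  The field is fixed, so \<open>q\<close> is the number of its elements. A superpolynomial is a polynomial in
  \<open>t\<close> whose coefficients are polynomials in \<open>a\<close>; the product below is \<open>(1 + a q) \<dots> (1 + a q^(k-1))\<close>.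
  Both sums are finite for the rings considered: each ideal in the slice contains an ideal of
  finite codimension, and each standard module contains the conductor.
\<close>

definition a_factor :: "nat \<Rightarrow> nat \<Rightarrow> int poly" where
  "a_factor q k = (\<Prod>i=1..<k. [:1, int q ^ i:])"

definition H_inst :: "'a::{field,finite} fps \<Rightarrow> 'a fps \<Rightarrow> int poly poly" where
  "H_inst x y = (\<Sum>I\<in>instanton_slice x y.
     monom (a_factor (card (UNIV :: 'a set)) (rho_A I)) (quotient_dim scaleA UNIV I))"

definition H_mot :: "'a::{field,finite} fps set \<Rightarrow> int poly poly" where
  "H_mot R = (\<Sum>M\<in>standard_modules R.
     monom (a_factor (card (UNIV :: 'a set)) (rho R M)) (quotient_dim scaleO UNIV M))"


subsection \<open>The presentations\<close>

definition gen_semigroup :: "nat \<Rightarrow> nat \<Rightarrow> nat \<Rightarrow> nat set" where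
  "gen_semigroup a b c = {i * a + j * b + k * c | i j k. True}"

definition presentation ::
  "nat set \<Rightarrow> nat \<Rightarrow> nat \<Rightarrow> nat \<Rightarrow> nat \<Rightarrow> 'a::field fps \<Rightarrow> 'a fps \<Rightarrow> 'a fps \<Rightarrow> bool" where
  "presentation \<Gamma> \<upsilon> r s p g x y \<longleftrightarrow>
     0 < s \<and> s < r \<and> 0 < \<upsilon> \<and> 0 < p \<and> coprime r s \<and> coprime \<upsilon> p \<and>
     of_nat s \<noteq> (0::'a) \<and>
     fps_X ^ (\<upsilon> * r + p + 1) dvd g \<and>
     x = fps_X ^ (\<upsilon> * r) + fps_X ^ (\<upsilon> * r + p) + g \<and>
     y = fps_X ^ (\<upsilon> * s) \<and>
     \<Gamma> = gen_semigroup (\<upsilon> * s) (\<upsilon> * r) (\<upsilon> * r * s + p) \<and>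
     value_semigroup (curve_ring x y) = \<Gamma>"

definition algebra_automorphism :: "('a::field fps fps \<Rightarrow> 'a fps fps) \<Rightarrow> bool" where
  "algebra_automorphism \<psi> \<longleftrightarrow> bij \<psi> \<and>
     (\<forall>f h. \<psi> (f + h) = \<psi> f + \<psi> h) \<and> (\<forall>f h. \<psi> (f * h) = \<psi> f * \<psi> h) \<and>
     (\<forall>c f. \<psi> (scaleA c f) = scaleA c (\<psi> f))"

end

theory Submission
  imports Defs
begin

text \<open>
  Put \<open>h = x^s - y^r\<close>, which has order \<open>\<upsilon>rs + p\<close> on the curve because \<open>s\<close> is invertible. Modulo large
  powers the ring \<open>A\<close> is spanned by the \<open>x^i y^j h^k\<close> with \<open>i < s\<close>, whose orders below \<open>c = 2\<delta>\<close> are pairwise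
  distinct; hence the ideal \<open>C\<close> is spanned by those of order at least \<open>c\<close> and does not depend on \<open>g\<close>.
  The same semigroup can come from different triples \<open>(\<upsilon>, r, s)\<close> only if it is \<open>\<langle>m, b\<rangle>\<close> with \<open>m\<close> and \<open>b\<close>
  coprime; then, after the shear \<open>x \<mapsto> x + y^r\<close> if \<open>s = 1\<close>, the ideal \<open>C\<close> becomes the monomial ideal of \<open>(m, b)\<close>.

  For the motivic superpolynomial, write a standard module as \<open>M = u N\<close> with a unit \<open>u\<close> and \<open>R \<subseteq> N\<close>. Counting
  pairs \<open>(M, u)\<close> turns the sum over \<open>M\<close> into a sum over \<open>N\<close> weighted by \<open>q^(dim O/N)\<close>. As the semigroup is
  symmetric, \<open>O/R\<close> is dual to \<open>A/C\<close>, so the modules \<open>N\<close> correspond to the ideals \<open>I\<close> of the slice, with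
  \<open>dim O/N = \<delta> - dim A/I\<close> and \<open>\<rho>(N) = 1 + dim (I : (x,y))/I\<close>, and everything is expressed through \<open>A/C\<close>.
\<close>

subsection \<open>Dimensions of quotients over a finite field\<close>

text \<open>The obstacle is that nothing inside O can be compared directly: the rings R for two
  choices of g are different subsets of O, and no isomorphism between them is at hand, so a standard
  module over one has no evident partner over the other. Only the finite-dimensional algebra A/C is
  common to both, and its ideals see just the modules that contain R. The weight q^(dim O/N) comes
  from normalising modules to contain R: the units of M, counted modulo z^(c+1), number (q - 1) q^(c
  - dim O/M), so M can be written as u N in that many ways and the weight evens this out. The
  duality rests on c = 2 \<delta>, which makes O/R and R/z^c O equally large, both of dimension
  \<delta>. The order of h is read off from x^s = z^(\<upsilon>rs) (1 + s z^p + ...), whose second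
  coefficient must not vanish. The slice is compared in two strengths: for equal triples the ideals
  C coincide as sets, for different triples an automorphism of A matches them.\<close>

definition finite_quotient :: "'v::ab_group_add set \<Rightarrow> 'v set \<Rightarrow> bool" where
  "finite_quotient U W \<longleftrightarrow> (\<exists>F. finite F \<and> (\<forall>u\<in>U. \<exists>f\<in>F. u - f \<in> W))"

lemma finite_quotient_mono:
  "finite_quotient V W \<Longrightarrow> U \<subseteq> V \<Longrightarrow> W \<subseteq> W' \<Longrightarrow> finite_quotient U W'"
  unfolding finite_quotient_def by (meson in_mono)

lemma quotient_basis_bij_image:
  assumes B: "quotient_basis scl U W B" and inj: "inj \<phi>"
    and add: "\<And>u v. \<phi> (u + v) = \<phi> u + \<phi> v" and scl: "\<And>c u. \<phi> (scl c u) = scl' c (\<phi> u)"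
  shows "quotient_basis scl' (\<phi> ` U) (\<phi> ` W) (\<phi> ` B)"
proof -
  have fin: "finite B" and BU: "B \<subseteq> U"
    and ex1: "\<And>u. u \<in> U \<Longrightarrow> \<exists>!c. c \<in> B \<rightarrow>\<^sub>E UNIV \<and> u - (\<Sum>b\<in>B. scl (c b) b) \<in> W"
    using B unfolding quotient_basis_def by auto
  interpret additive \<phi> by unfold_locales (rule add)
  have sum_eq: "(\<Sum>b\<in>\<phi> ` B. scl' (c b) b) = \<phi> (\<Sum>b\<in>B. scl (c (\<phi> b)) b)" for c
  proof -
    have "(\<Sum>b\<in>\<phi> ` B. scl' (c b) b) = (\<Sum>b\<in>B. scl' (c (\<phi> b)) (\<phi> b))"
      by (subst sum.reindex[OF inj_on_subset[OF inj subset_UNIV]]) (simp only: comp_def)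
    then show ?thesis by (simp only: sum scl)
  qed
  show ?thesis
    unfolding quotient_basis_def
  proof (intro conjI ballI)
    show "finite (\<phi> ` B)" "\<phi> ` B \<subseteq> \<phi> ` U" using fin BU by auto
    fix u' assume "u' \<in> \<phi> ` U"
    then obtain u where u: "u \<in> U" "u' = \<phi> u" by auto
    have mem: "u' - (\<Sum>b\<in>\<phi> ` B. scl' (c b) b) \<in> \<phi> ` W \<longleftrightarrow> u - (\<Sum>b\<in>B. scl (c (\<phi> b)) b) \<in> W" for c
      unfolding u(2) sum_eq diff[symmetric] using inj by (simp add: inj_image_mem_iff)
    from ex1[OF u(1)] obtain c where c: "c \<in> B \<rightarrow>\<^sub>E UNIV" "u - (\<Sum>b\<in>B. scl (c b) b) \<in> W"
      and uniq: "\<And>c'. c' \<in> B \<rightarrow>\<^sub>E UNIV \<Longrightarrow> u - (\<Sum>b\<in>B. scl (c' b) b) \<in> W \<Longrightarrow> c' = c" by (blast elim: ex1E)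
    show "\<exists>!c. c \<in> \<phi> ` B \<rightarrow>\<^sub>E UNIV \<and> u' - (\<Sum>b\<in>\<phi> ` B. scl' (c b) b) \<in> \<phi> ` W"
    proof (rule ex1I[of _ "restrict (\<lambda>b. c (the_inv \<phi> b)) (\<phi> ` B)"], intro conjI)
      show "u' - (\<Sum>b\<in>\<phi> ` B. scl' (restrict (\<lambda>b. c (the_inv \<phi> b)) (\<phi> ` B) b) b) \<in> \<phi> ` W"
        unfolding mem using c(2) inj by (simp add: the_inv_f_f cong: sum.cong)
      fix c' assume c': "c' \<in> \<phi> ` B \<rightarrow>\<^sub>E UNIV \<and> u' - (\<Sum>b\<in>\<phi> ` B. scl' (c' b) b) \<in> \<phi> ` W"
      have "restrict (c' \<circ> \<phi>) B = c"
        by (rule uniq) (use c' in \<open>auto simp: mem cong: sum.cong\<close>)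
      then have "c' (\<phi> b) = c b" if "b \<in> B" for b using that by (metis comp_apply restrict_apply')
      then show "c' = restrict (\<lambda>b. c (the_inv \<phi> b)) (\<phi> ` B)"
        using c' inj by (intro ext) (auto simp: the_inv_f_f restrict_def PiE_def extensional_def)
    qed simp
  qed
qed

text \<open>Both definite descriptions range over the same numbers, so the equality also holds where
  no finite basis exists and no finiteness has to be carried along.\<close>

lemma quotient_dim_bij_image:
  assumes bij: "bij \<phi>"
    and add: "\<And>u v. \<phi> (u + v) = \<phi> u + \<phi> v" and scl: "\<And>c u. \<phi> (scl c u) = scl' c (\<phi> u)"
  shows "quotient_dim scl' (\<phi> ` U) (\<phi> ` W) = quotient_dim scl U W"
proof -
  have inv: "the_inv \<phi> (\<phi> u) = u" "\<phi> (the_inv \<phi> v) = v" for u v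
    using bij by (auto simp: bij_def the_inv_f_f f_the_inv_into_f)
  have "(\<exists>B. quotient_basis scl' (\<phi> ` U) (\<phi> ` W) B \<and> card B = n) \<longleftrightarrow>
        (\<exists>B. quotient_basis scl U W B \<and> card B = n)" for n
  proof
    assume "\<exists>B. quotient_basis scl U W B \<and> card B = n"
    then show "\<exists>B. quotient_basis scl' (\<phi> ` U) (\<phi> ` W) B \<and> card B = n"
      using quotient_basis_bij_image[of scl U W _ \<phi> scl'] add scl bij
      by (metis bij_betw_imp_inj_on card_image inj_on_subset subset_UNIV)
  next
    assume "\<exists>B. quotient_basis scl' (\<phi> ` U) (\<phi> ` W) B \<and> card B = n"
    then obtain B where B: "quotient_basis scl' (\<phi> ` U) (\<phi> ` W) B" "card B = n" by auto
    have i: "inj (the_inv \<phi>)" by (metis inj_def inv(2))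
    have "quotient_basis scl (the_inv \<phi> ` \<phi> ` U) (the_inv \<phi> ` \<phi> ` W) (the_inv \<phi> ` B)"
      by (rule quotient_basis_bij_image[OF B(1) i]; metis inv add scl)
    moreover have "the_inv \<phi> ` \<phi> ` S = S" for S by (auto simp: image_image inv)
    ultimately show "\<exists>B. quotient_basis scl U W B \<and> card B = n"
      using B(2) i by (metis card_image inj_on_subset subset_UNIV)
  qed
  then show ?thesis unfolding quotient_dim_def by simp
qed

locale finite_field_space = vector_space scl
  for scl :: "'k::{field,finite} \<Rightarrow> 'v::ab_group_add \<Rightarrow> 'v"
begin

text \<open>Over a finite field dimensions of quotients may be compared by an arbitrary injection of cosets.\<close>

lemma quotient_basis_card_le:
  assumes B: "quotient_basis scl U W B" and B': "quotient_basis (scl' :: 'k \<Rightarrow> 'w::ab_group_add \<Rightarrow> 'w) U' W' B'"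
    and U: "subspace U" and W: "subspace W" and W': "\<And>a b. a \<in> W' \<Longrightarrow> b \<in> W' \<Longrightarrow> b - a \<in> W'"
    and maps: "\<And>u. u \<in> U \<Longrightarrow> \<phi> u \<in> U'"
    and inj: "\<And>u v. u \<in> U \<Longrightarrow> v \<in> U \<Longrightarrow> \<phi> u - \<phi> v \<in> W' \<Longrightarrow> u - v \<in> W"
  shows "card B \<le> card B'"
proof -
  have fin: "finite B" "finite B'" and BU: "B \<subseteq> U"
    and ex1: "\<And>u. u \<in> U \<Longrightarrow> \<exists>!c. c \<in> B \<rightarrow>\<^sub>E UNIV \<and> u - (\<Sum>b\<in>B. scl (c b) b) \<in> W"
    and ex1': "\<And>u. u \<in> U' \<Longrightarrow> \<exists>!c. c \<in> B' \<rightarrow>\<^sub>E UNIV \<and> u - (\<Sum>b\<in>B'. scl' (c b) b) \<in> W'"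
    using B B' unfolding quotient_basis_def by auto
  \<comment> \<open>\<open>s\<close> lists one representative for each coset of U/W. Passing to the
    coefficients of its image in U'/W' is injective, which gives q^card B \<le> q^card B'.\<close>
  define s where "s c = (\<Sum>b\<in>B. scl (c b) b)" for c
  have s: "s c \<in> U" for c unfolding s_def using BU U by (auto intro: subspace_sum subspace_scale)
  have "\<forall>c. \<exists>c'. c' \<in> B' \<rightarrow>\<^sub>E UNIV \<and> \<phi> (s c) - (\<Sum>b\<in>B'. scl' (c' b) b) \<in> W'"
    using ex1' maps s by blast
  then obtain g where g: "\<And>c. g c \<in> B' \<rightarrow>\<^sub>E UNIV" "\<And>c. \<phi> (s c) - (\<Sum>b\<in>B'. scl' (g c b) b) \<in> W'"
    by metis
  have "inj_on g (B \<rightarrow>\<^sub>E UNIV)"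
  proof (rule inj_onI)
    fix c d assume c: "c \<in> B \<rightarrow>\<^sub>E UNIV" and d: "d \<in> B \<rightarrow>\<^sub>E UNIV" and eq: "g c = g d"
    have "\<phi> (s c) - \<phi> (s d) \<in> W'"
      using W'[OF g(2)[of d] g(2)[of c]] eq by simp
    then have "s c - s d \<in> W" using inj s by blast
    moreover have "s c - s c \<in> W" using W by (simp add: subspace_0)
    ultimately show "c = d" using ex1[OF s[of c]] c d unfolding s_def[symmetric] by auto
  qed
  then have "card (B \<rightarrow>\<^sub>E (UNIV :: 'k set)) \<le> card (B' \<rightarrow>\<^sub>E (UNIV :: 'k set))"
    using g(1) fin by (intro card_inj_on_le[of g]) (auto intro: finite_PiE)
  then have "card (UNIV :: 'k set) ^ card B \<le> card (UNIV :: 'k set) ^ card B'"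
    using fin by (simp add: card_PiE)
  moreover have "card (UNIV :: 'k set) > 1"
    using card_mono[of "UNIV :: 'k set" "{0,1}"] by simp
  ultimately show ?thesis by simp
qed

text \<open>Gives the definite description in \<open>quotient_dim\<close> a value: the identity map
  compares any two bases in both directions.\<close>

lemma quotient_dim_eq:
  assumes B: "quotient_basis scl U W B" and U: "subspace U" and W: "subspace W"
  shows "quotient_dim scl U W = card B"
  unfolding quotient_dim_def
proof (rule the_equality)
  fix n assume "\<exists>B'. quotient_basis scl U W B' \<and> card B' = n"
  then obtain B' where B': "quotient_basis scl U W B'" "card B' = n" by auto
  have "card B1 \<le> card B2" if "quotient_basis scl U W B1" "quotient_basis scl U W B2" for B1 B2
    using quotient_basis_card_le[OF that U W, of "\<lambda>u. u"] W by (simp add: subspace_diff)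
  with B B' show "n = card B" by (metis le_antisym)
qed (use B in auto)

text \<open>U and W may both be infinite-dimensional with only U/W finite. Hence nested bases of
  arbitrary size, with finiteness proved for their difference alone.\<close>

lemma quotient_basis_Diff:
  assumes ind: "independent BU" and sub: "BW \<subseteq> BU"
    and fin: "finite_quotient (span BU) (span BW)"
  shows "quotient_basis scl (span BU) (span BW) (BU - BW)"
proof -
  define B where "B = BU - BW"
  have notin: "b \<notin> span (BU - {b})" if "b \<in> BU" for b
    using ind that dependent_def by blast
  obtain F where F: "finite F" "\<forall>u\<in>span BU. \<exists>f\<in>F. u - f \<in> span BW"
    using fin unfolding finite_quotient_def by auto
  then obtain h where h: "\<And>u. u \<in> span BU \<Longrightarrow> h u \<in> F \<and> u - h u \<in> span BW" by metis
  \<comment> \<open>Two elements of B with the same representative differ by an element of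
    \<open>span BW\<close>, which would make one of them dependent on the rest of
    \<open>BU\<close>.\<close>
  have "inj_on h B"
  proof (rule inj_onI, rule ccontr)
    fix a b assume a: "a \<in> B" and b: "b \<in> B" and eq: "h a = h b" and ne: "a \<noteq> b"
    have "a \<in> span BU" "b \<in> span BU" using a b by (auto simp: B_def span_base)
    then have "a - b \<in> span BW" using h[of a] h[of b] eq span_diff[of "a - h a" BW "b - h b"] by simp
    then have "a - b \<in> span (BU - {a})" using span_mono[of BW "BU - {a}"] a sub by (auto simp: B_def)
    moreover have "b \<in> span (BU - {a})" using b ne by (auto simp: B_def span_base)
    ultimately have "a \<in> span (BU - {a})" using span_add by fastforce
    then show False using notin a by (auto simp: B_def)
  qed
  moreover have "h ` B \<subseteq> F" using h by (auto simp: B_def span_base)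
  ultimately have finB: "finite B" using F(1) by (meson finite_imageD finite_subset)
  have indep: "d b = 0" if "(\<Sum>b\<in>B. scl (d b) b) \<in> span BW" "b \<in> B" for d b
  proof (rule ccontr)
    assume nz: "d b \<noteq> 0"
    have bU: "b \<in> BU" using that by (auto simp: B_def)
    have "(\<Sum>b\<in>B. scl (d b) b) = scl (d b) b + (\<Sum>b\<in>B - {b}. scl (d b) b)"
      using that finB by (simp add: sum.remove)
    then have "scl (d b) b = (\<Sum>b\<in>B. scl (d b) b) - (\<Sum>b\<in>B - {b}. scl (d b) b)" by simp
    also have "\<dots> \<in> span (BU - {b})"
    proof (rule span_diff)
      show "(\<Sum>b\<in>B. scl (d b) b) \<in> span (BU - {b})"
        using that span_mono[of BW "BU - {b}"] sub by (auto simp: B_def)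
      show "(\<Sum>b\<in>B - {b}. scl (d b) b) \<in> span (BU - {b})"
        by (intro span_sum span_scale span_base) (auto simp: B_def)
    qed
    finally have "scl (inverse (d b)) (scl (d b) b) \<in> span (BU - {b})" by (rule span_scale)
    then show False using notin[OF bU] nz by simp
  qed
  show ?thesis
    unfolding quotient_basis_def B_def[symmetric]
  proof (intro conjI ballI)
    show "finite B" by fact
    show "B \<subseteq> span BU" by (auto simp: B_def span_base)
    fix u assume u: "u \<in> span BU"
    have "BU = BW \<union> B" using sub by (auto simp: B_def)
    with u obtain v w where vw: "u = v + w" "v \<in> span BW" "w \<in> span B"
      using span_Un[of BW B] by auto
    then obtain c where c: "w = (\<Sum>b\<in>B. scl (c b) b)" using span_finite[OF finB] by auto
    show "\<exists>!c. c \<in> B \<rightarrow>\<^sub>E UNIV \<and> u - (\<Sum>b\<in>B. scl (c b) b) \<in> span BW"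
    proof (rule ex1I[of _ "restrict c B"], intro conjI)
      show "u - (\<Sum>b\<in>B. scl (restrict c B b) b) \<in> span BW" using vw c by (simp cong: sum.cong)
      fix c' assume c': "c' \<in> B \<rightarrow>\<^sub>E UNIV \<and> u - (\<Sum>b\<in>B. scl (c' b) b) \<in> span BW"
      have "(\<Sum>b\<in>B. scl (c b - c' b) b) = (u - (\<Sum>b\<in>B. scl (c' b) b)) - v"
        using vw c by (simp add: scale_left_diff_distrib sum_subtractf)
      also have "\<dots> \<in> span BW" using c' vw by (blast intro: span_diff)
      finally have "c b - c' b = 0" if "b \<in> B" for b using indep[of "\<lambda>b. c b - c' b"] that by auto
      then show "c' = restrict c B"
        using c' by (intro ext) (auto simp: restrict_def PiE_def extensional_def)
    qed simp
  qed
qed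

lemma basis_extend:
  assumes "subspace U" "BW \<subseteq> U" "independent BW"
  obtains BU where "BW \<subseteq> BU" "independent BU" "span BU = U"
  using maximal_independent_subset_extend[OF assms(2,3)] assms(1)
  by (metis span_minimal subset_antisym)

lemma quotient_basis_exists:
  assumes "subspace U" "subspace W" "W \<subseteq> U" "finite_quotient U W"
  obtains B where "quotient_basis scl U W B"
proof -
  obtain BW where BW: "independent BW" "span BW = W"
    using basis_extend[OF assms(2), of "{}"] independent_empty by auto
  then have "BW \<subseteq> U" using assms(3) span_superset by blast
  then obtain BU where "BW \<subseteq> BU" "independent BU" "span BU = U"
    using basis_extend[OF assms(1) _ BW(1)] by auto
  then show thesis using quotient_basis_Diff[of BU BW] BW assms(4) that by auto
qed

text \<open>With nested bases of W, U and V, the difference \<open>BV - BW\<close> is the disjoint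
  union of the other two.\<close>

lemma quotient_dim_add:
  assumes V: "subspace V" and U: "subspace U" and W: "subspace W" and sub: "W \<subseteq> U" "U \<subseteq> V"
    and fin: "finite_quotient V W"
  shows "quotient_dim scl V W = quotient_dim scl V U + quotient_dim scl U W"
proof -
  obtain BW where BW: "independent BW" "span BW = W" using basis_extend[OF W, of "{}"] independent_empty by auto
  then have "BW \<subseteq> U" using sub span_superset by blast
  then obtain BU where BU: "BW \<subseteq> BU" "independent BU" "span BU = U"
    using basis_extend[OF U _ BW(1)] by auto
  then have "BU \<subseteq> V" using sub span_superset by blast
  then obtain BV where BV: "BU \<subseteq> BV" "independent BV" "span BV = V"
    using basis_extend[OF V _ BU(2)] by auto
  have fins: "finite_quotient V U" "finite_quotient U W"
    using finite_quotient_mono[OF fin] sub by auto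
  have VW: "quotient_basis scl V W (BV - BW)" and VU: "quotient_basis scl V U (BV - BU)"
    and UW: "quotient_basis scl U W (BU - BW)"
    using quotient_basis_Diff[of BV BW] quotient_basis_Diff[of BV BU] quotient_basis_Diff[of BU BW]
      BW BU BV fin fins by auto
  have "BV - BW = (BV - BU) \<union> (BU - BW)" "(BV - BU) \<inter> (BU - BW) = {}" using BU BV by auto
  moreover have "finite (BV - BU)" "finite (BU - BW)" using VU UW by (auto simp: quotient_basis_def)
  ultimately have "card (BV - BW) = card (BV - BU) + card (BU - BW)"
    by (simp add: card_Un_disjoint)
  then show ?thesis
    using quotient_dim_eq[OF VW V W] quotient_dim_eq[OF VU V U] quotient_dim_eq[OF UW U W] by simp
qed

lemma quotient_dim_eq_0:
  assumes "subspace U" "subspace W" "W \<subseteq> U" "finite_quotient U W" "quotient_dim scl U W = 0"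
  shows "U = W"
proof -
  obtain B where B: "quotient_basis scl U W B" using quotient_basis_exists assms by metis
  then have "card B = 0" using quotient_dim_eq assms by metis
  then have "B = {}" using B by (auto simp: quotient_basis_def)
  then show ?thesis using B assms(3) by (auto simp: quotient_basis_def)
qed

lemma subspace_eqI_quotient_dim:
  assumes "subspace V" "subspace U" "subspace W" "W \<subseteq> U" "U \<subseteq> V" "finite_quotient V W"
    and "quotient_dim scl V W = quotient_dim scl U W"
  shows "U = V"
proof -
  have "quotient_dim scl V U = 0" using quotient_dim_add[of V U W] assms by simp
  moreover have "finite_quotient V U" using finite_quotient_mono[OF assms(6)] assms by auto
  ultimately show ?thesis using quotient_dim_eq_0[of V U] assms by auto
qed

end

subsection \<open>Perfect pairings of quotients\<close>

locale finite_pairing = left: finite_field_space sL + right: finite_field_space sR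
  for sL :: "'k::{field,finite} \<Rightarrow> 'l::ab_group_add \<Rightarrow> 'l"
    and sR :: "'k \<Rightarrow> 'r::ab_group_add \<Rightarrow> 'r" +
  fixes P :: "'l \<Rightarrow> 'r \<Rightarrow> 'k"
  assumes add_left: "P (l + l') r = P l r + P l' r"
    and scale_left: "P (sL c l) r = c * P l r"
    and add_right: "P l (r + r') = P l r + P l r'"
    and scale_right: "P l (sR c r) = c * P l r"
begin

lemma finite_pairing_swap: "finite_pairing sR sL (\<lambda>r l. P l r)"
  by unfold_locales (simp_all add: add_left add_right scale_left scale_right)

lemma zero_left [simp]: "P 0 r = 0"
  using scale_left[of 0 0 r] by simp

lemma zero_right [simp]: "P l 0 = 0"
  using scale_right[of l 0 0] by simp

lemma diff_left: "P (l - l') r = P l r - P l' r"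
  using add_left[of "l - l'" l' r] by simp

lemma sum_right: "P l (\<Sum>b\<in>B. f b) = (\<Sum>b\<in>B. P l (f b))"
  by (induction B rule: infinite_finite_induct) (simp_all add: add_right)

text \<open>The pairing embeds L/L0 into the dual of R/R0, which has as many elements as
  R/R0.\<close>

lemma quotient_dim_le:
  assumes L: "left.subspace L" "left.subspace L0" "L0 \<subseteq> L" "finite_quotient L L0"
    and R: "right.subspace R" "right.subspace R0" "R0 \<subseteq> R" "finite_quotient R R0"
    and vanish: "\<And>l r. l \<in> L \<Longrightarrow> r \<in> R0 \<Longrightarrow> P l r = 0"
    and nondeg: "\<And>l. l \<in> L \<Longrightarrow> (\<And>r. r \<in> R \<Longrightarrow> P l r = 0) \<Longrightarrow> l \<in> L0"
  shows "quotient_dim sL L L0 \<le> quotient_dim sR R R0"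
proof -
  obtain B where B: "quotient_basis sL L L0 B" using left.quotient_basis_exists L by metis
  obtain B' where B': "quotient_basis sR R R0 B'" using right.quotient_basis_exists R by metis
  then have B'R: "B' \<subseteq> R"
    and ex1: "\<And>u. u \<in> R \<Longrightarrow> \<exists>!c. c \<in> B' \<rightarrow>\<^sub>E UNIV \<and> u - (\<Sum>b\<in>B'. sR (c b) b) \<in> R0"
    unfolding quotient_basis_def by auto
  \<comment> \<open>The values of \<open>P l\<close> on the basis B' become coordinates in R. This
    replaces the dual of R/R0 by R/R0 itself, so that cosets can be counted.\<close>
  define \<phi> where "\<phi> l = (\<Sum>b\<in>B'. sR (P l b) b)" for l
  have \<phi>: "\<phi> l \<in> R" for l
    unfolding \<phi>_def using B'R R(1) by (auto intro: right.subspace_sum right.subspace_scale)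
  have "card B \<le> card B'"
  proof (rule left.quotient_basis_card_le[OF B B' L(1,2)])
    show "\<And>a b. a \<in> R0 \<Longrightarrow> b \<in> R0 \<Longrightarrow> b - a \<in> R0" using R(2) by (simp add: right.subspace_diff)
    show "\<phi> l \<in> R" for l by (rule \<phi>)
    fix l l' assume l: "l \<in> L" and l': "l' \<in> L" and d: "\<phi> l - \<phi> l' \<in> R0"
    have "(\<Sum>b\<in>B'. sR (restrict (P m) B' b) b) = \<phi> m" for m
      unfolding \<phi>_def by (rule sum.cong) auto
    moreover have "\<phi> l - \<phi> l \<in> R0" using R(2) by (simp add: right.subspace_0)
    ultimately have "restrict (P m) B' \<in> B' \<rightarrow>\<^sub>E UNIV \<and> \<phi> l - (\<Sum>b\<in>B'. sR (restrict (P m) B' b) b) \<in> R0"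
      if "m \<in> {l, l'}" for m
      using d that by auto
    then have "restrict (P l) B' = restrict (P l') B'"
      using ex1[OF \<phi>[of l]] by blast
    then have eq: "P l b = P l' b" if "b \<in> B'" for b using that by (metis restrict_apply')
    have ll: "l - l' \<in> L" using l l' L(1) by (simp add: left.subspace_diff)
    show "l - l' \<in> L0"
    proof (rule nondeg[OF ll])
      fix r assume "r \<in> R"
      then obtain c where c: "r - (\<Sum>b\<in>B'. sR (c b) b) \<in> R0" using ex1 by blast
      have "P (l - l') r = P (l - l') ((r - (\<Sum>b\<in>B'. sR (c b) b)) + (\<Sum>b\<in>B'. sR (c b) b))" by simp
      also have "\<dots> = 0"
        unfolding add_right using vanish[OF ll c] eq by (simp add: sum_right scale_right diff_left)
      finally show "P (l - l') r = 0" .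
    qed
  qed
  then show ?thesis
    using left.quotient_dim_eq[OF B L(1,2)] right.quotient_dim_eq[OF B' R(1,2)] by simp
qed

end

locale perfect_pairing = finite_pairing sL sR P
  for sL :: "'k::{field,finite} \<Rightarrow> 'l::ab_group_add \<Rightarrow> 'l"
    and sR :: "'k \<Rightarrow> 'r::ab_group_add \<Rightarrow> 'r"
    and P :: "'l \<Rightarrow> 'r \<Rightarrow> 'k" +
  fixes L0 :: "'l set" and R0 :: "'r set"
  assumes subspace_L0: "left.subspace L0" and subspace_R0: "right.subspace R0"
    and finite_L0: "finite_quotient UNIV L0" and finite_R0: "finite_quotient UNIV R0"
    and L0_iff: "l \<in> L0 \<longleftrightarrow> (\<forall>r. P l r = 0)"
    and R0_iff: "r \<in> R0 \<longleftrightarrow> (\<forall>l. P l r = 0)"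
begin

lemma perfect_pairing_swap: "perfect_pairing sR sL (\<lambda>r l. P l r) R0 L0"
  using finite_pairing_swap subspace_L0 subspace_R0 finite_L0 finite_R0 L0_iff R0_iff
  by (simp add: perfect_pairing_def perfect_pairing_axioms_def)

definition perp :: "'r set \<Rightarrow> 'l set" where
  "perp N = {l. \<forall>r\<in>N. P l r = 0}"

lemma subspace_perp: "left.subspace (perp N)"
  by (rule left.subspaceI) (simp_all add: perp_def add_left scale_left)

lemma L0_subset_perp: "L0 \<subseteq> perp N"
  by (auto simp: perp_def L0_iff)

lemma quotient_dim_UNIV: "quotient_dim sL UNIV L0 = quotient_dim sR UNIV R0"
proof (rule antisym)
  show "quotient_dim sL UNIV L0 \<le> quotient_dim sR UNIV R0"
    by (rule quotient_dim_le)
      (use subspace_L0 subspace_R0 finite_L0 finite_R0 L0_iff R0_iff in auto)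
  interpret sw: finite_pairing sR sL "\<lambda>r l. P l r" by (rule finite_pairing_swap)
  show "quotient_dim sR UNIV R0 \<le> quotient_dim sL UNIV L0"
    by (rule sw.quotient_dim_le)
      (use subspace_L0 subspace_R0 finite_L0 finite_R0 L0_iff R0_iff in auto)
qed

text \<open>Nondegeneracy bounds each dimension from above; the two bounds add up to the common
  value in \<open>quotient_dim_UNIV\<close>, so both are attained.\<close>

lemma
  assumes N: "right.subspace N" "R0 \<subseteq> N"
  shows quotient_dim_perp: "quotient_dim sL UNIV (perp N) = quotient_dim sR N R0"
    and quotient_dim_perp_L0: "quotient_dim sL (perp N) L0 = quotient_dim sR UNIV N"
proof -
  have finL: "finite_quotient UNIV (perp N)" "finite_quotient (perp N) L0"
    using finite_quotient_mono[OF finite_L0] L0_subset_perp by auto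
  have finR: "finite_quotient UNIV N" "finite_quotient N R0"
    using finite_quotient_mono[OF finite_R0] N by auto
  have "quotient_dim sL UNIV (perp N) \<le> quotient_dim sR N R0"
    by (rule quotient_dim_le)
      (use subspace_R0 R0_iff N finL finR subspace_perp in \<open>auto simp: perp_def\<close>)
  moreover have "quotient_dim sL (perp N) L0 \<le> quotient_dim sR UNIV N"
    by (rule quotient_dim_le)
      (use subspace_L0 L0_iff L0_subset_perp N finL finR subspace_perp in \<open>auto simp: perp_def\<close>)
  moreover have "quotient_dim sL UNIV L0 = quotient_dim sL UNIV (perp N) + quotient_dim sL (perp N) L0"
    by (rule left.quotient_dim_add) (use subspace_perp L0_subset_perp subspace_L0 finite_L0 in auto)
  moreover have "quotient_dim sR UNIV R0 = quotient_dim sR UNIV N + quotient_dim sR N R0"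
    by (rule right.quotient_dim_add) (use N subspace_R0 finite_R0 in auto)
  ultimately show "quotient_dim sL UNIV (perp N) = quotient_dim sR N R0"
    "quotient_dim sL (perp N) L0 = quotient_dim sR UNIV N"
    using quotient_dim_UNIV by auto
qed

text \<open>The double annihilator contains N, and two applications of the dimension formula show
  that it is no larger.\<close>

lemma perp_perp:
  assumes N: "right.subspace N" "R0 \<subseteq> N"
  shows "perfect_pairing.perp (\<lambda>r l. P l r) (perp N) = N"
proof -
  interpret sw: perfect_pairing sR sL "\<lambda>r l. P l r" R0 L0 by (rule perfect_pairing_swap)
  have sub: "N \<subseteq> sw.perp (perp N)" by (auto simp: sw.perp_def perp_def)
  have "quotient_dim sR (sw.perp (perp N)) R0 = quotient_dim sR N R0"
    using sw.quotient_dim_perp_L0[OF subspace_perp L0_subset_perp] quotient_dim_perp[OF N] by simp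
  moreover have "finite_quotient (sw.perp (perp N)) R0"
    using finite_quotient_mono[OF finite_R0] by auto
  ultimately show ?thesis
    using right.subspace_eqI_quotient_dim[OF sw.subspace_perp N(1) subspace_R0 N(2) sub] by simp
qed

end

subsection \<open>Substitution in the ring of power series in two variables\<close>

abbreviation Y_A :: "'a::comm_ring_1 fps fps" where
  "Y_A \<equiv> fps_const fps_X"

lemma fps_eq_const_plus_X_shift: "f = fps_const (fps_nth f 0) + fps_X * fps_shift 1 (f :: 'a::comm_ring_1 fps)"
  by (rule fps_ext) (simp add: fps_X_mult_nth)

text \<open>Modulo (X^N, Y^N) the ring A is spanned by monomials. This replaces limit arguments: a
  claim modulo high order needs to be checked only on monomials and on multiples of X^N and
  Y^N.\<close>

lemma fps_fps_eq_UNIV: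
  fixes T :: "'a::comm_ring_1 fps fps set"
  assumes add: "\<And>f g. f \<in> T \<Longrightarrow> g \<in> T \<Longrightarrow> f + g \<in> T"
    and monomial: "\<And>c a b. scaleA c (fps_X ^ a * Y_A ^ b) \<in> T"
    and X: "\<And>f. fps_X ^ N * f \<in> T" and Y: "\<And>f. Y_A ^ N * f \<in> T"
  shows "f \<in> T"
proof -
  have c: "fps_X ^ a * (Y_A ^ k * fps_const c) \<in> T" if "k \<le> N" for a k and c :: "'a fps"
    using that
  proof (induction k arbitrary: c rule: inc_induct)
    case base
    then show ?case using Y[of "fps_X ^ a * fps_const c"] by (simp only: mult.left_commute[of "fps_X ^ a"])
  next
    case (step k)
    have "fps_const c = fps_const (fps_const (fps_nth c 0)) + Y_A * fps_const (fps_shift 1 c)"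
      by (subst fps_eq_const_plus_X_shift[of c]) (simp flip: fps_const_add fps_const_mult)
    then have "fps_X ^ a * (Y_A ^ k * fps_const c) = scaleA (fps_nth c 0) (fps_X ^ a * Y_A ^ k)
        + fps_X ^ a * (Y_A ^ Suc k * fps_const (fps_shift 1 c))"
      by (simp only: power_Suc distrib_left mult_ac)
    also have "\<dots> \<in> T" by (intro add monomial step)
    finally show ?case .
  qed
  have "fps_X ^ k * f \<in> T" if "k \<le> N" for k f
    using that
  proof (induction k arbitrary: f rule: inc_induct)
    case base
    then show ?case using X by simp
  next
    case (step k)
    have "fps_X ^ k * f = fps_X ^ k * (Y_A ^ 0 * fps_const (fps_nth f 0)) + fps_X ^ Suc k * fps_shift 1 f"
      by (subst fps_eq_const_plus_X_shift[of f]) (simp add: distrib_left mult_ac)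
    also have "\<dots> \<in> T" by (intro add c step) simp
    finally show ?case .
  qed
  from this[of 0 f] show ?thesis by simp
qed

section \<open>Powers of the maximal ideal (x, y), and substitution endomorphisms of A\<close>

definition order_ge :: "nat \<Rightarrow> 'a::comm_ring_1 fps fps set" where
  "order_ge n = {f. \<forall>i j. i + j < n \<longrightarrow> fps_nth (fps_nth f i) j = 0}"

lemma order_ge_add: "f \<in> order_ge n \<Longrightarrow> g \<in> order_ge n \<Longrightarrow> f + g \<in> order_ge n"
  and order_ge_diff: "f \<in> order_ge n \<Longrightarrow> g \<in> order_ge n \<Longrightarrow> f - g \<in> order_ge n"
  by (auto simp: order_ge_def)

lemma order_ge_sum: "(\<And>i. i \<in> I \<Longrightarrow> f i \<in> order_ge n) \<Longrightarrow> sum f I \<in> order_ge n"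
  by (auto simp: order_ge_def fps_sum_nth intro!: sum.neutral)

lemma order_ge_0 [simp]: "f \<in> order_ge 0"
  by (simp add: order_ge_def)

lemma order_ge_mono: "f \<in> order_ge n \<Longrightarrow> m \<le> n \<Longrightarrow> f \<in> order_ge m"
  by (auto simp: order_ge_def)

lemma order_ge_mult:
  assumes "f \<in> order_ge m" "g \<in> order_ge n"
  shows "f * g \<in> order_ge (m + n)"
  unfolding order_ge_def
proof (intro CollectI allI impI)
  fix i j assume ij: "i + j < m + n"
  have "fps_nth (fps_nth f k) l * fps_nth (fps_nth g (i - k)) (j - l) = 0" if "k \<le> i" "l \<le> j" for k l
  proof (cases "k + l < m")
    case False
    then have "(i - k) + (j - l) < n" using that ij by linarith
    then show ?thesis using assms by (simp add: order_ge_def)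
  qed (use assms in \<open>simp add: order_ge_def\<close>)
  then show "fps_nth (fps_nth (f * g) i) j = 0"
    by (simp add: fps_mult_nth fps_sum_nth)
qed

lemma order_ge_mult_left: "g \<in> order_ge n \<Longrightarrow> f * g \<in> order_ge n"
  using order_ge_mult[of f 0 g n] by simp

lemma order_ge_power: "f \<in> order_ge 1 \<Longrightarrow> f ^ n \<in> order_ge n"
  by (induction n) (use order_ge_mult[of f 1] in auto)

text \<open>The filtration is separated, so an identity in A may be proved modulo each order in
  turn.\<close>

lemma order_ge_eq_0: "(\<And>n. f \<in> order_ge n) \<Longrightarrow> f = 0"
  by (intro fps_ext) (auto simp: order_ge_def intro: exI[of _ "Suc _"])

lemma order_ge_1_iff: "f \<in> order_ge (Suc 0) \<longleftrightarrow> fps_nth (fps_nth f 0) 0 = 0"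
  by (auto simp: order_ge_def)

lemma X_order_ge [simp]: "fps_X \<in> order_ge (Suc 0)" and Y_order_ge [simp]: "Y_A \<in> order_ge (Suc 0)"
  by (auto simp: order_ge_1_iff)

text \<open>This is f(u, v). If u and v have no constant term, then u^a v^b has order at least a +
  b, so exponents above i + j cannot reach the coefficient at (i, j) and the sum may be cut
  there.\<close>

definition subst_A :: "'a::comm_ring_1 fps fps \<Rightarrow> 'a fps fps \<Rightarrow> 'a fps fps \<Rightarrow> 'a fps fps" where
  "subst_A u v f = Abs_fps (\<lambda>i. Abs_fps (\<lambda>j.
     \<Sum>a\<le>i + j. \<Sum>b\<le>i + j. fps_nth (fps_nth f a) b * fps_nth (fps_nth (u ^ a * v ^ b) i) j))"

lemma subst_A_add: "subst_A u v (f + g) = subst_A u v f + subst_A u v g"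
  by (intro fps_ext) (simp add: subst_A_def distrib_right sum.distrib)

lemma subst_A_scale: "subst_A u v (scaleA c f) = scaleA c (subst_A u v f)"
  by (intro fps_ext) (simp add: subst_A_def sum_distrib_left mult_ac)

context
  fixes u v :: "'a::comm_ring_1 fps fps"
  assumes u: "u \<in> order_ge 1" and v: "v \<in> order_ge 1"
begin

private lemma monomial_order: "n \<le> a \<or> n \<le> b \<Longrightarrow> w * (u ^ a * v ^ b) \<in> order_ge n"
  by (metis mult.commute order_ge_mono order_ge_mult_left order_ge_power u v)

private definition partial :: "nat \<Rightarrow> 'a fps fps \<Rightarrow> 'a fps fps" where
  "partial N f = (\<Sum>a\<le>N. \<Sum>b\<le>N. scaleA (fps_nth (fps_nth f a) b) (u ^ a * v ^ b))"

private lemma subst_A_partial: "subst_A u v f - partial N f \<in> order_ge (Suc N)"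
  unfolding order_ge_def
proof (intro CollectI allI impI)
  fix i j assume ij: "i + j < Suc N"
  define t where "t a b = fps_nth (fps_nth f a) b * fps_nth (fps_nth (u ^ a * v ^ b) i) j" for a b
  have 0: "t a b = 0" if "i + j < a \<or> i + j < b" for a b
    using monomial_order[of "Suc (i + j)" a b 1] that by (auto simp: t_def order_ge_def)
  have "fps_nth (fps_nth (partial N f) i) j = (\<Sum>a\<le>N. \<Sum>b\<le>N. t a b)"
    by (simp add: partial_def fps_sum_nth t_def)
  also have "\<dots> = (\<Sum>a\<le>i + j. \<Sum>b\<le>N. t a b)"
    by (rule sum.mono_neutral_right) (use ij 0 in \<open>auto intro!: sum.neutral\<close>)
  also have "\<dots> = (\<Sum>a\<le>i + j. \<Sum>b\<le>i + j. t a b)"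
    by (intro sum.cong refl sum.mono_neutral_right) (use ij 0 in auto)
  finally show "fps_nth (fps_nth (subst_A u v f - partial N f) i) j = 0"
    by (simp add: subst_A_def t_def)
qed

lemma subst_A_X_mult: "subst_A u v (fps_X * f) = u * subst_A u v f"
proof -
  have "subst_A u v (fps_X * f) - u * subst_A u v f \<in> order_ge N" for N
  proof -
    have "partial (Suc N) (fps_X * f) = (\<Sum>a\<le>N. \<Sum>b\<le>Suc N. scaleA (fps_nth (fps_nth f a) b) (u ^ Suc a * v ^ b))"
      unfolding partial_def by (subst sum.atMost_Suc_shift) (simp add: fps_X_mult_nth)
    also have "\<dots> = u * partial N f + (\<Sum>a\<le>N. scaleA (fps_nth (fps_nth f a) (Suc N)) (u ^ Suc a * v ^ Suc N))"
      by (simp add: partial_def sum.distrib sum_distrib_left mult_ac)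
    \<comment> \<open>The shift moves the square of exponents by one, so the two truncations differ
      only along the edge b = Suc N, whose terms have order at least N.\<close>
    finally have eq: "partial (Suc N) (fps_X * f) - u * partial N f =
        (\<Sum>a\<le>N. scaleA (fps_nth (fps_nth f a) (Suc N)) (u ^ Suc a * v ^ Suc N))" by simp
    have 1: "partial (Suc N) (fps_X * f) - u * partial N f \<in> order_ge N"
      unfolding eq by (intro order_ge_sum monomial_order) auto
    have 2: "u * (subst_A u v f - partial N f) \<in> order_ge N"
      by (rule order_ge_mult_left[OF order_ge_mono[OF subst_A_partial]]) simp
    have 3: "subst_A u v (fps_X * f) - partial (Suc N) (fps_X * f) \<in> order_ge N"
      by (rule order_ge_mono[OF subst_A_partial]) simp
    show ?thesis using order_ge_add[OF 3 order_ge_diff[OF 1 2]] by (simp add: algebra_simps)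
  qed
  then show ?thesis using order_ge_eq_0 by fastforce
qed

lemma subst_A_Y_mult: "subst_A u v (Y_A * f) = v * subst_A u v f"
proof -
  have "subst_A u v (Y_A * f) - v * subst_A u v f \<in> order_ge N" for N
  proof -
    have "partial (Suc N) (Y_A * f) = (\<Sum>a\<le>Suc N. \<Sum>b\<le>N. scaleA (fps_nth (fps_nth f a) b) (u ^ a * v ^ Suc b))"
      unfolding partial_def
      by (rule sum.cong[OF refl], subst sum.atMost_Suc_shift) (simp add: fps_X_mult_nth)
    also have "\<dots> = v * partial N f + (\<Sum>b\<le>N. scaleA (fps_nth (fps_nth f (Suc N)) b) (u ^ Suc N * v ^ Suc b))"
      by (simp add: partial_def sum.distrib sum_distrib_left mult_ac)
    finally have eq: "partial (Suc N) (Y_A * f) - v * partial N f =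
        (\<Sum>b\<le>N. scaleA (fps_nth (fps_nth f (Suc N)) b) (u ^ Suc N * v ^ Suc b))" by simp
    have 1: "partial (Suc N) (Y_A * f) - v * partial N f \<in> order_ge N"
      unfolding eq by (intro order_ge_sum monomial_order) auto
    have 2: "v * (subst_A u v f - partial N f) \<in> order_ge N"
      by (rule order_ge_mult_left[OF order_ge_mono[OF subst_A_partial]]) simp
    have 3: "subst_A u v (Y_A * f) - partial (Suc N) (Y_A * f) \<in> order_ge N"
      by (rule order_ge_mono[OF subst_A_partial]) simp
    show ?thesis using order_ge_add[OF 3 order_ge_diff[OF 1 2]] by (simp add: algebra_simps)
  qed
  then show ?thesis using order_ge_eq_0 by fastforce
qed

lemma subst_A_1: "subst_A u v 1 = 1"
proof -
  have "subst_A u v 1 - 1 \<in> order_ge (Suc N)" for N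
  proof -
    have "partial N 1 = 1"
      by (simp add: partial_def sum.atMost_shift if_distrib[of "\<lambda>x. fps_nth x _"] cong: if_cong)
    then show ?thesis using subst_A_partial[of 1 N] by simp
  qed
  then have "subst_A u v 1 - 1 = 0" by (intro order_ge_eq_0) (metis order_ge_mono le_SucI order_refl)
  then show ?thesis by simp
qed

lemma subst_A_X_power_mult: "subst_A u v (fps_X ^ n * f) = u ^ n * subst_A u v f"
  by (induction n) (simp_all add: subst_A_X_mult mult.assoc)

lemma subst_A_Y_power_mult: "subst_A u v (Y_A ^ n * f) = v ^ n * subst_A u v f"
  by (induction n) (simp_all add: subst_A_Y_mult mult.assoc del: fps_const_power)

lemma subst_A_X: "subst_A u v fps_X = u"
  using subst_A_X_mult[of 1] by (simp add: subst_A_1)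

lemma subst_A_Y: "subst_A u v Y_A = v"
  using subst_A_Y_mult[of 1] by (simp add: subst_A_1)

text \<open>Continuity comes for free: S maps multiples of X^N and Y^N to multiples of u^N and v^N,
  which have order at least N. Multiplicativity of \<open>subst_A\<close> and the composition law
  both follow by choosing S.\<close>

lemma subst_A_unique:
  assumes add: "\<And>f g. S (f + g) = S f + S g"
    and X: "\<And>f. S (fps_X * f) = u * S f" and Y: "\<And>f. S (Y_A * f) = v * S f"
    and scl: "\<And>c f. S (scaleA c f) = scaleA c (S f)"
  shows "S f = subst_A u v f * S 1"
proof -
  have Xn: "S (fps_X ^ n * f) = u ^ n * S f" for n f
    by (induction n) (simp_all add: X mult.assoc)
  have Yn: "S (Y_A ^ n * f) = v ^ n * S f" for n f
    by (induction n) (simp_all add: Y mult.assoc del: fps_const_power)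
  have "S f - subst_A u v f * S 1 \<in> order_ge N" for N
  proof -
    have "f \<in> {f. S f - subst_A u v f * S 1 \<in> order_ge N}"
    proof (rule fps_fps_eq_UNIV[where N = N])
      fix f g assume "f \<in> {f. S f - subst_A u v f * S 1 \<in> order_ge N}"
        and "g \<in> {f. S f - subst_A u v f * S 1 \<in> order_ge N}"
      then show "f + g \<in> {f. S f - subst_A u v f * S 1 \<in> order_ge N}"
        using order_ge_add by (fastforce simp: add subst_A_add algebra_simps)
    next
      fix c a b
      have "S (scaleA c (fps_X ^ a * (Y_A ^ b * 1))) = scaleA c (u ^ a * (v ^ b * S 1))"
        unfolding scl Xn Yn ..
      moreover have "subst_A u v (scaleA c (fps_X ^ a * (Y_A ^ b * 1))) = scaleA c (u ^ a * (v ^ b * 1))"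
        unfolding subst_A_scale subst_A_X_power_mult subst_A_Y_power_mult subst_A_1 ..
      ultimately show "scaleA c (fps_X ^ a * Y_A ^ b) \<in> {f. S f - subst_A u v f * S 1 \<in> order_ge N}"
        by (simp add: order_ge_def mult.assoc)
    next
      fix f
      have "u ^ N * (S f - subst_A u v f * S 1) \<in> order_ge N"
        using u by (metis mult.commute order_ge_mult_left order_ge_power)
      then show "fps_X ^ N * f \<in> {f. S f - subst_A u v f * S 1 \<in> order_ge N}"
        unfolding mem_Collect_eq Xn subst_A_X_power_mult by (simp add: algebra_simps)
      have "v ^ N * (S f - subst_A u v f * S 1) \<in> order_ge N"
        using v by (metis mult.commute order_ge_mult_left order_ge_power)
      then show "Y_A ^ N * f \<in> {f. S f - subst_A u v f * S 1 \<in> order_ge N}"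
        unfolding mem_Collect_eq Yn subst_A_Y_power_mult by (simp add: algebra_simps)
    qed
    then show ?thesis by simp
  qed
  then show ?thesis using order_ge_eq_0 by fastforce
qed

lemma subst_A_mult: "subst_A u v (f * g) = subst_A u v f * subst_A u v g"
  using subst_A_unique[of "\<lambda>f. subst_A u v (f * g)" f]
  by (simp add: distrib_right subst_A_add mult.assoc subst_A_X_mult subst_A_Y_mult subst_A_scale)

end

lemma subst_A_id: "subst_A fps_X Y_A f = f"
  using subst_A_unique[of fps_X Y_A "\<lambda>f. f" f] by simp

lemma subst_A_order_ge:
  assumes "u \<in> order_ge 1" "v \<in> order_ge 1" "f \<in> order_ge 1"
  shows "subst_A u v f \<in> order_ge (Suc 0)"
  using assms by (simp add: order_ge_1_iff subst_A_def)

lemma subst_A_comp: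
  assumes "u \<in> order_ge 1" "v \<in> order_ge 1" "u' \<in> order_ge 1" "v' \<in> order_ge 1"
  shows "subst_A u v (subst_A u' v' f) = subst_A (subst_A u v u') (subst_A u v v') f"
  using subst_A_unique[of "subst_A u v u'" "subst_A u v v'" "\<lambda>f. subst_A u v (subst_A u' v' f)" f] assms
  by (simp add: subst_A_order_ge subst_A_add subst_A_X_mult subst_A_Y_mult subst_A_scale subst_A_mult subst_A_1
      subst_A_X subst_A_Y)

text \<open>Embeds O into A as the series in the inner variable, with z in the role of y. Then
  \<open>subst2\<close> is a case of \<open>subst_A\<close> and inherits its algebraic laws.\<close>

lemma fps_const_subst2:
  "fps_const (subst2 x y f) = subst_A (fps_const x) (fps_const y) (f :: 'a::field fps fps)"
  by (intro fps_ext) (simp add: subst_A_def subst2_def)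

lemma fps_const_order_ge [simp]: "fps_const x \<in> order_ge (Suc 0) \<longleftrightarrow> fps_nth x 0 = 0"
  by (simp add: order_ge_1_iff)

lemma subst2_add: "subst2 x y (f + g) = subst2 x y f + subst2 x y g"
  using fps_const_subst2[of x y "f + g"]
  by (simp add: subst_A_add flip: fps_const_subst2)

lemma subst2_scale: "subst2 x y (scaleA c f) = scaleO c (subst2 x y f)"
  using fps_const_subst2[of x y "scaleA c f"]
  by (simp add: subst_A_scale flip: fps_const_subst2)

lemma subst2_0 [simp]: "subst2 x y 0 = 0"
  by (rule fps_ext) (simp add: subst2_def)

lemma subst2_diff: "subst2 x y (f - g) = subst2 x y f - subst2 x y g"
  using subst2_add[of x y "f - g" g] by simp

lemma subst2_sum: "subst2 x y (\<Sum>i\<in>I. f i) = (\<Sum>i\<in>I. subst2 x y (f i))"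
  by (induction I rule: infinite_finite_induct) (simp_all add: subst2_add)

lemma subst2_nth_0 [simp]: "fps_nth (subst2 x y f) 0 = fps_nth (fps_nth f 0) 0"
  by (simp add: subst2_def)

context
  fixes x y :: "'a::field fps"
  assumes x: "fps_nth x 0 = 0" and y: "fps_nth y 0 = 0"
begin

lemma subst2_mult: "subst2 x y (f * g) = subst2 x y f * subst2 x y g"
proof -
  have "fps_const (subst2 x y (f * g)) = fps_const (subst2 x y f * subst2 x y g)"
    using x y by (simp add: fps_const_subst2 subst_A_mult flip: fps_const_mult)
  then show ?thesis by simp
qed

lemma subst2_1: "subst2 x y 1 = 1"
proof -
  have "fps_const (subst2 x y 1) = fps_const 1"
    using x y unfolding fps_const_subst2 by (simp add: subst_A_1)
  then show ?thesis by simp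
qed

lemma subst2_X: "subst2 x y fps_X = x"
  using fps_const_subst2[of x y fps_X] x y by (simp add: subst_A_X)

lemma subst2_Y: "subst2 x y Y_A = y"
  using fps_const_subst2[of x y Y_A] x y by (simp add: subst_A_Y)

lemma subst2_power: "subst2 x y (f ^ n) = subst2 x y f ^ n"
  by (induction n) (simp_all add: subst2_1 subst2_mult)

lemma subst2_subst_A:
  assumes "u \<in> order_ge 1" "v \<in> order_ge 1"
  shows "subst2 x y (subst_A u v f) = subst2 (subst2 x y u) (subst2 x y v) f"
proof -
  have "fps_const (subst2 x y (subst_A u v f)) = fps_const (subst2 (subst2 x y u) (subst2 x y v) f)"
    unfolding fps_const_subst2 using assms x y
    by (subst subst_A_comp) simp_all
  then show ?thesis by simp
qed

end

section \<open>Automorphisms of A and their action on ideals and on the slice\<close>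

lemma max_ideal_A_eq: "max_ideal_A = (order_ge 1 :: 'a::field fps fps set)"
proof (intro subset_antisym subsetI)
  fix f :: "'a fps fps" assume "f \<in> max_ideal_A"
  then obtain n a u where "f = (\<Sum>i<(n::nat). a i * u i)" and u: "\<And>i. i < n \<Longrightarrow> u i \<in> {fps_X, Y_A}"
    by (auto simp: max_ideal_A_def prod_set_def)
  then show "f \<in> order_ge 1"
    by (auto intro!: order_ge_sum order_ge_mult_left dest: u)
next
  fix f :: "'a fps fps" assume f: "f \<in> order_ge 1"
  have 1: "f = fps_const (fps_nth f 0) + fps_X * fps_shift 1 f"
    by (rule fps_eq_const_plus_X_shift)
  have "fps_nth f 0 = fps_X * fps_shift 1 (fps_nth f 0)"
    using f by (subst fps_eq_const_plus_X_shift) (simp add: order_ge_def)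
  then have "fps_const (fps_nth f 0) = Y_A * fps_const (fps_shift 1 (fps_nth f 0))"
    by (metis fps_const_mult)
  with 1 have "f = (\<Sum>i<2::nat. (if i = 0 then fps_const (fps_shift 1 (fps_nth f 0)) else fps_shift 1 f)
      * (if i = 0 then Y_A else fps_X))"
    by (simp add: eval_nat_numeral mult.commute)
  then show "f \<in> max_ideal_A"
    unfolding max_ideal_A_def prod_set_def mem_Collect_eq
    by (intro exI[of _ "2::nat"] exI[of _ "\<lambda>i. if i = 0 then fps_const (fps_shift 1 (fps_nth f 0)) else fps_shift 1 f"]
        exI[of _ "\<lambda>i. if i = 0 then Y_A else fps_X"]) simp
qed

text \<open>Separate maps for scalars and module elements: with equal maps this serves automorphisms
  of A, with the identity on scalars it serves multiplication of a module by a unit.\<close>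

lemma prod_set_image:
  assumes add: "\<And>f g. \<phi> (f + g) = \<phi> f + \<phi> g" and mult: "\<And>f g. f \<in> S \<Longrightarrow> g \<in> M \<Longrightarrow> \<phi>' f * \<phi> g = \<phi> (f * g)"
  shows "prod_set (\<phi>' ` S) (\<phi> ` M) = \<phi> ` prod_set S M"
proof -
  have "\<phi> 0 = 0" using add[of 0 0] by simp
  then have sum: "\<phi> (sum f I) = (\<Sum>i\<in>I. \<phi> (f i))" for f I
    by (induction I rule: infinite_finite_induct) (simp_all add: add)
  show ?thesis
  proof (intro subset_antisym subsetI)
    fix f assume "f \<in> prod_set (\<phi>' ` S) (\<phi> ` M)"
    then obtain n a u where f: "f = (\<Sum>i<(n::nat). a i * u i)"
      and au: "\<forall>i. i < n \<longrightarrow> a i \<in> \<phi>' ` S \<and> u i \<in> \<phi> ` M" by (auto simp: prod_set_def)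
    then have "\<forall>i. \<exists>a' u'. i < n \<longrightarrow> a i = \<phi>' a' \<and> a' \<in> S \<and> u i = \<phi> u' \<and> u' \<in> M" by blast
    then obtain a' u' where "\<And>i. i < n \<Longrightarrow> a i = \<phi>' (a' i) \<and> a' i \<in> S \<and> u i = \<phi> (u' i) \<and> u' i \<in> M"
      by metis
    then have "f = \<phi> (\<Sum>i<n. a' i * u' i)" "(\<Sum>i<n. a' i * u' i) \<in> prod_set S M"
      by (auto simp: f sum mult prod_set_def)
    then show "f \<in> \<phi> ` prod_set S M" by blast
  next
    fix f assume "f \<in> \<phi> ` prod_set S M"
    then obtain n a u where f: "f = \<phi> (\<Sum>i<(n::nat). a i * u i)" and au: "\<forall>i. i < n \<longrightarrow> a i \<in> S \<and> u i \<in> M"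
      by (auto simp: prod_set_def)
    then have "f = (\<Sum>i<n. \<phi>' (a i) * \<phi> (u i))" by (simp add: sum mult)
    then show "f \<in> prod_set (\<phi>' ` S) (\<phi> ` M)"
      using au unfolding prod_set_def
      by (intro CollectI exI[of _ n] exI[of _ "\<phi>' \<circ> a"] exI[of _ "\<phi> \<circ> u"]) auto
  qed
qed

text \<open>Records the invariance of (x, y), because \<open>rho_A\<close> and \<open>colon\<close>
  are formed with that ideal.\<close>

definition local_automorphism :: "('a::field fps fps \<Rightarrow> 'a fps fps) \<Rightarrow> bool" where
  "local_automorphism \<psi> \<longleftrightarrow> algebra_automorphism \<psi> \<and> \<psi> ` order_ge 1 = order_ge 1"

lemma local_automorphism_comp:
  assumes "local_automorphism \<psi>" "local_automorphism \<psi>'"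
  shows "local_automorphism (\<psi> \<circ> \<psi>')"
  unfolding local_automorphism_def algebra_automorphism_def
proof (intro conjI allI)
  have h: "\<And>f h. \<psi> (f + h) = \<psi> f + \<psi> h" "\<And>f h. \<psi> (f * h) = \<psi> f * \<psi> h" "\<And>c f. \<psi> (scaleA c f) = scaleA c (\<psi> f)"
    and h': "\<And>f h. \<psi>' (f + h) = \<psi>' f + \<psi>' h" "\<And>f h. \<psi>' (f * h) = \<psi>' f * \<psi>' h" "\<And>c f. \<psi>' (scaleA c f) = scaleA c (\<psi>' f)"
    and b: "bij \<psi>" "bij \<psi>'" "\<psi> ` order_ge 1 = order_ge 1" "\<psi>' ` order_ge 1 = order_ge 1"
    using assms by (auto simp: local_automorphism_def algebra_automorphism_def)
  show "bij (\<psi> \<circ> \<psi>')" "(\<psi> \<circ> \<psi>') ` order_ge 1 = order_ge 1"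
    using b by (simp_all only: bij_comp image_comp[symmetric])
  fix f h c
  show "(\<psi> \<circ> \<psi>') (f + h) = (\<psi> \<circ> \<psi>') f + (\<psi> \<circ> \<psi>') h" by (simp only: comp_apply h(1) h'(1))
  show "(\<psi> \<circ> \<psi>') (f * h) = (\<psi> \<circ> \<psi>') f * (\<psi> \<circ> \<psi>') h" by (simp only: comp_apply h(2) h'(2))
  show "(\<psi> \<circ> \<psi>') (scaleA c f) = scaleA c ((\<psi> \<circ> \<psi>') f)"
    unfolding comp_apply by (subst h'(3), subst h(3)) (rule refl)
qed

lemma local_automorphism_inv:
  assumes "local_automorphism \<psi>"
  shows "local_automorphism (inv \<psi>)"
proof -
  have b: "bij \<psi>" and o: "\<psi> ` order_ge 1 = order_ge 1"
    and h: "\<And>f h. \<psi> (f + h) = \<psi> f + \<psi> h" "\<And>f h. \<psi> (f * h) = \<psi> f * \<psi> h" "\<And>c f. \<psi> (scaleA c f) = scaleA c (\<psi> f)"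
    using assms by (auto simp: local_automorphism_def algebra_automorphism_def)
  have [simp]: "\<psi> (inv \<psi> f) = f" "inv \<psi> (\<psi> f) = f" for f
    using b by (auto simp: bij_def surj_f_inv_f)
  have "inv \<psi> ` order_ge 1 = order_ge 1"
    using b o by (metis bij_is_inj image_inv_f_f)
  moreover have "inv \<psi> (f + h) = inv \<psi> f + inv \<psi> h" "inv \<psi> (f * h) = inv \<psi> f * inv \<psi> h"
    "inv \<psi> (scaleA c f) = scaleA c (inv \<psi> f)" for f h c
    by (rule inv_f_eq[OF bij_is_inj[OF b]], simp add: h(1), rule inv_f_eq[OF bij_is_inj[OF b]],
        simp add: h(2), rule inv_f_eq[OF bij_is_inj[OF b]], subst h(3), simp)
  ultimately show ?thesis
    using b unfolding local_automorphism_def algebra_automorphism_def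
    by (simp add: bij_imp_bij_inv)
qed

text \<open>The shear x \<mapsto> x + w(y) has the inverse x \<mapsto> x - w(y).\<close>

lemma local_automorphism_subst_A:
  fixes w :: "'a::field fps"
  assumes "fps_nth w 0 = 0"
  shows "local_automorphism (subst_A (fps_X + fps_const w) Y_A)"
proof -
  have o: "fps_X + fps_const w' \<in> order_ge (Suc 0)" "fps_X - fps_const w' \<in> order_ge (Suc 0)" if "fps_nth w' 0 = 0" for w' :: "'a fps"
    using that by (simp_all add: order_ge_1_iff)
  \<comment> \<open>\<open>fps_const w'\<close> is a series in y alone, and the substitution fixes
    y.\<close>
  have const: "subst_A u Y_A (fps_const w') = fps_const w'" for u and w' :: "'a fps"
  proof (intro fps_ext)
    fix i j
    define t where "t = (\<Sum>b\<le>i+j. fps_nth w' b * fps_nth (fps_nth (Y_A ^ b) i) j)"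
    have "fps_nth (fps_nth (subst_A u Y_A (fps_const w')) i) j = (\<Sum>a\<le>i+j. if a = 0 then t else 0)"
      unfolding subst_A_def fps_nth_Abs_fps
    proof (rule sum.cong[OF refl])
      fix a show "(\<Sum>b\<le>i+j. fps_nth (fps_nth (fps_const w') a) b * fps_nth (fps_nth (u ^ a * Y_A ^ b) i) j) = (if a = 0 then t else 0)"
        by (cases "a = 0") (simp_all add: t_def)
    qed
    also have "\<dots> = t" by simp
    also have "t = (\<Sum>b\<le>i+j. if b = j then (if i = 0 then fps_nth w' j else 0) else 0)"
      unfolding t_def
    proof (rule sum.cong[OF refl])
      fix b
      have "fps_nth (fps_nth (Y_A ^ b :: 'a fps fps) i) j = (if i = 0 \<and> b = j then 1 else 0)" by auto
      then show "fps_nth w' b * fps_nth (fps_nth (Y_A ^ b) i) j = (if b = j then (if i = 0 then fps_nth w' j else 0) else 0)"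
        by simp
    qed
    also have "\<dots> = fps_nth (fps_nth (fps_const w') i) j" by (simp add: sum.delta)
    finally show "fps_nth (fps_nth (subst_A u Y_A (fps_const w')) i) j = fps_nth (fps_nth (fps_const w') i) j" .
  qed
  have inv1: "subst_A (fps_X + fps_const w') Y_A (subst_A (fps_X - fps_const w') Y_A f) = f"
    if "fps_nth w' 0 = 0" for w' :: "'a fps" and f
  proof -
    have "subst_A (fps_X + fps_const w') Y_A (fps_X - fps_const w') = fps_X"
      using subst_A_add[of "fps_X + fps_const w'" Y_A "fps_X - fps_const w'" "fps_const w'"]
      by (simp add: const o that subst_A_X)
    then show ?thesis
      using subst_A_comp[of "fps_X + fps_const w'" Y_A "fps_X - fps_const w'" Y_A f] o[OF that]
      by (simp add: subst_A_id subst_A_Y)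
  qed
  define p where "p = subst_A (fps_X + fps_const w) Y_A"
  define m where "m = subst_A (fps_X - fps_const w) Y_A"
  have pm: "p (m f) = f" "m (p f) = f" for f
    using inv1[of w f] inv1[of "- w" f] assms by (simp_all add: p_def m_def flip: fps_const_neg)
  have "bij p" using pm by (metis bijI')
  moreover have "p f \<in> order_ge 1" "m f \<in> order_ge 1" if "f \<in> order_ge 1" for f
    using that o[OF assms] by (simp_all add: p_def m_def subst_A_order_ge)
  then have "p ` order_ge 1 = order_ge 1"
    using pm by (metis (no_types, lifting) image_subsetI subsetI subset_antisym image_eqI)
  ultimately show ?thesis
    using o[OF assms] unfolding local_automorphism_def algebra_automorphism_def p_def
    by (simp add: subst_A_add subst_A_mult subst_A_scale)
qed

text \<open>Modulo I this is the socle of A/I, the part that is dual to generators of a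
  module.\<close>

definition colon :: "'a::field fps fps set \<Rightarrow> 'a fps fps set" where
  "colon I = {f. \<forall>g\<in>order_ge 1. g * f \<in> I}"

context
  fixes \<psi> :: "'a::field fps fps \<Rightarrow> 'a fps fps"
  assumes \<psi>: "local_automorphism \<psi>"
begin

private lemma hom: "\<psi> (f + h) = \<psi> f + \<psi> h" "\<psi> (f * h) = \<psi> f * \<psi> h" "\<psi> (scaleA c f) = scaleA c (\<psi> f)"
  and bij: "bij \<psi>" and order: "\<psi> ` order_ge 1 = order_ge 1"
  using \<psi> by (auto simp: local_automorphism_def algebra_automorphism_def)

private lemma mem: "\<psi> f \<in> \<psi> ` I \<longleftrightarrow> f \<in> I"
  using bij by (simp add: bij_is_inj inj_image_mem_iff)

lemma is_submodule_image: "is_submodule UNIV (\<psi> ` I) \<longleftrightarrow> is_submodule UNIV I"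
proof -
  have all: "(\<forall>f. Q f) \<longleftrightarrow> (\<forall>f. Q (\<psi> f))" for Q using bij by (metis bij_pointE)
  have "\<psi> 0 = 0" using hom(1)[of 0 0] by (metis add_cancel_right_right)
  then have "0 \<in> \<psi> ` I \<longleftrightarrow> 0 \<in> I" using mem by metis
  moreover have "(\<forall>a. \<forall>u\<in>\<psi> ` I. a * u \<in> \<psi> ` I) \<longleftrightarrow> (\<forall>a. \<forall>u\<in>I. a * u \<in> I)"
    by (subst all) (simp add: mem flip: hom)
  ultimately show ?thesis unfolding is_submodule_def by (simp add: mem flip: hom)
qed

lemma quotient_dim_image: "quotient_dim scaleA (\<psi> ` U) (\<psi> ` W) = quotient_dim scaleA U W"
  using hom(1,3) by (intro quotient_dim_bij_image[where scl = scaleA and scl' = scaleA and \<phi> = \<psi>] bij) simp_all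

lemma rho_A_image: "rho_A (\<psi> ` I) = rho_A I"
proof -
  have "prod_set max_ideal_A (\<psi> ` I) = \<psi> ` prod_set max_ideal_A I"
    using prod_set_image[of \<psi> max_ideal_A I \<psi>] order by (simp add: hom max_ideal_A_eq)
  then show ?thesis by (simp add: rho_A_def quotient_dim_image)
qed

lemma colon_image: "colon (\<psi> ` I) = \<psi> ` colon I"
proof -
  have "\<psi> f \<in> colon (\<psi> ` I) \<longleftrightarrow> \<psi> f \<in> \<psi> ` colon I" for f
  proof -
    have "\<psi> f \<in> colon (\<psi> ` I) \<longleftrightarrow> (\<forall>g\<in>\<psi> ` order_ge 1. g * \<psi> f \<in> \<psi> ` I)"
      by (simp add: colon_def order del: One_nat_def)
    also have "\<dots> \<longleftrightarrow> (\<forall>g\<in>order_ge 1. g * f \<in> I)" by (simp add: mem flip: hom)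
    finally show ?thesis by (simp add: mem) (simp add: colon_def)
  qed
  then show ?thesis using bij by (metis bij_pointE subsetI subset_antisym)
qed

lemma instanton_slice_image:
  assumes "\<psi> ` conductor_preimage x y = conductor_preimage x' y'"
  shows "bij_betw (\<lambda>I. \<psi> ` I) (instanton_slice x y) (instanton_slice x' y')"
proof (rule bij_betw_imageI)
  show "inj_on ((`) \<psi>) (instanton_slice x y)"
    using bij by (meson bij_is_inj inj_image_eq_iff inj_onI)
  show "(`) \<psi> ` instanton_slice x y = instanton_slice x' y'"
  proof (intro subset_antisym subsetI)
    fix I assume "I \<in> (`) \<psi> ` instanton_slice x y"
    then show "I \<in> instanton_slice x' y'"
      unfolding instanton_slice_def assms[symmetric] by (auto simp: is_submodule_image)
  next
    fix I assume I: "I \<in> instanton_slice x' y'"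
    define J where "J = \<psi> -` I"
    have "I = \<psi> ` J" using bij by (simp add: J_def bij_is_surj surj_image_vimage_eq)
    moreover from this have "J \<in> instanton_slice x y"
      using I bij unfolding instanton_slice_def assms[symmetric]
      by (auto simp: is_submodule_image inj_image_subset_iff bij_is_inj)
    ultimately show "I \<in> (`) \<psi> ` instanton_slice x y" by blast
  qed
qed

end

lemma H_inst_image:
  fixes x y x' y' :: "'a::{field,finite} fps"
  assumes "local_automorphism \<psi>" "\<psi> ` conductor_preimage x y = conductor_preimage x' y'"
  shows "H_inst x y = H_inst x' y'"
proof -
  have "\<psi> ` UNIV = UNIV" using assms(1) by (simp add: local_automorphism_def algebra_automorphism_def bij_is_surj)
  then have "quotient_dim scaleA UNIV (\<psi> ` I) = quotient_dim scaleA UNIV I" for I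
    using quotient_dim_image[OF assms(1), of UNIV I] by simp
  then have "H_inst x y = (\<Sum>I\<in>instanton_slice x y.
      monom (a_factor (card (UNIV :: 'a set)) (rho_A (\<psi> ` I))) (quotient_dim scaleA UNIV (\<psi> ` I)))"
    by (simp add: H_inst_def rho_A_image[OF assms(1)])
  also have "\<dots> = H_inst x' y'"
    unfolding H_inst_def by (rule sum.reindex_bij_betw[OF instanton_slice_image[OF assms]])
  finally show ?thesis .
qed

subsection \<open>Branches and their conductors\<close>

lemma X_power_dvd_iff: "fps_X ^ n dvd f \<longleftrightarrow> (\<forall>k<n. fps_nth (f :: 'a::comm_ring_1 fps) k = 0)"
proof
  assume "\<forall>k<n. fps_nth f k = 0"
  then have "f = fps_X ^ n * fps_shift n f" by (intro fps_ext) (simp add: fps_X_power_mult_nth)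
  then show "fps_X ^ n dvd f" by (metis dvd_triv_left)
qed (auto simp: fps_X_power_mult_nth)

lemma X_power_dvd_subdegree: "n \<le> subdegree f \<Longrightarrow> fps_X ^ n dvd (f :: 'a::comm_ring_1 fps)"
  by (auto simp: X_power_dvd_iff intro: nth_less_subdegree_zero)

lemma X_power_dvd_eq_0: "(\<And>n. fps_X ^ n dvd f) \<Longrightarrow> f = (0 :: 'a::comm_ring_1 fps)"
  by (rule fps_ext) (metis X_power_dvd_iff fps_zero_nth lessI)

lemma X_power_dvd_le: "fps_X ^ n dvd f \<Longrightarrow> m \<le> n \<Longrightarrow> fps_X ^ m dvd (f :: 'a::comm_ring_1 fps)"
  by (auto simp: X_power_dvd_iff)

lemma fps_cancel_leading:
  fixes f r :: "'a::field fps"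
  assumes "fps_X ^ n dvd f" "subdegree r = n" "r \<noteq> 0"
  shows "fps_X ^ Suc n dvd f - scaleO (fps_nth f n / fps_nth r n) r"
proof -
  have "fps_nth r n \<noteq> 0" using assms by auto
  then show ?thesis using assms unfolding X_power_dvd_iff by (auto simp: less_Suc_eq)
qed

text \<open>A single coefficient sequence serves every N, so it can later be reassembled into power
  series. It arises by cancelling one leading term after another.\<close>

lemma fps_expand:
  fixes f :: "'a::field fps"
  assumes v: "\<And>n. v n \<noteq> 0" "\<And>n. subdegree (v n) = c + n" and f: "fps_X ^ c dvd f"
  shows "\<exists>b. \<forall>N. fps_X ^ (c + N) dvd f - (\<Sum>n<N. scaleO (b n) (v n))"
proof -
  define d where "d n h = fps_nth h (c + n) / fps_nth (v n) (c + n)" for n h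
  define res where "res = rec_nat f (\<lambda>n h. h - scaleO (d n h) (v n))"
  have res: "res 0 = f" "res (Suc n) = res n - scaleO (d n (res n)) (v n)" for n
    by (simp_all add: res_def)
  have "res N = f - (\<Sum>n<N. scaleO (d n (res n)) (v n))" for N
    by (induction N) (simp_all add: res)
  moreover have "fps_X ^ (c + N) dvd res N" for N
  proof (induction N)
    case (Suc N)
    then show ?case using fps_cancel_leading[OF Suc v(2,1)] by (simp add: res d_def)
  qed (use f res in simp)
  ultimately show ?thesis by metis
qed

lemma curve_ring_iff: "f \<in> curve_ring x y \<longleftrightarrow> (\<exists>a. f = subst2 x y a)"
  by (auto simp: curve_ring_def)

context
  fixes x y :: "'a::field fps"
  assumes x: "fps_nth x 0 = 0" and y: "fps_nth y 0 = 0"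
begin

lemma curve_ring_add: "f \<in> curve_ring x y \<Longrightarrow> g \<in> curve_ring x y \<Longrightarrow> f + g \<in> curve_ring x y"
  unfolding curve_ring_iff by (metis subst2_add)

lemma curve_ring_mult: "f \<in> curve_ring x y \<Longrightarrow> g \<in> curve_ring x y \<Longrightarrow> f * g \<in> curve_ring x y"
  unfolding curve_ring_iff by (metis subst2_mult x y)

lemma curve_ring_scale: "f \<in> curve_ring x y \<Longrightarrow> scaleO c f \<in> curve_ring x y"
  unfolding curve_ring_iff by (metis subst2_scale)

lemma curve_ring_1: "1 \<in> curve_ring x y"
  unfolding curve_ring_iff by (metis subst2_1 x y)

text \<open>\<open>fps_const F\<close> is the series F(y) in A, so this is the evaluation of F on
  the curve, cut at J with an explicit tail.\<close>

lemma subst2_const_partial: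
  "subst2 x y (fps_const F) =
     (\<Sum>j<J. scaleO (fps_nth F j) (y ^ j)) + y ^ J * subst2 x y (fps_const (fps_shift J F))"
proof (induction J)
  case (Suc J)
  have "fps_const (fps_shift J F) = scaleA (fps_nth F J) 1 + Y_A * fps_const (fps_shift (Suc J) F)"
  proof -
    have "fps_shift 1 (fps_shift J F) = fps_shift (Suc J) F" by (rule fps_ext) simp
    then show ?thesis using fps_eq_const_plus_X_shift[of "fps_shift J F"] by simp
  qed
  then have "subst2 x y (fps_const (fps_shift J F)) =
      subst2 x y (scaleA (fps_nth F J) 1 + Y_A * fps_const (fps_shift (Suc J) F))" by (rule arg_cong)
  also have "\<dots> = scaleO (fps_nth F J) 1 + y * subst2 x y (fps_const (fps_shift (Suc J) F))"
    unfolding subst2_add subst2_scale subst2_mult[OF x y] subst2_Y[OF x y] subst2_1[OF x y] ..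
  finally show ?case unfolding Suc.IH by (simp add: algebra_simps)
qed simp

text \<open>Orders alone only give approximation by elements of R. Membership follows because f is a
  combination of finitely many elements of R whose coefficients are power series in y, and those are
  values of \<open>subst2\<close>.\<close>

lemma curve_ring_conductor:
  assumes y': "y \<noteq> 0" and \<Gamma>: "\<And>n. c \<le> n \<Longrightarrow> n \<in> value_semigroup (curve_ring x y)"
    and f: "fps_X ^ c dvd f"
  shows "f \<in> curve_ring x y"
proof -
  define m where "m = subdegree y"
  have "subdegree y \<noteq> 0" using y y' by (simp add: subdegree_eq_0_iff)
  then have m: "m > 0" by (simp add: m_def)
  have "\<forall>l. \<exists>a. subst2 x y a \<noteq> 0 \<and> subdegree (subst2 x y a) = c + l"
  proof
    fix l
    have "c + l \<in> value_semigroup (curve_ring x y)" by (rule \<Gamma>) simp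
    then show "\<exists>a. subst2 x y a \<noteq> 0 \<and> subdegree (subst2 x y a) = c + l"
      by (force simp: value_semigroup_def curve_ring_def)
  qed
  then obtain a where a: "\<And>l. subst2 x y (a l) \<noteq> 0" "\<And>l. subdegree (subst2 x y (a l)) = c + l"
    by metis
  \<comment> \<open>With m the order of y, powers of y turn elements of orders c, ..., c + m - 1
    into one element of each order from c on.\<close>
  define v where "v n = y ^ (n div m) * subst2 x y (a (n mod m))" for n
  have "v n \<noteq> 0" "subdegree (v n) = c + n" for n
    using a y' by (simp_all add: v_def flip: m_def)
  from fps_expand[of v, OF this f] obtain b
    where b: "\<And>N. fps_X ^ (c + N) dvd f - (\<Sum>n<N. scaleO (b n) (v n))" by metis
  \<comment> \<open>The coefficients of the expansion, sorted by residue modulo m, form m power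
    series in y; thus g is a finite sum in A.\<close>
  define F where "F l = Abs_fps (\<lambda>j. b (j * m + l))" for l
  define g where "g = (\<Sum>l<m. fps_const (F l) * a l)"
  have "fps_X ^ N dvd f - subst2 x y g" for N
  proof -
    have "(\<Sum>n<N*m. scaleO (b n) (v n)) = (\<Sum>j<N. \<Sum>n\<in>{j*m..<j*m+m}. scaleO (b n) (v n))"
      by (simp add: sum.nat_group)
    also have "\<dots> = (\<Sum>j<N. \<Sum>l<m. scaleO (b (j*m+l)) (v (j*m+l)))"
      by (rule sum.cong[OF refl], subst sum.atLeastLessThan_shift_0) (simp add: atLeast0LessThan)
    also have "\<dots> = (\<Sum>l<m. (\<Sum>j<N. scaleO (fps_nth (F l) j) (y ^ j)) * subst2 x y (a l))"
      by (subst sum.swap) (simp add: v_def F_def sum_distrib_right mult.assoc)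
    finally have v_sum: "(\<Sum>n<N*m. scaleO (b n) (v n)) =
        (\<Sum>l<m. (\<Sum>j<N. scaleO (fps_nth (F l) j) (y ^ j)) * subst2 x y (a l))" .
    have "subst2 x y g = (\<Sum>l<m. subst2 x y (fps_const (F l)) * subst2 x y (a l))"
      by (simp add: g_def subst2_sum subst2_mult[OF x y])
    also have "\<dots> = (\<Sum>l<m. ((\<Sum>j<N. scaleO (fps_nth (F l) j) (y ^ j))
        + y ^ N * subst2 x y (fps_const (fps_shift N (F l)))) * subst2 x y (a l))"
      by (rule sum.cong[OF refl], subst subst2_const_partial[of _ N]) (rule refl)
    finally have "subst2 x y g - (\<Sum>n<N*m. scaleO (b n) (v n)) =
        (\<Sum>l<m. y ^ N * subst2 x y (fps_const (fps_shift N (F l))) * subst2 x y (a l))"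
      unfolding v_sum by (simp add: distrib_right sum.distrib)
    moreover have "fps_X ^ (N * m) dvd y ^ N"
      by (rule X_power_dvd_subdegree) (simp add: m_def)
    then have "fps_X ^ (N * m) dvd (\<Sum>l<m. y ^ N * subst2 x y (fps_const (fps_shift N (F l))) * subst2 x y (a l))"
      by (intro dvd_sum) (simp add: dvd_mult2)
    ultimately have 1: "fps_X ^ (N * m) dvd subst2 x y g - (\<Sum>n<N*m. scaleO (b n) (v n))" by simp
    have 2: "fps_X ^ (N * m) dvd f - (\<Sum>n<N*m. scaleO (b n) (v n))"
      using X_power_dvd_le[OF b[of "N * m"]] by simp
    have "fps_X ^ (N * m) dvd f - subst2 x y g" using dvd_diff[OF 2 1] by simp
    then show ?thesis using m by (rule_tac X_power_dvd_le) auto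
  qed
  then have "f - subst2 x y g = 0" by (rule X_power_dvd_eq_0)
  then show ?thesis by (auto simp: curve_ring_iff)
qed

end

section \<open>Counting the codimension of R by gaps of the semigroup\<close>

interpretation scaleO: finite_field_space "scaleO :: 'a::{field,finite} \<Rightarrow> 'a fps \<Rightarrow> 'a fps"
  by unfold_locales (simp_all add: algebra_simps flip: fps_const_mult fps_const_add)

interpretation scaleA: finite_field_space "scaleA :: 'a::{field,finite} \<Rightarrow> 'a fps fps \<Rightarrow> 'a fps fps"
  by unfold_locales (simp_all add: algebra_simps flip: fps_const_mult fps_const_add)

text \<open>A leading exponent in the semigroup can be cancelled by an element of R, one outside it
  by a power of z. The process ends at exponent c, where everything lies in R.\<close>

lemma quotient_basis_gaps:
  fixes R :: "'a::{field,finite} fps set"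
  assumes R: "scaleO.subspace R" and c: "\<And>f. fps_X ^ c dvd f \<Longrightarrow> f \<in> R"
  shows "quotient_basis scaleO UNIV R ((^) fps_X ` (- value_semigroup R))"
proof -
  define G where "G = - value_semigroup R"
  have inj: "inj ((^) fps_X :: nat \<Rightarrow> 'a fps)"
    by (rule injI) (metis fps_X_power_subdegree)
  have "n \<in> value_semigroup R" if "c \<le> n" for n
    using c[of "fps_X ^ n"] that unfolding value_semigroup_def
    by (auto intro!: exI[of _ "fps_X ^ n"] le_imp_power_dvd simp: fps_X_power_subdegree)
  then have "G \<subseteq> {..<c}" by (auto simp: G_def not_le[symmetric])
  then have finG: "finite G" by (rule finite_subset) simp
  define s where "s d = (\<Sum>g\<in>G. scaleO (d g) (fps_X ^ g))" for d :: "nat \<Rightarrow> 'a"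
  have s_add: "s (\<lambda>n. d n + d' n) = s d + s d'" and s_diff: "s (\<lambda>n. d n - d' n) = s d - s d'" for d d'
    by (simp_all add: s_def sum.distrib sum_subtractf algebra_simps flip: fps_const_add fps_const_sub)
  have s_nth: "fps_nth (s d) n = (if n \<in> G then d n else 0)" for d n
    using finG by (simp add: s_def fps_sum_nth fps_X_power_nth if_distrib cong: if_cong)
  have ex: "\<exists>d. f - s d \<in> R" if "fps_X ^ k dvd f" "k \<le> c" for k f
    using that(2,1)
  proof (induction k arbitrary: f rule: inc_induct)
    case base
    then show ?case using c by (intro exI[of _ "\<lambda>_. 0"]) (simp add: s_def)
  next
    case (step k)
    show ?case
    proof (cases "k \<in> G")
      case True
      define e where "e = (\<lambda>n. if n = k then fps_nth f k else 0)"
      have "fps_X ^ Suc k dvd f - s e"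
        using step.prems unfolding X_power_dvd_iff by (auto simp: s_nth e_def less_Suc_eq True)
      then obtain d where "f - s e - s d \<in> R" using step.IH by metis
      then show ?thesis by (intro exI[of _ "\<lambda>n. e n + d n"]) (simp add: s_add diff_diff_eq)
    next
      case False
      then obtain r where r: "r \<in> R" "r \<noteq> 0" "subdegree r = k" by (auto simp: G_def value_semigroup_def)
      define e where "e = fps_nth f k / fps_nth r k"
      have "fps_X ^ Suc k dvd f - scaleO e r"
        unfolding e_def by (rule fps_cancel_leading[OF step.prems r(3,2)])
      then obtain d where "f - scaleO e r - s d \<in> R" using step.IH by metis
      then have "(f - scaleO e r - s d) + scaleO e r \<in> R"
        using R r(1) by (intro scaleO.subspace_add) (auto intro: scaleO.subspace_scale)
      then show ?thesis by (intro exI[of _ d]) simp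
    qed
  qed
  \<comment> \<open>A nonzero combination of gap powers has a gap as its order, so it cannot lie in
    R.\<close>
  have zero: "d g = 0" if "s d \<in> R" "g \<in> G" for d g
  proof (rule ccontr)
    assume "d g \<noteq> 0"
    then have nz: "s d \<noteq> 0" using s_nth[of d g] that(2) by auto
    then have "subdegree (s d) \<in> value_semigroup R" using that(1) by (auto simp: value_semigroup_def)
    then have "fps_nth (s d) (subdegree (s d)) = 0" by (subst s_nth) (simp add: G_def)
    then show False using nz by simp
  qed
  have sum_eq: "(\<Sum>b\<in>(^) fps_X ` G. scaleO (d b) b) = s (\<lambda>g. d (fps_X ^ g))" for d
    unfolding s_def by (subst sum.reindex) (auto simp: inj inj_on_subset[OF inj])
  have "quotient_basis scaleO UNIV R ((^) fps_X ` G)"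
    unfolding quotient_basis_def sum_eq
  proof (intro conjI ballI)
    show "finite ((^) fps_X ` G)" using finG by simp
    fix f :: "'a fps"
    obtain d where d: "f - s d \<in> R" using ex[of 0 f] by auto
    define e where "e = restrict (\<lambda>b :: 'a fps. d (subdegree b)) ((^) fps_X ` G)"
    have e: "s (\<lambda>g. e (fps_X ^ g)) = s d"
      unfolding s_def by (rule sum.cong) (auto simp: e_def fps_X_power_subdegree)
    show "\<exists>!c :: 'a fps \<Rightarrow> 'a. c \<in> (^) fps_X ` G \<rightarrow>\<^sub>E UNIV \<and> f - s (\<lambda>g. c (fps_X ^ g)) \<in> R"
    proof (rule ex1I[of _ e], intro conjI)
      show "e \<in> (^) fps_X ` G \<rightarrow>\<^sub>E UNIV" by (simp add: e_def)
      show "f - s (\<lambda>g. e (fps_X ^ g)) \<in> R" using d e by simp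
      fix c' :: "'a fps \<Rightarrow> 'a" assume c': "c' \<in> (^) fps_X ` G \<rightarrow>\<^sub>E UNIV \<and> f - s (\<lambda>g. c' (fps_X ^ g)) \<in> R"
      have "(f - s d) - (f - s (\<lambda>g. c' (fps_X ^ g))) \<in> R"
        using R d c' by (blast intro: scaleO.subspace_diff)
      then have "s (\<lambda>g. c' (fps_X ^ g) - d g) \<in> R" by (simp add: s_diff)
      then have "c' (fps_X ^ g) = d g" if "g \<in> G" for g using zero that by fastforce
      then show "c' = e"
        using c' by (intro ext) (auto simp: e_def restrict_def PiE_def extensional_def fps_X_power_subdegree)
    qed
  qed simp
  then show ?thesis by (simp add: G_def)
qed

lemma (in finite_field_space) functional_exists:
  assumes W: "subspace W" and e: "e \<notin> W"
  obtains \<theta> :: "'v \<Rightarrow> 'k" where "\<And>u v. \<theta> (u + v) = \<theta> u + \<theta> v" "\<And>c u. \<theta> (scl c u) = c * \<theta> u"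
    "\<And>w. w \<in> W \<Longrightarrow> \<theta> w = 0" "\<theta> e = 1"
proof -
  interpret k: vector_space "(*) :: 'k \<Rightarrow> 'k \<Rightarrow> 'k" by unfold_locales (simp_all add: algebra_simps)
  interpret p: vector_space_pair scl "(*) :: 'k \<Rightarrow> 'k \<Rightarrow> 'k" ..
  obtain B where B: "independent B" "span B = W" using basis_extend[OF W, of "{}"] independent_empty by auto
  then have "independent (insert e B)" using e by (simp add: independent_insertI)
  from p.linear_independent_extend[OF this, of "\<lambda>b. if b = e then 1 else 0"]
  obtain g where g: "Vector_Spaces.linear scl (*) g" "\<forall>b\<in>insert e B. g b = (if b = e then 1 else 0)" by blast
  interpret g: Vector_Spaces.linear scl "(*)" g by fact
  have "e \<notin> B" using e B span_superset by auto
  then have "g b = 0" if "b \<in> B" for b using g(2) that by auto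
  then have "g w = 0" if "w \<in> W" for w
    using g.eq_0_on_span[of B w] that B by auto
  then show thesis using that[of g] g(2) g.add g.scale by auto
qed

subsection \<open>Standard modules\<close>

lemma finite_range_fps_cutoff: "finite (range (fps_cutoff n :: 'a::{field,finite} fps \<Rightarrow> 'a fps))"
proof (rule finite_subset)
  show "range (fps_cutoff n) \<subseteq> (\<lambda>g. Abs_fps (\<lambda>k. if k < n then g k else 0)) ` ({..<n} \<rightarrow>\<^sub>E (UNIV :: 'a set))"
  proof (rule image_subsetI)
    fix f :: "'a fps"
    show "fps_cutoff n f \<in> (\<lambda>g. Abs_fps (\<lambda>k. if k < n then g k else 0)) ` ({..<n} \<rightarrow>\<^sub>E UNIV)"
      by (rule image_eqI[of _ _ "restrict (fps_nth f) {..<n}"]) (auto intro!: fps_ext)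
  qed
qed (simp add: finite_PiE)

text \<open>One preimage for each value of h represents all cosets. Finite codimension thus reduces
  to a map with finitely many values that separates cosets, such as truncation.\<close>

lemma finite_quotientI:
  assumes fin: "finite (h ` U)" and h: "\<And>u v. u \<in> U \<Longrightarrow> v \<in> U \<Longrightarrow> h u = h v \<Longrightarrow> u - v \<in> W"
  shows "finite_quotient U W"
  unfolding finite_quotient_def
proof (intro exI conjI ballI)
  show "finite (inv_into U h ` (h ` U))" using fin by simp
  fix u assume u: "u \<in> U"
  show "\<exists>f\<in>inv_into U h ` h ` U. u - f \<in> W"
    using u by (intro bexI[of _ "inv_into U h (h u)"] h) (auto simp: inv_into_into f_inv_into_f)
qed

lemma X_power_dvd_diff_iff: "fps_X ^ n dvd f - g \<longleftrightarrow> fps_cutoff n f = fps_cutoff n (g :: 'a::comm_ring_1 fps)"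
  by (auto simp: X_power_dvd_iff fps_cutoff_eq_fps_cutoff_iff)

lemma finite_quotient_fps:
  assumes "\<And>f. fps_X ^ n dvd f \<Longrightarrow> f \<in> (W :: 'a::{field,finite} fps set)"
  shows "finite_quotient U W"
proof (rule finite_quotientI[of "fps_cutoff n"])
  show "finite (fps_cutoff n ` U)" by (rule finite_subset[OF image_mono finite_range_fps_cutoff]) simp
qed (simp add: assms X_power_dvd_diff_iff)

lemma subspace_X_power: "scaleO.subspace {f. fps_X ^ n dvd f}"
  by (rule scaleO.subspaceI) auto

lemma subspace_X: "scaleO.subspace {f. fps_X dvd f}"
  using subspace_X_power[of 1] by simp

lemma value_semigroup_X_power:
  "value_semigroup {f :: 'a::field fps. fps_X ^ n dvd f} = {n..}"
proof (intro subset_antisym subsetI)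
  fix k assume "k \<in> value_semigroup {f :: 'a fps. fps_X ^ n dvd f}"
  then obtain f :: "'a fps" where "fps_X ^ n dvd f" "f \<noteq> 0" "k = subdegree f" by (auto simp: value_semigroup_def)
  then show "k \<in> {n..}" using dvd_imp_subdegree_le[of "fps_X ^ n" f] by (simp add: fps_X_power_subdegree)
next
  fix k assume "k \<in> {n..}"
  then show "k \<in> value_semigroup {f :: 'a fps. fps_X ^ n dvd f}"
    by (auto simp: value_semigroup_def fps_X_power_subdegree le_imp_power_dvd intro!: exI[of _ "fps_X ^ k"])
qed

lemma card_power_X_image: "card ((^) (fps_X :: 'a::field fps) ` G) = card G"
  by (rule card_image) (metis fps_X_power_subdegree inj_onI)

lemma quotient_dim_gaps:
  assumes "scaleO.subspace R" "\<And>f. fps_X ^ c dvd f \<Longrightarrow> f \<in> R"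
  shows "quotient_dim scaleO UNIV (R :: 'a::{field,finite} fps set) = card (- value_semigroup R)"
  using scaleO.quotient_dim_eq[OF quotient_basis_gaps[OF assms]] assms(1)
  by (simp add: card_power_X_image)

lemma quotient_dim_X_power:
  "quotient_dim scaleO UNIV {f :: 'a::{field,finite} fps. fps_X ^ n dvd f} = n"
proof -
  have "- {n..} = {..<n}" by auto
  then show ?thesis
    using quotient_dim_gaps[OF subspace_X_power, of n n] by (simp add: value_semigroup_X_power)
qed

text \<open>Since z^D O lies in M, truncation at D stays in M and picks exactly one element of each
  coset; so this counts M/z^D O.\<close>

lemma card_truncations:
  fixes M :: "'a::{field,finite} fps set"
  assumes M: "scaleO.subspace M" and D: "{f. fps_X ^ D dvd f} \<subseteq> M"
  shows "card (M \<inter> range (fps_cutoff D)) = card (UNIV :: 'a set) ^ quotient_dim scaleO M {f. fps_X ^ D dvd f}"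
proof -
  let ?Z = "{f :: 'a fps. fps_X ^ D dvd f}"
  have fin: "finite_quotient M ?Z" by (rule finite_quotient_fps[of D]) simp
  obtain B where B: "quotient_basis scaleO M ?Z B"
    using scaleO.quotient_basis_exists[OF M subspace_X_power D fin] by metis
  then have finB: "finite B" and BM: "B \<subseteq> M"
    and ex1: "\<And>u. u \<in> M \<Longrightarrow> \<exists>!c. c \<in> B \<rightarrow>\<^sub>E UNIV \<and> u - (\<Sum>b\<in>B. scaleO (c b) b) \<in> ?Z"
    by (auto simp: quotient_basis_def)
  define s where "s c = (\<Sum>b\<in>B. scaleO (c b) b)" for c
  have sM: "s c \<in> M" for c
    unfolding s_def using BM M by (auto intro!: scaleO.subspace_sum intro: scaleO.subspace_scale)
  have cut: "fps_cutoff D f \<in> M" if "f \<in> M" for f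
  proof -
    have "f - fps_cutoff D f \<in> M" using D by (auto simp: X_power_dvd_iff)
    then have "f - (f - fps_cutoff D f) \<in> M" using M that by (blast intro: scaleO.subspace_diff)
    then show ?thesis by simp
  qed
  have "bij_betw (\<lambda>c. fps_cutoff D (s c)) (B \<rightarrow>\<^sub>E UNIV) (M \<inter> range (fps_cutoff D))"
  proof (rule bij_betw_imageI)
    show "inj_on (\<lambda>c. fps_cutoff D (s c)) (B \<rightarrow>\<^sub>E UNIV)"
    proof (rule inj_onI)
      fix c d :: "'a fps \<Rightarrow> 'a" assume "c \<in> B \<rightarrow>\<^sub>E UNIV" "d \<in> B \<rightarrow>\<^sub>E UNIV" "fps_cutoff D (s c) = fps_cutoff D (s d)"
      moreover from this have "s c - s c \<in> ?Z" "s c - s d \<in> ?Z" by (simp_all add: X_power_dvd_diff_iff)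
      ultimately show "c = d" using ex1[OF sM[of c]] unfolding s_def[symmetric] by blast
    qed
    show "(\<lambda>c. fps_cutoff D (s c)) ` (B \<rightarrow>\<^sub>E UNIV) = M \<inter> range (fps_cutoff D)"
    proof (intro subset_antisym subsetI)
      fix f assume f: "f \<in> M \<inter> range (fps_cutoff D)"
      then obtain c where "c \<in> B \<rightarrow>\<^sub>E UNIV" "f - s c \<in> ?Z" using ex1[of f] unfolding s_def by blast
      moreover from this have "fps_cutoff D (s c) = fps_cutoff D f" by (simp add: X_power_dvd_diff_iff)
      moreover have "fps_cutoff D f = f" using f by (auto intro!: fps_ext)
      ultimately show "f \<in> (\<lambda>c. fps_cutoff D (s c)) ` (B \<rightarrow>\<^sub>E UNIV)" by (metis image_eqI)
    qed (use cut sM in auto)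
  qed
  then have "card (M \<inter> range (fps_cutoff D)) = card (B \<rightarrow>\<^sub>E (UNIV :: 'a set))"
    by (simp add: bij_betw_same_card)
  then show ?thesis
    using finB scaleO.quotient_dim_eq[OF B M subspace_X_power] by (simp add: card_PiE)
qed

text \<open>W consists of series without constant term, so the scalar c is fixed by the constant
  coefficient of f.\<close>

lemma quotient_dim_singleton:
  fixes U W :: "'a::{field,finite} fps set"
  assumes UW: "scaleO.subspace U" "scaleO.subspace W" and W: "W \<subseteq> {f. fps_X dvd f}"
    and u: "u \<in> U" "fps_nth u 0 \<noteq> 0" and ex: "\<And>f. f \<in> U \<Longrightarrow> \<exists>c. f - scaleO c u \<in> W"
  shows "quotient_dim scaleO U W = 1"
proof -
  have "quotient_basis scaleO U W {u}"
    unfolding quotient_basis_def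
  proof (intro conjI ballI)
    fix f assume "f \<in> U"
    then obtain c where c: "f - scaleO c u \<in> W" using ex by metis
    show "\<exists>!c. c \<in> {u} \<rightarrow>\<^sub>E UNIV \<and> f - (\<Sum>b\<in>{u}. scaleO (c b) b) \<in> W"
    proof (rule ex1I[of _ "restrict (\<lambda>_. c) {u}"])
      fix c' assume c': "c' \<in> {u} \<rightarrow>\<^sub>E UNIV \<and> f - (\<Sum>b\<in>{u}. scaleO (c' b) b) \<in> W"
      have "(f - scaleO c u) - (f - scaleO (c' u) u) \<in> W"
        by (rule scaleO.subspace_diff[OF UW(2)]) (use c c' in simp_all)
      then have "fps_X ^ 1 dvd (f - scaleO c u) - (f - scaleO (c' u) u)" using W by auto
      then have "c' u = c" using u(2) unfolding X_power_dvd_iff by simp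
      then show "c' = restrict (\<lambda>_. c) {u}"
        using c' by (intro ext) (auto simp: PiE_def extensional_def)
    qed (use c in simp)
  qed (use u in auto)
  then show ?thesis using scaleO.quotient_dim_eq UW by fastforce
qed

lemma is_submodule_subspace:
  fixes M :: "'a::{field,finite} fps set"
  assumes "is_submodule R M" "\<And>c. fps_const c \<in> R"
  shows "scaleO.subspace M"
  using assms by (intro scaleO.subspaceI) (auto simp: is_submodule_def)

text \<open>O is local: if every element of M lay in z O, then so would O M.\<close>

lemma prod_set_UNIV_eq_UNIV_iff:
  fixes M :: "'a::field fps set"
  shows "prod_set UNIV M = UNIV \<longleftrightarrow> (\<exists>u\<in>M. fps_nth u 0 \<noteq> 0)"
proof
  assume "prod_set UNIV M = UNIV"
  then have "1 \<in> prod_set UNIV M" by simp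
  then obtain n a u where eq: "1 = (\<Sum>i<(n::nat). a i * u i)" and M: "\<forall>i<n. u i \<in> M" by (auto simp: prod_set_def)
  then have "(\<Sum>i<n. fps_nth (a i) 0 * fps_nth (u i) 0) = 1"
  proof -
    have "(\<Sum>i<n. fps_nth (a i) 0 * fps_nth (u i) 0) = fps_nth (\<Sum>i<n. a i * u i) 0" by (simp add: fps_sum_nth)
    also have "\<dots> = 1" unfolding eq[symmetric] by simp
    finally show ?thesis .
  qed
  then have "\<exists>i<n. fps_nth (u i) 0 \<noteq> 0"
    by (metis (no_types, lifting) lessThan_iff mult_zero_right sum.neutral zero_neq_one)
  then show "\<exists>u\<in>M. fps_nth u 0 \<noteq> 0" using M by blast
next
  assume "\<exists>u\<in>M. fps_nth u 0 \<noteq> 0"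
  then obtain u where u: "u \<in> M" "fps_nth u 0 \<noteq> 0" by blast
  have "f \<in> prod_set UNIV M" for f
    unfolding prod_set_def using u
    by (intro CollectI exI[of _ 1] exI[of _ "\<lambda>_. f * inverse u"] exI[of _ "\<lambda>_. u"])
      (simp add: mult.assoc inverse_mult_eq_1)
  then show "prod_set UNIV M = UNIV" by blast
qed

locale conductor_ring =
  fixes R :: "'a::{field,finite} fps set" and c :: nat
  assumes R_add: "f \<in> R \<Longrightarrow> g \<in> R \<Longrightarrow> f + g \<in> R"
    and R_mult: "f \<in> R \<Longrightarrow> g \<in> R \<Longrightarrow> f * g \<in> R"
    and R_const: "fps_const k \<in> R"
    and R_conductor: "fps_X ^ c dvd f \<Longrightarrow> f \<in> R"
begin

lemma R_subspace: "scaleO.subspace R"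
  using R_const[of 0] by (intro scaleO.subspaceI) (auto intro: R_add R_mult R_const)

definition overmodules :: "'a fps set set" where
  "overmodules = {N. is_submodule R N \<and> 1 \<in> N}"

text \<open>Multiplication by the unit u maps z^c O onto itself, and u R lies in M.\<close>

lemma unit_conductor:
  assumes "is_submodule R M" "u \<in> M" "fps_nth u 0 \<noteq> 0" "fps_X ^ c dvd f"
  shows "f \<in> M"
proof -
  have "f * inverse u * u \<in> M"
    using assms R_conductor[of "f * inverse u"] by (auto simp: is_submodule_def)
  then show ?thesis using assms(3) by (simp add: mult.assoc inverse_mult_eq_1)
qed

lemma standard_modules_iff:
  "M \<in> standard_modules R \<longleftrightarrow> is_submodule R M \<and> (\<exists>u\<in>M. fps_nth u 0 \<noteq> 0)"
  by (simp add: standard_modules_def prod_set_UNIV_eq_UNIV_iff)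

text \<open>A standard module contains z^c O, hence is determined by its truncations at c.\<close>

lemma finite_standard_modules: "finite (standard_modules R)"
proof -
  have "inj_on (\<lambda>M. M \<inter> range (fps_cutoff c)) (standard_modules R)"
  proof (rule inj_on_inverseI)
    fix M assume "M \<in> standard_modules R"
    then obtain u where M: "is_submodule R M" and u: "u \<in> M" "fps_nth u 0 \<noteq> 0"
      by (auto simp: standard_modules_iff)
    have sub: "scaleO.subspace M" by (rule is_submodule_subspace[OF M R_const])
    have diff: "f - fps_cutoff c f \<in> M" for f
      by (rule unit_conductor[OF M u]) (simp add: X_power_dvd_iff)
    have "fps_cutoff c f \<in> M \<longleftrightarrow> f \<in> M" for f
      using scaleO.subspace_add[OF sub diff[of f]] scaleO.subspace_diff[OF sub _ diff[of f]]
      by fastforce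
    then show "{f. fps_cutoff c f \<in> M \<inter> range (fps_cutoff c)} = M" by auto
  qed
  moreover have "(\<lambda>M. M \<inter> range (fps_cutoff c)) ` standard_modules R \<subseteq> Pow (range (fps_cutoff c))" by auto
  ultimately show ?thesis
    using finite_range_fps_cutoff by (meson finite_Pow_iff inj_on_finite)
qed

text \<open>Truncation at c + 1 rather than c keeps the constant coefficient visible even when c =
  0.\<close>

definition units :: "'a fps set" where
  "units = {u \<in> range (fps_cutoff (Suc c)). fps_nth u 0 \<noteq> 0}"

lemma finite_units: "finite units"
  by (rule finite_subset[OF _ finite_range_fps_cutoff[of "Suc c"]]) (auto simp: units_def)

text \<open>The units of M are M without M \<inter> z O, a subspace of codimension 1 in M. Counting
  modulo z^(c+1) gives q^(c+1-d) - q^(c-d) with d = dim O/M.\<close>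

lemma card_units:
  assumes "M \<in> standard_modules R"
  shows "card {u \<in> units. u \<in> M} * card (UNIV :: 'a set) ^ quotient_dim scaleO UNIV M
    = card (UNIV :: 'a set) ^ c * (card (UNIV :: 'a set) - 1)"
proof -
  let ?q = "card (UNIV :: 'a set)" and ?D = "Suc c"
  let ?Z = "{f :: 'a fps. fps_X ^ ?D dvd f}" and ?T = "range (fps_cutoff ?D) :: 'a fps set"
  obtain u where M: "is_submodule R M" and u: "u \<in> M" "fps_nth u 0 \<noteq> 0"
    using assms by (auto simp: standard_modules_iff)
  have sub: "scaleO.subspace M" by (rule is_submodule_subspace[OF M R_const])
  define M0 where "M0 = M \<inter> {f. fps_X dvd f}"
  have sub0: "scaleO.subspace M0" unfolding M0_def by (intro scaleO.subspace_inter sub subspace_X)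
  have ZM: "?Z \<subseteq> M" by (auto intro!: unit_conductor[OF M u] dest: X_power_dvd_le[of ?D _ c])
  have ZM0: "?Z \<subseteq> M0" using ZM X_power_dvd_le[of ?D _ 1] by (auto simp: M0_def)
  have finT: "finite ?T" by (rule finite_range_fps_cutoff)
  have fq: "finite_quotient U ?Z" for U :: "'a fps set" by (rule finite_quotient_fps[of ?D]) simp
  have d1: "quotient_dim scaleO M M0 = 1"
  proof (rule quotient_dim_singleton[OF sub sub0 _ u])
    fix f assume f: "f \<in> M"
    define k where "k = fps_nth f 0 / fps_nth u 0"
    have "f - scaleO k u \<in> M" using f u sub by (intro scaleO.subspace_diff scaleO.subspace_scale)
    moreover have "fps_X ^ 1 dvd f - scaleO k u" unfolding X_power_dvd_iff using u by (simp add: k_def)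
    ultimately show "\<exists>k. f - scaleO k u \<in> M0" by (intro exI[of _ k]) (simp add: M0_def)
  qed (simp add: M0_def)
  have d2: "quotient_dim scaleO M ?Z = quotient_dim scaleO M M0 + quotient_dim scaleO M0 ?Z"
    by (rule scaleO.quotient_dim_add[OF sub sub0 subspace_X_power ZM0 _ fq]) (simp add: M0_def)
  have "quotient_dim scaleO UNIV ?Z = quotient_dim scaleO UNIV M + quotient_dim scaleO M ?Z"
    by (rule scaleO.quotient_dim_add[OF _ sub subspace_X_power ZM _ fq]) simp_all
  then have d3: "?D = quotient_dim scaleO UNIV M + quotient_dim scaleO M ?Z"
    unfolding quotient_dim_X_power .
  define e where "e = quotient_dim scaleO M0 ?Z"
  have "{u \<in> units. u \<in> M} = (M \<inter> ?T) - (M0 \<inter> ?T)"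
    using X_power_dvd_iff[of 1] by (auto simp: units_def M0_def)
  then have "card {u \<in> units. u \<in> M} = card (M \<inter> ?T) - card (M0 \<inter> ?T)"
    using finT by (simp only:) (rule card_Diff_subset, auto simp: M0_def)
  also have "\<dots> = ?q ^ e * (?q - 1)"
    using card_truncations[OF sub ZM] card_truncations[OF sub0 ZM0] d1 d2
    by (simp add: e_def algebra_simps diff_mult_distrib2)
  finally have "card {u \<in> units. u \<in> M} * ?q ^ quotient_dim scaleO UNIV M
      = ?q ^ (e + quotient_dim scaleO UNIV M) * (?q - 1)" by (simp add: power_add mult_ac)
  also have "e + quotient_dim scaleO UNIV M = c" using d1 d2 d3 by (simp add: e_def)
  finally show ?thesis .
qed

text \<open>Multiplication by u is an R-linear bijection of O that takes 1 to u, so it preserves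
  codimension and number of generators.\<close>

lemma
  assumes u: "fps_nth u 0 \<noteq> 0"
  shows bij_betw_overmodules: "bij_betw ((`) ((*) u)) overmodules {M \<in> standard_modules R. u \<in> M}"
    and quotient_dim_unit: "quotient_dim scaleO UNIV ((*) u ` N) = quotient_dim scaleO UNIV N"
    and rho_unit: "rho R ((*) u ` N) = rho R N"
proof -
  have inv: "u * (inverse u * f) = f" "inverse u * (u * f) = f" for f
    using u by (simp_all add: inverse_mult_eq_1 inverse_mult_eq_1' flip: mult.assoc)
  have bij: "bij ((*) u)" by (rule bij_betw_byWitness[of _ "(*) (inverse u)"]) (auto simp: inv)
  have dim: "quotient_dim scaleO ((*) u ` V) ((*) u ` W) = quotient_dim scaleO V W" for V W
    by (rule quotient_dim_bij_image[OF bij]) (simp_all add: algebra_simps)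
  show "quotient_dim scaleO UNIV ((*) u ` N) = quotient_dim scaleO UNIV N"
    using dim[of UNIV N] bij by (simp add: bij_is_surj)
  have "prod_set (id ` max_ideal R) ((*) u ` N) = (*) u ` prod_set (max_ideal R) N"
    by (rule prod_set_image) (simp_all add: algebra_simps)
  then show "rho R ((*) u ` N) = rho R N" by (simp add: rho_def dim)
  have sub: "is_submodule R ((*) v ` N)" if "is_submodule R N" for v N
    unfolding is_submodule_def
  proof (intro conjI ballI)
    show "0 \<in> (*) v ` N" using that by (auto simp: is_submodule_def image_iff intro!: bexI[of _ 0])
    fix f g assume "f \<in> (*) v ` N" "g \<in> (*) v ` N"
    then show "f + g \<in> (*) v ` N"
      using that by (auto simp: is_submodule_def simp flip: distrib_left)
  next
    fix a f assume "a \<in> R" "f \<in> (*) v ` N"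
    then obtain n where "n \<in> N" "f = v * n" by auto
    then have "a * f = v * (a * n)" "a * n \<in> N" using that \<open>a \<in> R\<close> by (simp_all add: is_submodule_def mult_ac)
    then show "a * f \<in> (*) v ` N" by blast
  qed
  show "bij_betw ((`) ((*) u)) overmodules {M \<in> standard_modules R. u \<in> M}"
  proof (rule bij_betw_byWitness[of _ "(`) ((*) (inverse u))"])
    show "\<forall>N\<in>overmodules. (*) (inverse u) ` (*) u ` N = N"
      "\<forall>M\<in>{M \<in> standard_modules R. u \<in> M}. (*) u ` (*) (inverse u) ` M = M"
      by (simp_all add: image_image inv)
    show "(`) ((*) u) ` overmodules \<subseteq> {M \<in> standard_modules R. u \<in> M}"
    proof (rule image_subsetI)
      fix N assume N: "N \<in> overmodules"
      then have "u \<in> (*) u ` N" by (auto simp: overmodules_def image_iff intro!: bexI[of _ 1])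
      then show "(*) u ` N \<in> {M \<in> standard_modules R. u \<in> M}"
        using N u sub by (auto simp: standard_modules_iff overmodules_def intro: bexI[of _ 1])
    qed
    show "(`) ((*) (inverse u)) ` {M \<in> standard_modules R. u \<in> M} \<subseteq> overmodules"
    proof (rule image_subsetI)
      fix M assume M: "M \<in> {M \<in> standard_modules R. u \<in> M}"
      then have "1 \<in> (*) (inverse u) ` M" using u by (auto simp: image_iff inverse_mult_eq_1 intro!: bexI[of _ u])
      then show "(*) (inverse u) ` M \<in> overmodules"
        using M sub by (auto simp: standard_modules_iff overmodules_def)
    qed
  qed
qed

text \<open>
  Double counting of the pairs of a standard module \<open>M\<close> and a unit \<open>u \<in> M\<close> modulo \<open>z^(c+1)\<close>;
  the number of units of \<open>M\<close> is proportional to \<open>q^(- dim(O/M))\<close>, and \<open>M = u N\<close> with \<open>1 \<in> N\<close>.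
\<close>

lemma H_mot_overmodules:
  "H_mot R = (\<Sum>N\<in>overmodules. of_nat (card (UNIV :: 'a set) ^ quotient_dim scaleO UNIV N) *
     monom (a_factor (card (UNIV :: 'a set)) (rho R N)) (quotient_dim scaleO UNIV N))"
proof -
  let ?q = "card (UNIV :: 'a set)"
  define F where "F M = monom (a_factor ?q (rho R M)) (quotient_dim scaleO UNIV M)"
    for M :: "'a fps set"
  define w where "w M = ?q ^ quotient_dim scaleO UNIV M" for M :: "'a fps set"
  define K where "K = ?q ^ c * (?q - 1)"
  have q: "?q > 1" using card_mono[of "UNIV :: 'a set" "{0,1}"] by simp
  have "1 \<in> (UNIV :: 'a fps set)" by simp
  then have UNIV: "UNIV \<in> standard_modules R"
    by (auto simp: standard_modules_iff is_submodule_def intro!: exI[of _ 1])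
  have "quotient_dim scaleO UNIV (UNIV :: 'a fps set) = 0"
    using scaleO.quotient_dim_add[of UNIV UNIV UNIV] finite_quotient_fps[of 0 "UNIV :: 'a fps set" UNIV] by simp
  \<comment> \<open>O is itself a standard module and contains every unit, so the same count also
    gives the total number of units.\<close>
  then have card_units_eq: "card units = K" using card_units[OF UNIV] by (simp add: K_def)
  have "of_nat K * H_mot R = (\<Sum>M\<in>standard_modules R. of_nat (card {u \<in> units. u \<in> M} * w M) * F M)"
    using card_units by (simp add: H_mot_def F_def w_def K_def sum_distrib_left)
  also have "\<dots> = (\<Sum>M\<in>standard_modules R. \<Sum>u\<in>{u \<in> units. u \<in> M}. of_nat (w M) * F M)"
    by (simp add: mult.assoc)
  also have "\<dots> = (\<Sum>u\<in>units. \<Sum>M\<in>{M \<in> standard_modules R. u \<in> M}. of_nat (w M) * F M)"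
    by (rule sum.swap_restrict[OF finite_standard_modules finite_units])
  also have "\<dots> = (\<Sum>u\<in>units. \<Sum>N\<in>overmodules. of_nat (w N) * F N)"
  proof (rule sum.cong[OF refl])
    fix u assume "u \<in> units"
    then have u: "fps_nth u 0 \<noteq> 0" by (simp add: units_def)
    show "(\<Sum>M\<in>{M \<in> standard_modules R. u \<in> M}. of_nat (w M) * F M) = (\<Sum>N\<in>overmodules. of_nat (w N) * F N)"
      unfolding sum.reindex_bij_betw[OF bij_betw_overmodules[OF u], symmetric]
      by (simp add: w_def F_def quotient_dim_unit[OF u] rho_unit[OF u])
  qed
  also have "\<dots> = of_nat K * (\<Sum>N\<in>overmodules. of_nat (w N) * F N)"
    using card_units_eq by simp
  finally have "of_nat K * H_mot R = of_nat K * (\<Sum>N\<in>overmodules. of_nat (w N) * F N)" .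
  \<comment> \<open>K is a positive integer as q > 1, and polynomials over the integers admit its
    cancellation.\<close>
  moreover have "(of_nat K :: int poly poly) \<noteq> 0" using q by (simp add: K_def)
  ultimately show ?thesis by (simp add: F_def w_def)
qed

end

subsection \<open>Duality between modules and ideals\<close>

text \<open>The semigroup enters the duality only through its conductor c, the gap at c - 1, and the
  symmetry count that half of the numbers below c are gaps. The form c = Suc n leaves room for c =
  0.\<close>

locale plane_branch =
  fixes x y :: "'a::{field,finite} fps" and c :: nat
  assumes x_0: "fps_nth x 0 = 0" and y_0: "fps_nth y 0 = 0" and y_nonzero: "y \<noteq> 0"
    and semigroup_ge: "c \<le> n \<Longrightarrow> n \<in> value_semigroup (curve_ring x y)"
    and semigroup_gap: "c = Suc n \<Longrightarrow> n \<notin> value_semigroup (curve_ring x y)"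
    and card_gaps: "2 * card (- value_semigroup (curve_ring x y)) = c"
begin

abbreviation "R \<equiv> curve_ring x y"
abbreviation "S \<equiv> subst2 x y"
abbreviation "C \<equiv> conductor_preimage x y"

lemmas S_mult = subst2_mult[OF x_0 y_0]

lemma R_conductor: "fps_X ^ c dvd f \<Longrightarrow> f \<in> R"
  by (rule curve_ring_conductor[OF x_0 y_0 y_nonzero semigroup_ge])

lemma S_mem: "S f \<in> R"
  by (simp add: curve_ring_def)

sublocale conductor_ring R c
proof
  show "fps_const k \<in> R" for k
    using curve_ring_scale[OF x_0 y_0 curve_ring_1[OF x_0 y_0], of k] by simp
qed (simp_all add: curve_ring_add[OF x_0 y_0] curve_ring_mult[OF x_0 y_0] R_conductor)

lemma quotient_dim_R: "2 * quotient_dim scaleO UNIV R = c"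
  using quotient_dim_gaps[OF R_subspace R_conductor] card_gaps by simp

lemma C_iff: "f \<in> C \<longleftrightarrow> fps_X ^ c dvd S f"
  using quotient_dim_R by (simp add: conductor_preimage_def conductor_def delta_def)

lemma C_subspace: "scaleA.subspace C"
  by (rule scaleA.subspaceI) (simp_all add: C_iff subst2_add subst2_scale)

lemma finite_quotient_R: "finite_quotient UNIV R"
  by (rule finite_quotient_fps[of c]) (rule R_conductor)

lemma finite_quotient_C: "finite_quotient UNIV C"
proof (rule finite_quotientI[of "fps_cutoff c \<circ> S"])
  show "finite ((fps_cutoff c \<circ> S) ` UNIV)"
    by (rule finite_subset[OF _ finite_range_fps_cutoff[of c]]) auto
qed (simp add: C_iff subst2_diff X_power_dvd_diff_iff)

text \<open>R/z^c O has dimension c - \<delta> = \<delta>, and choosing preimages under S separates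
  its cosets in A/C. The pairing supplies the opposite bound.\<close>

lemma quotient_dim_C: "quotient_dim scaleO UNIV R \<le> quotient_dim scaleA UNIV C"
proof -
  let ?Z = "{f :: 'a fps. fps_X ^ c dvd f}"
  have Z: "?Z \<subseteq> R" using R_conductor by auto
  have fin: "finite_quotient U ?Z" for U :: "'a fps set" by (rule finite_quotient_fps[of c]) simp
  have "quotient_dim scaleO UNIV ?Z = quotient_dim scaleO UNIV R + quotient_dim scaleO R ?Z"
    by (rule scaleO.quotient_dim_add[OF _ R_subspace subspace_X_power Z _ fin]) simp_all
  then have eq: "quotient_dim scaleO UNIV R = quotient_dim scaleO R ?Z"
    unfolding quotient_dim_X_power using quotient_dim_R by simp
  obtain B where B: "quotient_basis scaleO R ?Z B"
    using scaleO.quotient_basis_exists[OF R_subspace subspace_X_power Z fin] .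
  obtain B' where B': "quotient_basis scaleA UNIV C B'"
    using scaleA.quotient_basis_exists[OF _ C_subspace _ finite_quotient_C] by auto
  have "card B \<le> card B'"
  proof (rule scaleO.quotient_basis_card_le[OF B B' R_subspace subspace_X_power, of "inv S"])
    show "\<And>a b. a \<in> C \<Longrightarrow> b \<in> C \<Longrightarrow> b - a \<in> C" using C_subspace by (rule scaleA.subspace_diff)
    fix u v assume "u \<in> R" "v \<in> R" "inv S u - inv S v \<in> C"
    then show "u - v \<in> ?Z" by (simp add: C_iff subst2_diff curve_ring_def f_inv_into_f)
  qed simp
  then show ?thesis
    using scaleO.quotient_dim_eq[OF B R_subspace subspace_X_power]
      scaleA.quotient_dim_eq[OF B' _ C_subspace] eq by simp
qed

text \<open>
  A functional on \<open>O/R\<close> that does not vanish at \<open>z^(c-1)\<close> makes \<open>O/R\<close> the dual of \<open>A/C\<close>;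
  this is where the symmetry of the semigroup enters.
\<close>

lemma pairing_exists:
  obtains \<theta> where "perfect_pairing scaleA scaleO (\<lambda>f n. \<theta> (S f * n)) C R"
    and "\<And>u v. \<theta> (u + v) = \<theta> u + \<theta> v" and "\<And>r. r \<in> R \<Longrightarrow> \<theta> r = 0"
proof -
  obtain \<theta> :: "'a fps \<Rightarrow> 'a" where \<theta>: "\<And>u v. \<theta> (u + v) = \<theta> u + \<theta> v" "\<And>k u. \<theta> (scaleO k u) = k * \<theta> u"
    "\<And>r. r \<in> R \<Longrightarrow> \<theta> r = 0" and top: "\<And>n. c = Suc n \<Longrightarrow> \<theta> (fps_X ^ n) = 1"
  proof (cases c)
    \<comment> \<open>Here R = O, so the functional has to be zero.\<close>
    case 0
    then show thesis using that[of "\<lambda>_. 0"] by simp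
  next
    case (Suc n)
    have "fps_X ^ n \<notin> R"
      using semigroup_gap[OF Suc] by (auto simp: value_semigroup_def fps_X_power_subdegree)
    with scaleO.functional_exists[OF R_subspace, of "fps_X ^ n"] obtain \<theta> :: "'a fps \<Rightarrow> 'a" where "\<And>u v. \<theta> (u + v) = \<theta> u + \<theta> v" "\<And>k u. \<theta> (scaleO k u) = k * \<theta> u"
      "\<And>r. r \<in> R \<Longrightarrow> \<theta> r = 0" "\<theta> (fps_X ^ n) = 1" by metis
    then show thesis using that[of \<theta>] Suc by simp
  qed
  define P where "P f n = \<theta> (S f * n)" for f n
  interpret finite_pairing scaleA scaleO P
  proof
    fix f f' n n' k
    show "P (f + f') n = P f n + P f' n" by (simp add: P_def subst2_add distrib_right \<theta>(1))
    show "P (scaleA k f) n = k * P f n" by (simp add: P_def subst2_scale mult.assoc \<theta>(2))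
    show "P f (n + n') = P f n + P f n'" by (simp add: P_def distrib_left \<theta>(1))
    show "P f (scaleO k n) = k * P f n" by (simp add: P_def mult.left_commute \<theta>(2))
  qed
  have vanish: "P f n = 0" if "f \<in> C" for f n
    using that \<theta>(3)[OF R_conductor] by (simp add: P_def C_iff dvd_mult2)
  have nondeg: "f \<in> C" if f: "\<And>n. P f n = 0" for f
  proof (rule ccontr)
    assume "f \<notin> C"
    then have k: "subdegree (S f) < c" using X_power_dvd_subdegree[of c "S f"] unfolding C_iff by linarith
    have nz: "S f \<noteq> 0" using \<open>f \<notin> C\<close> by (auto simp: C_iff)
    define w where "w = fps_shift (subdegree (S f)) (S f)"
    have w: "S f = fps_X ^ subdegree (S f) * w" "fps_nth w 0 \<noteq> 0"
      using nz subdegree_decompose[of "S f"] by (simp_all only: w_def mult.commute) simp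
    obtain n where n: "c = Suc n" using k by (cases c) auto
    \<comment> \<open>Dividing S f by its unit part and raising its order to c - 1 reaches the power
      of z at which \<theta> equals 1.\<close>
    have "S f * (fps_X ^ (n - subdegree (S f)) * inverse w) = fps_X ^ subdegree (S f) * fps_X ^ (n - subdegree (S f)) * (w * inverse w)"
      by (subst w(1)) (simp only: mult_ac)
    also have "\<dots> = fps_X ^ n"
      using w(2) k n by (simp add: inverse_mult_eq_1' flip: power_add)
    finally have "P f (fps_X ^ (n - subdegree (S f)) * inverse w) = 1"
      using top[OF n] by (simp add: P_def)
    then show False using f by simp
  qed
  \<comment> \<open>The right radical. It contains R, and the chain \<delta> \<le> dim A/C \<le> dim
    O/R' \<le> dim O/R = \<delta> leaves no room between them.\<close>
  define R' where "R' = {n. \<forall>f. P f n = 0}"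
  have R': "scaleO.subspace R'"
    by (rule scaleO.subspaceI) (simp_all add: R'_def add_right scale_right)
  have RR': "R \<subseteq> R'" using \<theta>(3) R_mult[OF S_mem] by (auto simp: R'_def P_def)
  then have fin: "finite_quotient UNIV R'" "finite_quotient R' R"
    using finite_quotient_mono[OF finite_quotient_R] by auto
  have "quotient_dim scaleA UNIV C \<le> quotient_dim scaleO UNIV R'"
    by (rule quotient_dim_le)
      (use C_subspace R' finite_quotient_C fin vanish nondeg in \<open>auto simp: R'_def\<close>)
  moreover have "quotient_dim scaleO UNIV R = quotient_dim scaleO UNIV R' + quotient_dim scaleO R' R"
    by (rule scaleO.quotient_dim_add[OF _ R' R_subspace RR' _ finite_quotient_R]) simp_all
  ultimately have "quotient_dim scaleO R' R = 0" using quotient_dim_C by simp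
  then have "R' = R" using scaleO.quotient_dim_eq_0[OF R' R_subspace RR' fin(2)] by simp
  then have "n \<in> R \<longleftrightarrow> (\<forall>f. P f n = 0)" for n by (auto simp: R'_def)
  then have "perfect_pairing scaleA scaleO P C R"
    using vanish nondeg C_subspace R_subspace finite_quotient_C finite_quotient_R
    by unfold_locales auto
  then show thesis using that[of \<theta>] \<theta> unfolding P_def by blast
qed

lemma overmodules_subset: "N \<in> overmodules \<Longrightarrow> R \<subseteq> N"
  unfolding overmodules_def is_submodule_def by (metis (mono_tags, lifting) mem_Collect_eq mult.right_neutral subsetI)

lemma overmodules_subspace: "N \<in> overmodules \<Longrightarrow> scaleO.subspace N"
  unfolding overmodules_def using is_submodule_subspace R_const by blast

lemma max_ideal_iff: "r \<in> max_ideal R \<longleftrightarrow> (\<exists>g\<in>order_ge 1. r = S g)"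
proof -
  have "fps_X dvd S g \<longleftrightarrow> g \<in> order_ge 1" for g
    using X_power_dvd_iff[of 1 "S g"] by (simp add: order_ge_1_iff)
  then show ?thesis by (auto simp: max_ideal_def curve_ring_iff)
qed

lemma slice_subspace: "I \<in> instanton_slice x y \<Longrightarrow> scaleA.subspace I"
  unfolding instanton_slice_def is_submodule_def by (intro scaleA.subspaceI) auto

text \<open>The right-hand side uses only the algebra A, the ideal C and the number c. The
  subtraction is exact: if I is the annihilator of N, then dim A/I = dim N/R \<le> \<delta> =
  c/2.\<close>

lemma H_mot_slice:
  "H_mot R = (\<Sum>I\<in>instanton_slice x y.
     of_nat (card (UNIV :: 'a set) ^ (c div 2 - quotient_dim scaleA UNIV I)) *
     monom (a_factor (card (UNIV :: 'a set)) (1 + quotient_dim scaleA (colon I) I))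
       (c div 2 - quotient_dim scaleA UNIV I))"
proof -
  obtain \<theta> where pp: "perfect_pairing scaleA scaleO (\<lambda>f n. \<theta> (S f * n)) C R"
    and add: "\<And>u v. \<theta> (u + v) = \<theta> u + \<theta> v" and zero: "\<And>r. r \<in> R \<Longrightarrow> \<theta> r = 0"
    using pairing_exists by metis
  define P where "P f n = \<theta> (S f * n)" for f n
  interpret perfect_pairing scaleA scaleO P C R using pp unfolding P_def .
  interpret sw: perfect_pairing scaleO scaleA "\<lambda>n f. P f n" R C by (rule perfect_pairing_swap)
  \<comment> \<open>The action of A on both sides is adjoint for P, so annihilators of modules are
    ideals and conversely.\<close>
  have P_mult: "P (a * f) n = P f (S a * n)" for a f n by (simp add: P_def S_mult mult_ac)
  have S_mult_mem: "S a * n \<in> N" if "N \<in> overmodules" "n \<in> N" for a n N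
    using that S_mem by (auto simp: overmodules_def is_submodule_def)
  have perp_slice: "perp N \<in> instanton_slice x y" if N: "N \<in> overmodules" for N
    using L0_subset_perp[of N] subspace_perp[of N] S_mult_mem[OF N]
    by (auto simp: instanton_slice_def is_submodule_def perp_def P_mult add_left)
  have perp_over: "sw.perp I \<in> overmodules" if I: "I \<in> instanton_slice x y" for I
  proof -
    have "a * n \<in> sw.perp I" if "a \<in> R" "n \<in> sw.perp I" for a n
    proof -
      obtain b where "a = S b" using \<open>a \<in> R\<close> by (auto simp: curve_ring_iff)
      then show ?thesis using that I P_mult[symmetric]
        by (auto simp: sw.perp_def instanton_slice_def is_submodule_def)
    qed
    moreover have "1 \<in> sw.perp I" unfolding sw.perp_def using zero[OF S_mem] by (simp add: P_def)
    ultimately show ?thesis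
      by (simp add: overmodules_def is_submodule_def) (simp add: sw.perp_def add_right)
  qed
  have bij: "bij_betw perp overmodules (instanton_slice x y)"
  proof (rule bij_betw_byWitness[of _ sw.perp])
    show "\<forall>N\<in>overmodules. sw.perp (perp N) = N"
      using perp_perp overmodules_subspace overmodules_subset by blast
    show "\<forall>I\<in>instanton_slice x y. perp (sw.perp I) = I"
      using sw.perp_perp slice_subspace by (auto simp: instanton_slice_def)
  qed (use perp_slice perp_over in auto)
  have codim: "quotient_dim scaleO UNIV N = c div 2 - quotient_dim scaleA UNIV (perp N)"
    if N: "N \<in> overmodules" for N
  proof -
    note N' = overmodules_subspace[OF N] overmodules_subset[OF N]
    have "quotient_dim scaleO UNIV R = quotient_dim scaleO UNIV N + quotient_dim scaleO N R"
      by (rule scaleO.quotient_dim_add[OF _ N'(1) R_subspace N'(2) _ finite_quotient_R]) simp_all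
    then show ?thesis using quotient_dim_perp[OF N'] quotient_dim_R by simp
  qed
  have rank: "rho R N = 1 + quotient_dim scaleA (colon (perp N)) (perp N)" if N: "N \<in> overmodules" for N
  proof -
    note N' = overmodules_subspace[OF N] overmodules_subset[OF N]
    have N_1: "1 \<in> N" and N_sub: "is_submodule R N" using N by (auto simp: overmodules_def)
    define mN where "mN = prod_set (max_ideal R) N"
    \<comment> \<open>Annihilators recover only subspaces that contain R, and \<open>mN\<close>
      lacks 1. Adding the constants repairs this; the extra line is the summand 1 in the rank, and
      dim N/K becomes the socle dimension.\<close>
    define K where "K = {u. \<exists>k. u - scaleO k 1 \<in> mN}"
    have mN_sum: "(\<Sum>i<n. a i * u i) \<in> mN" if "\<And>i. i < n \<Longrightarrow> a i \<in> max_ideal R \<and> u i \<in> N" for n :: nat and a u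
      using that unfolding mN_def prod_set_def by blast
    have mN_mult: "a * u \<in> mN" if "a \<in> max_ideal R" "u \<in> N" for a u
      using mN_sum[of 1 "\<lambda>_. a" "\<lambda>_. u"] that by simp
    have mN_subspace: "scaleO.subspace mN"
    proof (rule scaleO.subspaceI)
      show "0 \<in> mN" using mN_sum[of 0] by simp
      fix f g assume "f \<in> mN" "g \<in> mN"
      then obtain n a u n' a' u' where f: "f = (\<Sum>i<(n::nat). a i * u i)" "\<forall>i<n. a i \<in> max_ideal R \<and> u i \<in> N"
        and g: "g = (\<Sum>i<(n'::nat). a' i * u' i)" "\<forall>i<n'. a' i \<in> max_ideal R \<and> u' i \<in> N"
        by (auto simp: mN_def prod_set_def)
      have "f + g = (\<Sum>i<n + n'. (if i < n then a i else a' (i - n)) * (if i < n then u i else u' (i - n)))"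
      proof -
        have "(\<Sum>i<n + n'. (if i < n then a i else a' (i - n)) * (if i < n then u i else u' (i - n)))
          = (\<Sum>i<n. a i * u i) + (\<Sum>i=n..<n + n'. a' (i - n) * u' (i - n))"
          by (simp add: lessThan_atLeast0 flip: sum.atLeastLessThan_concat[of 0 n "n + n'"])
        also have "(\<Sum>i=n..<n + n'. a' (i - n) * u' (i - n)) = (\<Sum>i<n'. a' i * u' i)"
          by (subst sum.atLeastLessThan_shift_0) (simp add: atLeast0LessThan)
        finally show ?thesis using f g by simp
      qed
      also have "\<dots> \<in> mN" by (rule mN_sum) (use f g in auto)
      finally show "f + g \<in> mN" .
    next
      fix k f assume "f \<in> mN"
      then obtain n a u where f: "f = (\<Sum>i<(n::nat). a i * u i)" "\<forall>i<n. a i \<in> max_ideal R \<and> u i \<in> N"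
        by (auto simp: mN_def prod_set_def)
      have "scaleO k f = (\<Sum>i<n. a i * scaleO k (u i))" by (simp add: f sum_distrib_left mult_ac)
      also have "\<dots> \<in> mN" by (rule mN_sum) (use f N' scaleO.subspace_scale in blast)
      finally show "scaleO k f \<in> mN" .
    qed
    have max_dvd: "fps_X dvd a" if "a \<in> max_ideal R" for a using that by (simp add: max_ideal_def)
    have mN_X: "mN \<subseteq> {f. fps_X dvd f}"
      unfolding mN_def prod_set_def by (auto intro!: dvd_sum dvd_mult2 dest: max_dvd)
    have mN_N: "mN \<subseteq> N"
    proof
      fix f assume "f \<in> mN"
      then obtain n a u where f: "f = (\<Sum>i<(n::nat). a i * u i)" "\<forall>i<n. a i \<in> max_ideal R \<and> u i \<in> N"
        by (auto simp: mN_def prod_set_def)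
      show "f \<in> N"
        unfolding f(1) by (rule scaleO.subspace_sum[OF N'(1)])
          (use f(2) N_sub in \<open>auto simp: is_submodule_def max_ideal_def\<close>)
    qed
    have max_mN: "a \<in> mN" if "a \<in> max_ideal R" for a using mN_mult[OF that N_1] by simp
    have K_subspace: "scaleO.subspace K"
    proof (rule scaleO.subspaceI)
      show "0 \<in> K" using mN_subspace by (auto simp: K_def scaleO.subspace_0 intro!: exI[of _ 0])
      fix f g assume "f \<in> K" "g \<in> K"
      then obtain k l where "f - scaleO k 1 \<in> mN" "g - scaleO l 1 \<in> mN" by (auto simp: K_def)
      then have "(f - scaleO k 1) + (g - scaleO l 1) \<in> mN" using mN_subspace by (blast intro: scaleO.subspace_add)
      then show "f + g \<in> K" unfolding K_def by (intro CollectI exI[of _ "k + l"]) (simp add: algebra_simps flip: fps_const_add)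
    next
      fix k f assume "f \<in> K"
      then obtain l where "f - scaleO l 1 \<in> mN" by (auto simp: K_def)
      then have "scaleO k (f - scaleO l 1) \<in> mN" using mN_subspace by (blast intro: scaleO.subspace_scale)
      then show "scaleO k f \<in> K" unfolding K_def by (intro CollectI exI[of _ "k * l"]) (simp add: algebra_simps flip: fps_const_mult)
    qed
    have mN_K: "mN \<subseteq> K" by (auto simp: K_def intro!: exI[of _ 0])
    have R_K: "R \<subseteq> K"
    proof
      fix r assume r: "r \<in> R"
      have "r - scaleO (fps_nth r 0) 1 \<in> R"
        using r scaleO.subspace_diff[OF R_subspace] R_const by simp
      moreover have "fps_X ^ 1 dvd r - scaleO (fps_nth r 0) 1" unfolding X_power_dvd_iff by simp
      ultimately have "r - scaleO (fps_nth r 0) 1 \<in> max_ideal R" by (simp add: max_ideal_def)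
      then show "r \<in> K" using max_mN by (auto simp: K_def)
    qed
    have K_N: "K \<subseteq> N"
    proof
      fix u assume "u \<in> K"
      then obtain k where "u - scaleO k 1 \<in> N" using mN_N by (auto simp: K_def)
      then have "(u - scaleO k 1) + scaleO k 1 \<in> N" using N' N_1 by (blast intro: scaleO.subspace_add scaleO.subspace_scale)
      then show "u \<in> N" by simp
    qed
    have fin: "finite_quotient U mN" for U
    proof (rule finite_quotient_fps[of "Suc c"])
      fix f :: "'a fps" assume f: "fps_X ^ Suc c dvd f"
      then have "f \<in> R" "fps_X dvd f"
        using R_conductor X_power_dvd_le[OF f, of c] X_power_dvd_le[OF f, of 1] by auto
      then show "f \<in> mN" using max_mN by (simp add: max_ideal_def)
    qed
    have "quotient_dim scaleO N mN = quotient_dim scaleO N K + quotient_dim scaleO K mN"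
      by (rule scaleO.quotient_dim_add[OF N'(1) K_subspace mN_subspace mN_K K_N fin])
    moreover have "quotient_dim scaleO K mN = 1"
      by (rule quotient_dim_singleton[OF K_subspace mN_subspace mN_X, of 1])
        (use R_K R_const[of 1] in \<open>auto simp: K_def\<close>)
    moreover have "quotient_dim scaleO N R = quotient_dim scaleO N K + quotient_dim scaleO K R"
      by (rule scaleO.quotient_dim_add[OF N'(1) K_subspace R_subspace R_K K_N
            finite_quotient_mono[OF finite_quotient_R]]) simp_all
    \<comment> \<open>By adjointness, f annihilates m N exactly if m f annihilates N. The constants
      impose no further condition, because \<theta> vanishes on R.\<close>
    moreover have perp_K: "perp K = colon (perp N)"
    proof (intro subset_antisym subsetI)
      fix f assume f: "f \<in> perp K"
      have "P (g * f) n = 0" if "g \<in> order_ge 1" "n \<in> N" for g n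
      proof -
        have "S g * n \<in> K" using mN_mult[of "S g" n] that mN_K max_ideal_iff by blast
        then show ?thesis using f by (simp add: P_mult perp_def)
      qed
      then show "f \<in> colon (perp N)" by (simp add: colon_def perp_def)
    next
      fix f assume f: "f \<in> colon (perp N)"
      have "P f u = 0" if "u \<in> K" for u
      proof -
        obtain k n a w where u: "u - scaleO k 1 = (\<Sum>i<(n::nat). a i * w i)"
          and aw: "\<forall>i<n. a i \<in> max_ideal R \<and> w i \<in> N"
          using \<open>u \<in> K\<close> by (auto simp: K_def mN_def prod_set_def)
        have "P f (a i * w i) = 0" if "i < n" for i
        proof -
          obtain g where "g \<in> order_ge 1" "a i = S g" using aw \<open>i < n\<close> max_ideal_iff by blast
          then show ?thesis using f aw that by (simp add: colon_def perp_def flip: P_mult)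
        qed
        then have "P f (\<Sum>i<n. a i * w i) = 0" by (simp add: sum_right)
        moreover have "P f (scaleO k 1) = 0" unfolding scale_right using zero[OF S_mem] by (simp add: P_def)
        moreover have "u = (\<Sum>i<n. a i * w i) + scaleO k 1" using u by (metis diff_add_cancel)
        ultimately show ?thesis by (simp only: add_right) simp
      qed
      then show "f \<in> perp K" by (simp add: perp_def)
    qed
    moreover have "quotient_dim scaleA UNIV (perp K) = quotient_dim scaleO K R"
      "quotient_dim scaleA UNIV (perp N) = quotient_dim scaleO N R"
      using quotient_dim_perp K_subspace R_K N' by auto
    moreover have "quotient_dim scaleA UNIV (perp N) = quotient_dim scaleA UNIV (perp K) + quotient_dim scaleA (perp K) (perp N)"
      by (rule scaleA.quotient_dim_add[OF _ subspace_perp subspace_perp _ _ finite_quotient_mono[OF finite_quotient_C]])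
        (use K_N L0_subset_perp in \<open>auto simp: perp_def\<close>)
    ultimately show ?thesis by (simp add: rho_def mN_def)
  qed
  show ?thesis
    unfolding H_mot_overmodules sum.reindex_bij_betw[OF bij, symmetric]
    by (rule sum.cong) (simp_all add: codim rank)
qed

end

subsection \<open>The value semigroup\<close>

locale two_pair_semigroup =
  fixes \<upsilon> r s p :: nat
  assumes s_pos: "0 < s" and s_less_r: "s < r" and \<upsilon>_pos: "0 < \<upsilon>" and p_pos: "0 < p"
    and coprime_rs: "coprime r s" and coprime_\<upsilon>p: "coprime \<upsilon> p"
begin

definition \<gamma> :: nat where "\<gamma> = \<upsilon> * r * s + p"

lemma coprime_\<upsilon>_\<gamma>: "coprime \<upsilon> \<gamma>"
  unfolding coprime_iff_gcd_eq_1 \<gamma>_def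
  using coprime_\<upsilon>p gcd_add_mult[of \<upsilon> "r * s" p] by (simp add: mult_ac coprime_iff_gcd_eq_1)

abbreviation "\<Gamma> \<equiv> gen_semigroup (\<upsilon> * s) (\<upsilon> * r) \<gamma>"

text \<open>The order of x^i y^j h^k on the curve, extended to integers so that gaps too have a
  normal form, with negative j.\<close>

definition weight :: "int \<Rightarrow> int \<Rightarrow> int \<Rightarrow> int" where
  "weight i j k = i * (\<upsilon> * r) + j * (\<upsilon> * s) + k * \<gamma>"

lemma int_dvd_diff_less:
  assumes "int n dvd a - b" "0 \<le> a" "a < n" "0 \<le> b" "b < n"
  shows "a = b"
  using assms by (metis mod_eq_dvd_iff mod_pos_pos_trivial)

text \<open>As \<gamma> is congruent to p modulo \<upsilon>, the weight determines k modulo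
  \<upsilon>; after division by \<upsilon>, coprimality of r and s determines i modulo s.\<close>

lemma weight_unique:
  assumes eq: "weight i j k = weight i' j' k'"
    and i: "0 \<le> i" "i < s" "0 \<le> i'" "i' < s" and k: "0 \<le> k" "k < \<upsilon>" "0 \<le> k'" "k' < \<upsilon>"
  shows "i = i' \<and> j = j' \<and> k = k'"
proof -
  have "(k - k') * p = \<upsilon> * (r * (i' - i) + s * (j' - j) - (k - k') * r * s)"
    using eq by (simp add: weight_def \<gamma>_def algebra_simps)
  then have "int \<upsilon> dvd (k - k') * p" by (metis dvd_triv_left)
  then have "int \<upsilon> dvd k - k'"
    using coprime_\<upsilon>p by (simp add: coprime_dvd_mult_left_iff)
  then have kk: "k = k'" using int_dvd_diff_less k by blast
  have "\<upsilon> * ((i - i') * r) = \<upsilon> * (s * (j' - j))"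
    using eq kk by (simp add: weight_def algebra_simps)
  then have ij: "(i - i') * r = s * (j' - j)" using \<upsilon>_pos by simp
  then have "int s dvd (i - i') * r" by (metis dvd_triv_left)
  then have "int s dvd i - i'"
    using coprime_rs by (simp add: coprime_dvd_mult_left_iff coprime_commute)
  then have "i = i'" using int_dvd_diff_less i by blast
  with ij kk s_pos show ?thesis by simp
qed

lemma congruent_multiple:
  assumes "coprime (int n) d" "0 < n"
  obtains k where "0 \<le> k" "k < int n" "int n dvd a - k * d"
proof -
  obtain u v where uv: "u * int n + v * d = 1"
    using assms(1) by (metis bezout_int coprime_imp_gcd_eq_1)
  define k where "k = (a * v) mod int n"
  have "a - k * d = a * (u * int n + v * d) - k * d" by (simp add: uv)
  also have "\<dots> = int n * (a * u) + (a * v - k) * d" by (simp add: algebra_simps)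
  finally have "int n dvd a - k * d"
    by (simp add: k_def mod_eq_dvd_iff minus_mod_eq_mult_div)
  then show thesis using that[of k] assms(2) by (simp add: k_def)
qed

lemma weight_exists:
  obtains i j k where "n = weight i j k" "0 \<le> i" "i < s" "0 \<le> k" "k < \<upsilon>"
proof -
  have "coprime (int \<upsilon>) (int \<gamma>)" using coprime_\<upsilon>_\<gamma> by simp
  then obtain k :: int where k: "0 \<le> k" "k < \<upsilon>" "int \<upsilon> dvd n - k * \<gamma>"
    by (rule congruent_multiple[OF _ \<upsilon>_pos, of "int \<gamma>" n])
  then obtain n' :: int where n': "n - k * \<gamma> = \<upsilon> * n'" by (auto elim: dvdE)
  have "coprime (int s) (int r)" using coprime_rs by (simp add: coprime_commute)
  then obtain i :: int where i: "0 \<le> i" "i < s" "int s dvd n' - i * r"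
    by (rule congruent_multiple[OF _ s_pos, of "int r" n'])
  then obtain j :: int where "n' - i * r = s * j" by (auto elim: dvdE)
  then have "n = weight i j k" using n' by (simp add: weight_def algebra_simps)
  then show thesis using that i k by blast
qed

text \<open>Among the unique normal forms of integers, the semigroup is singled out by the sign of
  j.\<close>

definition in_semigroup :: "int \<Rightarrow> bool" where
  "in_semigroup n \<longleftrightarrow> (\<exists>i j k. n = weight i j k \<and> 0 \<le> i \<and> i < s \<and> 0 \<le> j \<and> 0 \<le> k \<and> k < \<upsilon>)"

text \<open>Since \<gamma> exceeds r s, it lies in the semigroup of r and s. Hence \<upsilon>
  \<gamma> is a combination of \<upsilon> r and \<upsilon> s, which allows k to be reduced below
  \<upsilon>.\<close>

lemma \<gamma>_decomp: obtains i j :: nat where "\<gamma> = i * r + j * s"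
proof -
  have "coprime (int s) (int r)" using coprime_rs by (simp add: coprime_commute)
  then obtain i :: int where i: "0 \<le> i" "i < s" "int s dvd int \<gamma> - i * r"
    by (rule congruent_multiple[OF _ s_pos, of "int r" "int \<gamma>"])
  then obtain j :: int where j: "int \<gamma> - i * r = s * j" by (auto elim: dvdE)
  have "i * r \<le> int s * r" using i by (intro mult_right_mono) auto
  also have "\<dots> \<le> int \<gamma>"
  proof -
    have "s * r \<le> \<upsilon> * (s * r)" using \<upsilon>_pos by (cases \<upsilon>) auto
    moreover have "\<gamma> = \<upsilon> * (s * r) + p" by (simp add: \<gamma>_def)
    ultimately have "s * r \<le> \<gamma>" by linarith
    then show ?thesis by (metis of_nat_le_iff of_nat_mult)
  qed
  finally have "0 \<le> int s * j" using j by simp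
  then have "0 \<le> j" using s_pos by (simp add: zero_le_mult_iff)
  then have "int \<gamma> = int (nat i * r + nat j * s)" using j i by (simp add: algebra_simps)
  then show thesis using that by (metis of_nat_eq_iff)
qed

text \<open>Two rewritings reach the normal form: \<upsilon> copies of \<gamma> by
  \<open>\<gamma>_decomp\<close>, then s copies of \<upsilon> r by r copies of \<upsilon> s.\<close>

lemma semigroup_iff: "n \<in> \<Gamma> \<longleftrightarrow> in_semigroup (int n)"
proof
  assume "n \<in> \<Gamma>"
  then obtain a b d where n: "n = a * (\<upsilon> * s) + b * (\<upsilon> * r) + d * \<gamma>" by (auto simp: gen_semigroup_def)
  obtain i0 j0 where ij: "\<gamma> = i0 * r + j0 * s" by (rule \<gamma>_decomp)
  define d1 where "d1 = d div \<upsilon>"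
  define b' where "b' = b + d1 * i0"
  have d: "d = \<upsilon> * d1 + d mod \<upsilon>" by (simp add: d1_def)
  obtain q i where b': "b' = s * q + i" and i: "i < s"
    using s_pos that[of "b' div s" "b' mod s"] by simp
  have "n = a * (\<upsilon> * s) + b * (\<upsilon> * r) + (\<upsilon> * d1 + d mod \<upsilon>) * \<gamma>" using n d by metis
  also have "\<dots> = a * (\<upsilon> * s) + b * (\<upsilon> * r) + \<upsilon> * d1 * (i0 * r + j0 * s) + (d mod \<upsilon>) * \<gamma>"
    using ij by (simp add: algebra_simps)
  also have "\<dots> = b' * (\<upsilon> * r) + (a + d1 * j0) * (\<upsilon> * s) + (d mod \<upsilon>) * \<gamma>"
    by (simp add: b'_def algebra_simps)
  also have "\<dots> = i * (\<upsilon> * r) + (a + d1 * j0 + r * q) * (\<upsilon> * s) + (d mod \<upsilon>) * \<gamma>"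
    unfolding b' by (simp add: algebra_simps)
  finally have "int n = weight (int i) (int (a + d1 * j0 + r * q)) (int (d mod \<upsilon>))"
    unfolding weight_def by (metis of_nat_add of_nat_mult)
  then show "in_semigroup (int n)"
    unfolding in_semigroup_def using i \<upsilon>_pos
    by (intro exI[of _ "int i"] exI[of _ "int (a + d1 * j0 + r * q)"] exI[of _ "int (d mod \<upsilon>)"]) simp
next
  assume "in_semigroup (int n)"
  then obtain i j k where n: "int n = weight i j k" and pos: "0 \<le> i" "0 \<le> j" "0 \<le> k"
    by (auto simp: in_semigroup_def)
  have "int n = int (nat j * (\<upsilon> * s) + nat i * (\<upsilon> * r) + nat k * \<gamma>)"
    using n pos by (simp add: weight_def)
  then have "n = nat j * (\<upsilon> * s) + nat i * (\<upsilon> * r) + nat k * \<gamma>" by (simp only: of_nat_eq_iff)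
  then show "n \<in> \<Gamma>" by (auto simp: gen_semigroup_def)
qed

lemma in_semigroup_nonneg: "in_semigroup n \<Longrightarrow> 0 \<le> n"
  by (auto simp: in_semigroup_def weight_def)

text \<open>The largest gap is the weight of \<open>(s - 1, - 1, \<upsilon> - 1)\<close>, which makes the semigroup symmetric.\<close>

definition max_gap :: int where "max_gap = weight (int s - 1) (- 1) (int \<upsilon> - 1)"

text \<open>In normal form the reflection sends j to - 1 - j and keeps i and k in range, so it
  exchanges j \<ge> 0 with j < 0.\<close>

lemma in_semigroup_symmetric: "in_semigroup (max_gap - n) \<longleftrightarrow> \<not> in_semigroup n"
proof -
  obtain i j k where n: "n = weight i j k" and ik: "0 \<le> i" "i < s" "0 \<le> k" "k < \<upsilon>"
    by (rule weight_exists)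
  have t: "max_gap - n = weight (int s - 1 - i) (- 1 - j) (int \<upsilon> - 1 - k)"
    by (simp add: max_gap_def n weight_def algebra_simps)
  have iff: "in_semigroup (weight i j k) \<longleftrightarrow> 0 \<le> j" if "0 \<le> i" "i < s" "0 \<le> k" "k < \<upsilon>" for i j k :: int
  proof
    assume "in_semigroup (weight i j k)"
    then obtain i' j' k' where eq: "weight i j k = weight i' j' k'"
      and "0 \<le> i'" "i' < s" "0 \<le> j'" "0 \<le> k'" "k' < \<upsilon>" unfolding in_semigroup_def by blast
    with weight_unique[OF eq] that show "0 \<le> j" by simp
  next
    assume "0 \<le> j"
    with that show "in_semigroup (weight i j k)"
      unfolding in_semigroup_def by (intro exI[of _ i] exI[of _ j] exI[of _ k]) simp
  qed
  have "in_semigroup (max_gap - n) \<longleftrightarrow> 0 \<le> - 1 - j"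
    unfolding t by (rule iff) (use ik in auto)
  moreover have "in_semigroup n \<longleftrightarrow> 0 \<le> j" unfolding n by (rule iff) (use ik in auto)
  ultimately show ?thesis by linarith
qed

text \<open>Since - 1 is not in the semigroup, its reflection \<open>max_gap + 1\<close> is. The
  value \<open>max_gap\<close> = - 1 occurs when there are no gaps.\<close>

lemma max_gap_ge: "0 \<le> max_gap + 1"
  using in_semigroup_symmetric[of "- 1"] in_semigroup_nonneg[of "- 1"] in_semigroup_nonneg[of "max_gap + 1"] by fastforce

definition c :: nat where "c = nat (max_gap + 1)"

lemma c_le: "c \<le> n \<Longrightarrow> n \<in> \<Gamma>"
  using in_semigroup_symmetric[of "int n"] in_semigroup_nonneg[of "max_gap - int n"]
  by (auto simp: semigroup_iff c_def)

lemma c_gap: "c = Suc n \<Longrightarrow> n \<notin> \<Gamma>"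
proof -
  assume "c = Suc n"
  then have "int n = max_gap" by (simp add: c_def)
  moreover have "in_semigroup 0"
    unfolding in_semigroup_def using s_pos \<upsilon>_pos by (intro exI[of _ 0]) (simp add: weight_def)
  ultimately show ?thesis using in_semigroup_symmetric[of 0] by (simp add: semigroup_iff)
qed

lemma card_gaps: "2 * card (- \<Gamma>) = c"
proof -
  have gaps: "- \<Gamma> = {n. n < c \<and> n \<notin> \<Gamma>}" using c_le by (auto simp: not_le[symmetric])
  have swap: "c - Suc n \<in> \<Gamma> \<longleftrightarrow> n \<notin> \<Gamma>" if "n < c" for n
  proof -
    have "int (c - Suc n) = max_gap - int n" using that by (simp add: c_def)
    then show ?thesis using in_semigroup_symmetric[of "int n"] by (simp add: semigroup_iff)
  qed
  have "bij_betw (\<lambda>n. c - Suc n) {n. n < c \<and> n \<notin> \<Gamma>} {n. n < c \<and> n \<in> \<Gamma>}"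
    by (rule bij_betw_byWitness[of _ "\<lambda>n. c - Suc n"]) (auto simp: swap)
  then have "card {n. n < c \<and> n \<notin> \<Gamma>} = card {n. n < c \<and> n \<in> \<Gamma>}" by (rule bij_betw_same_card)
  moreover have "card ({n. n < c \<and> n \<notin> \<Gamma>} \<union> {n. n < c \<and> n \<in> \<Gamma>})
      = card {n. n < c \<and> n \<notin> \<Gamma>} + card {n. n < c \<and> n \<in> \<Gamma>}"
    by (rule card_Un_disjoint) auto
  moreover have "{n. n < c \<and> n \<notin> \<Gamma>} \<union> {n. n < c \<and> n \<in> \<Gamma>} = {..<c}" by auto
  ultimately show ?thesis by (simp add: gaps)
qed

lemma int_c: "int c = (int s - 1) * (\<upsilon> * r) - \<upsilon> * s + (int \<upsilon> - 1) * \<gamma> + 1"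
  using max_gap_ge by (simp add: c_def max_gap_def weight_def)

lemma c_le_\<upsilon>_\<gamma>: "c \<le> \<upsilon> * \<gamma>"
proof -
  have "int c \<le> int (\<upsilon> * \<gamma>)"
  proof -
    have "int (\<upsilon> * \<gamma>) - int c = int \<upsilon> * int r + int \<upsilon> * int s + int p - 1"
      by (simp add: int_c \<gamma>_def algebra_simps)
    moreover have "0 \<le> int \<upsilon> * int r" "0 \<le> int \<upsilon> * int s" by simp_all
    ultimately show ?thesis using p_pos by linarith
  qed
  then show ?thesis by linarith
qed

text \<open>A weight below c forces k < \<upsilon> because c \<le> \<upsilon> \<gamma>, so the
  uniqueness of normal forms applies without a bound on k.\<close>

lemma weight_inj:
  assumes eq: "i * (\<upsilon> * r) + j * (\<upsilon> * s) + k * \<gamma> = i' * (\<upsilon> * r) + j' * (\<upsilon> * s) + k' * \<gamma>"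
    and less: "i * (\<upsilon> * r) + j * (\<upsilon> * s) + k * \<gamma> < c" and i: "i < s" "i' < s"
  shows "i = i' \<and> j = j' \<and> k = k'"
proof -
  have "k * \<gamma> < \<upsilon> * \<gamma>" "k' * \<gamma> < \<upsilon> * \<gamma>" using less eq c_le_\<upsilon>_\<gamma> by linarith+
  then have k: "k < \<upsilon>" "k' < \<upsilon>" by simp_all
  have "weight (int i) (int j) (int k) = weight (int i') (int j') (int k')"
    using arg_cong[OF eq, of int] by (simp add: weight_def)
  from weight_unique[OF this] show ?thesis using i k by simp
qed

section \<open>Recovering the generators from the semigroup\<close>

lemma multiplicity: "n \<in> \<Gamma> \<Longrightarrow> 0 < n \<Longrightarrow> \<upsilon> * s \<le> n"
proof -
  assume "n \<in> \<Gamma>" "0 < n"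
  then obtain a b d where n: "n = a * (\<upsilon> * s) + b * (\<upsilon> * r) + d * \<gamma>" by (auto simp: gen_semigroup_def)
  have "\<upsilon> * s \<le> \<upsilon> * s * r" using s_less_r by (cases r) auto
  moreover have "\<gamma> = \<upsilon> * s * r + p" by (simp add: \<gamma>_def mult_ac)
  ultimately have "\<upsilon> * s \<le> \<gamma>" by linarith
  have le: "\<upsilon> * s \<le> \<upsilon> * r" using s_less_r by (intro mult_le_mono2) simp
  from n \<open>0 < n\<close> consider "0 < a" | "0 < b" | "0 < d" by fastforce
  then show "\<upsilon> * s \<le> n"
  proof cases
    case 1
    then have "\<upsilon> * s \<le> a * (\<upsilon> * s)" by (cases a) auto
    then show ?thesis unfolding n by linarith
  next
    case 2
    then have "\<upsilon> * r \<le> b * (\<upsilon> * r)" by (cases b) auto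
    then show ?thesis unfolding n using le by linarith
  next
    case 3
    then have "\<gamma> \<le> d * \<gamma>" by (cases d) auto
    then show ?thesis unfolding n using \<open>\<upsilon> * s \<le> \<gamma>\<close> by linarith
  qed
qed

lemma multiplicity_mem: "\<upsilon> * s \<in> \<Gamma>"
  unfolding gen_semigroup_def by (intro CollectI exI[of _ 1] exI[of _ 0]) simp

text \<open>If \<upsilon> s > 1, the least element of the semigroup not divisible by the
  multiplicity \<upsilon> s. For s = 1 the generator \<upsilon> r is such a multiple, so \<gamma> =
  \<upsilon> r + p takes its place.\<close>

definition second :: nat where "second = (if s = 1 then \<upsilon> * r + p else \<upsilon> * r)"

lemma second_eq_\<gamma>: "s = 1 \<Longrightarrow> second = \<gamma>"
  unfolding second_def \<gamma>_def by simp

lemma second_eq: "s \<noteq> 1 \<Longrightarrow> second = \<upsilon> * r"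
  by (simp add: second_def)

lemma second_mem: "second \<in> \<Gamma>"
proof -
  have "\<gamma> \<in> \<Gamma>" unfolding gen_semigroup_def by (intro CollectI exI[of _ 0] exI[of _ 1]) simp
  moreover have "\<upsilon> * r \<in> \<Gamma>"
    unfolding gen_semigroup_def by (rule CollectI, rule exI[of _ 0], rule exI[of _ 1], rule exI[of _ 0]) simp
  ultimately show ?thesis by (metis second_eq_\<gamma> second_eq)
qed

lemma second_not_dvd: "1 < \<upsilon> * s \<Longrightarrow> \<not> \<upsilon> * s dvd second"
proof
  assume m: "1 < \<upsilon> * s" and dvd: "\<upsilon> * s dvd second"
  show False
  proof (cases "s = 1")
    case True
    then have "\<upsilon> dvd \<upsilon> * r + p" using dvd unfolding second_def by simp
    then have "\<upsilon> dvd p" by (metis dvd_add_right_iff dvd_triv_left)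
    then have "is_unit \<upsilon>" using coprime_\<upsilon>p by (metis coprime_common_divisor dvd_refl)
    then show False using m True by simp
  next
    case False
    then have "s dvd r" using dvd \<upsilon>_pos by (simp add: second_def)
    then have "is_unit s" using coprime_rs by (metis coprime_common_divisor dvd_refl)
    then show False using False by simp
  qed
qed

lemma second_le:
  assumes "n \<in> \<Gamma>" "\<not> \<upsilon> * s dvd n"
  shows "second \<le> n"
proof -
  obtain a b d where n: "n = a * (\<upsilon> * s) + b * (\<upsilon> * r) + d * \<gamma>" using assms by (auto simp: gen_semigroup_def)
  show ?thesis
  proof (cases "s = 1")
    case True
    then have "d \<noteq> 0" using assms(2) n by (auto intro!: Nat.gr0I)
    then obtain e where e: "d = Suc e" by (cases d) auto
    show ?thesis unfolding n second_eq_\<gamma>[OF True] e by simp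
  next
    case False
    have "\<upsilon> * r \<le> \<upsilon> * r * s" using s_pos by (cases s) auto
    then have "\<upsilon> * r \<le> \<gamma>" unfolding \<gamma>_def by linarith
    moreover have "b \<noteq> 0 \<or> d \<noteq> 0" using assms(2) n by (cases b; cases d) auto
    ultimately show ?thesis using n False by (auto simp: second_def gr0_conv_Suc not0_implies_Suc dest!: not0_implies_Suc)
  qed
qed

lemma gcd_second: "gcd (\<upsilon> * s) second = (if s = 1 then 1 else \<upsilon>)"
proof (cases "s = 1")
  case True
  have "gcd (\<upsilon> * s) second = gcd \<upsilon> \<gamma>" by (subst second_eq_\<gamma>[OF True]) (simp add: True)
  then show ?thesis using coprime_\<upsilon>_\<gamma> True by simp
next
  case False
  then show ?thesis using coprime_rs by (simp add: second_def gcd_mult_distrib_nat[symmetric] coprime_commute)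
qed

end

text \<open>Multiplicity and \<open>second\<close> are intrinsic to the semigroup. Their gcd yields
  \<upsilon> unless s = 1, and the conductor then yields \<gamma>, hence p.\<close>

lemma two_pair_semigroup_determined:
  assumes "two_pair_semigroup \<upsilon> r s p" "two_pair_semigroup \<upsilon>' r' s' p'"
    and eq: "gen_semigroup (\<upsilon> * s) (\<upsilon> * r) (\<upsilon> * r * s + p) = gen_semigroup (\<upsilon>' * s') (\<upsilon>' * r') (\<upsilon>' * r' * s' + p')"
  shows "\<upsilon> * s = \<upsilon>' * s'"
    and "1 < \<upsilon> * s \<Longrightarrow> (if s = 1 then \<upsilon> * r + p else \<upsilon> * r) = (if s' = 1 then \<upsilon>' * r' + p' else \<upsilon>' * r')"
    and "1 < \<upsilon> \<Longrightarrow> 1 < s \<Longrightarrow> \<upsilon> = \<upsilon>' \<and> r = r' \<and> s = s' \<and> p = p'"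
proof -
  interpret A: two_pair_semigroup \<upsilon> r s p by fact
  interpret B: two_pair_semigroup \<upsilon>' r' s' p' by fact
  have eq: "A.\<Gamma> = B.\<Gamma>" using eq by (simp add: A.\<gamma>_def B.\<gamma>_def)
  have pos: "0 < \<upsilon> * s" "0 < \<upsilon>' * s'" using A.\<upsilon>_pos A.s_pos B.\<upsilon>_pos B.s_pos by simp_all
  show m: "\<upsilon> * s = \<upsilon>' * s'"
    using A.multiplicity[of "\<upsilon>' * s'"] B.multiplicity[of "\<upsilon> * s"] A.multiplicity_mem B.multiplicity_mem pos eq
    by auto
  have sec: "A.second = B.second" if "1 < \<upsilon> * s"
    using A.second_le[of B.second] B.second_le[of A.second] A.second_mem B.second_mem
      A.second_not_dvd B.second_not_dvd that eq m by auto
  then show "1 < \<upsilon> * s \<Longrightarrow> (if s = 1 then \<upsilon> * r + p else \<upsilon> * r) = (if s' = 1 then \<upsilon>' * r' + p' else \<upsilon>' * r')"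
    by (simp only: A.second_def B.second_def)
  assume \<upsilon>: "1 < \<upsilon>" and s: "1 < s"
  then have 1: "1 < \<upsilon> * s" using one_less_mult[of \<upsilon> s] by (simp add: mult.commute)
  \<comment> \<open>Because \<upsilon> > 1, this equation of gcds rules out s' = 1.\<close>
  have "\<upsilon> = (if s' = 1 then 1 else \<upsilon>')"
    using A.gcd_second B.gcd_second sec[OF 1] m s by simp
  then have \<upsilon>': "\<upsilon> = \<upsilon>'" and s': "s' \<noteq> 1" using \<upsilon> by (auto split: if_splits)
  have ss: "s = s'" using m \<upsilon>' A.\<upsilon>_pos by simp
  have "\<upsilon> * r = \<upsilon>' * r'" using sec[OF 1] A.second_eq B.second_eq s s' by simp
  then have rr: "r = r'" using \<upsilon>' A.\<upsilon>_pos by simp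
  \<comment> \<open>For fixed \<upsilon>, r and s the conductor is affine in \<gamma> with slope
    \<upsilon> - 1 > 0.\<close>
  have "A.c = B.c" using A.card_gaps B.card_gaps eq by simp
  then have "(int \<upsilon> - 1) * A.\<gamma> = (int \<upsilon> - 1) * B.\<gamma>"
    using A.int_c B.int_c \<upsilon>' ss rr by auto
  then have "A.\<gamma> = B.\<gamma>" using \<upsilon> by simp
  then have "\<upsilon> * r * s + p = \<upsilon>' * r' * s' + p'" unfolding A.\<gamma>_def B.\<gamma>_def .
  then show "\<upsilon> = \<upsilon>' \<and> r = r' \<and> s = s' \<and> p = p'" using \<upsilon>' ss rr by simp
qed

subsection \<open>Independence of the presentation\<close>

text \<open>The least weight with a nonzero coefficient occurs only once, so its term survives at an
  exponent below c.\<close>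

lemma independent_subdegrees:
  fixes v :: "'i \<Rightarrow> 'a::field fps"
  assumes fin: "finite W" and inj: "inj_on wt W"
    and v: "\<And>w. w \<in> W \<Longrightarrow> v w \<noteq> 0 \<and> subdegree (v w) = wt w \<and> wt w < c"
    and dvd: "fps_X ^ c dvd (\<Sum>w\<in>W. scaleO (d w) (v w))"
    and w: "w \<in> W"
  shows "d w = 0"
proof (rule ccontr)
  assume "d w \<noteq> 0"
  with w have "\<exists>w. w \<in> W \<and> d w \<noteq> 0" by blast
  from ex_has_least_nat[of "\<lambda>w. w \<in> W \<and> d w \<noteq> 0" _ wt] this
  obtain w0 where w0: "w0 \<in> W" "d w0 \<noteq> 0" and least: "\<And>w. w \<in> W \<Longrightarrow> d w \<noteq> 0 \<Longrightarrow> wt w0 \<le> wt w" by metis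
  have "d w * fps_nth (v w) (wt w0) = 0" if "w \<in> W - {w0}" for w
  proof (cases "d w = 0")
    case False
    then have "wt w0 \<le> wt w" "wt w0 \<noteq> wt w" using least that w0 inj by (auto simp: inj_on_def)
    then have "fps_nth (v w) (wt w0) = 0" using v[of w] that by (intro nth_less_subdegree_zero) auto
    then show ?thesis by simp
  qed simp
  then have "(\<Sum>w\<in>W - {w0}. d w * fps_nth (v w) (wt w0)) = 0" by (intro sum.neutral) blast
  then have "fps_nth (\<Sum>w\<in>W. scaleO (d w) (v w)) (wt w0) = d w0 * fps_nth (v w0) (wt w0)"
    by (simp add: fps_sum_nth sum.remove[OF fin w0(1)])
  moreover have "fps_nth (\<Sum>w\<in>W. scaleO (d w) (v w)) (wt w0) = 0"
    using dvd v[OF w0(1)] by (simp add: X_power_dvd_iff)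
  moreover have "fps_nth (v w0) (wt w0) \<noteq> 0" using v[OF w0(1)] nth_subdegree_nonzero by metis
  ultimately show False using w0(2) by simp
qed

text \<open>The ideal C with its exponent as a parameter, so that it can also be formed for a
  sheared pair such as (x - y^r, y).\<close>

definition vanishing_ideal :: "nat \<Rightarrow> 'a::field fps \<Rightarrow> 'a fps \<Rightarrow> 'a fps fps set" where
  "vanishing_ideal c x y = {f. fps_X ^ c dvd subst2 x y f}"

text \<open>
  The elements \<open>x^i y^j h^k\<close> with \<open>i < s\<close> span \<open>A\<close> modulo large powers, and their orders on the
  curve are distinct below \<open>c\<close>; so the ideal is the span of those of order at least \<open>c\<close>.
\<close>

lemma vanishing_ideal_subset:
  fixes x y x' y' :: "'a::field fps" and e :: 'a and r s :: nat
  defines "h \<equiv> fps_X ^ s - scaleA e (Y_A ^ r)"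
  assumes x: "x \<noteq> 0" "subdegree x = \<alpha>" "x' \<noteq> 0" "subdegree x' = \<alpha>" "0 < \<alpha>"
    and y: "y \<noteq> 0" "subdegree y = \<beta>" "y' \<noteq> 0" "subdegree y' = \<beta>" "0 < \<beta>"
    and h: "subst2 x y h \<noteq> 0" "subdegree (subst2 x y h) = \<gamma>"
      "subst2 x' y' h \<noteq> 0" "subdegree (subst2 x' y' h) = \<gamma>" "0 < \<gamma>"
    and s: "0 < s"
    and inj: "\<And>i j k i' j' k'. i < s \<Longrightarrow> i' < s \<Longrightarrow> i * \<alpha> + j * \<beta> + k * \<gamma> = i' * \<alpha> + j' * \<beta> + k' * \<gamma> \<Longrightarrow>
      i * \<alpha> + j * \<beta> + k * \<gamma> < c \<Longrightarrow> i = i' \<and> j = j' \<and> k = k'"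
  shows "vanishing_ideal c x y \<subseteq> vanishing_ideal c x' y'"
proof -
  have x0: "fps_nth x 0 = 0" "fps_nth x' 0 = 0" "fps_nth y 0 = 0" "fps_nth y' 0 = 0"
    using x y by (auto intro: nth_less_subdegree_zero)
  note mult = subst2_mult[OF x0(1,3)] subst2_mult[OF x0(2,4)] subst2_power[OF x0(1,3)] subst2_power[OF x0(2,4)]
    subst2_X[OF x0(1,3)] subst2_X[OF x0(2,4)] subst2_Y[OF x0(1,3)] subst2_Y[OF x0(2,4)]
  define wt where "wt = (\<lambda>(i, j, k). i * \<alpha> + j * \<beta> + k * \<gamma>)"
  define E where "E = (\<lambda>(i, j, k). fps_X ^ i * Y_A ^ j * h ^ k)"
  define W where "W = {(i, j, k). i < s \<and> wt (i, j, k) < c}"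
  \<comment> \<open>Working modulo the intersection treats both curves at once: a product E of
    weight at least c vanishes to order c on either.\<close>
  define G where "G = vanishing_ideal c x y \<inter> vanishing_ideal c x' y'"
  have G_0: "0 \<in> G" by (simp add: G_def vanishing_ideal_def)
  have G_add: "f + g \<in> G" if "f \<in> G" "g \<in> G" for f g
    using that by (auto simp: G_def vanishing_ideal_def subst2_add)
  have G_mult: "g * f \<in> G" if "f \<in> G" for f g
    using that by (auto simp: G_def vanishing_ideal_def mult)
  have E: "subst2 x y (E w) \<noteq> 0" "subdegree (subst2 x y (E w)) = wt w"
    "subst2 x' y' (E w) \<noteq> 0" "subdegree (subst2 x' y' (E w)) = wt w" for w
    using x y h by (auto simp: E_def wt_def mult simp del: fps_const_power split: prod.splits)
  have E_G: "E w \<in> G" if "c \<le> wt w" for w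
    using E[of w] that by (auto simp: G_def vanishing_ideal_def intro!: X_power_dvd_subdegree)
  have "W \<subseteq> {..<s} \<times> {..<c} \<times> {..<c}"
  proof
    fix w assume w: "w \<in> W"
    obtain i j k where ijk: "w = (i, j, k)" by (cases w)
    have "j \<le> j * \<beta>" "k \<le> k * \<gamma>" using y(5) h(5) by (simp_all add: Suc_leI)
    moreover have "i < s" "i * \<alpha> + j * \<beta> + k * \<gamma> < c" using w by (simp_all add: W_def wt_def ijk)
    ultimately have "i < s" "j < c" "k < c" by linarith+
    then show "w \<in> {..<s} \<times> {..<c} \<times> {..<c}" by (simp add: ijk)
  qed
  then have finW: "finite W" by (rule finite_subset) auto
  have injW: "inj_on wt W"
  proof (rule inj_onI)
    fix w w' assume "w \<in> W" "w' \<in> W" "wt w = wt w'"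
    moreover obtain i j k i' j' k' where "w = (i, j, k)" "w' = (i', j', k')" by (cases w, cases w')
    ultimately show "w = w'" using inj[of i i' j k j' k'] by (simp add: W_def wt_def)
  qed
  define T where "T = {f. \<exists>d. f - (\<Sum>w\<in>W. scaleA (d w) (E w)) \<in> G}"
  have G_T: "f \<in> T" if "f \<in> G" for f using that by (auto simp: T_def intro!: exI[of _ "\<lambda>_. 0"])
  have T_add: "f + g \<in> T" if fg: "f \<in> T" "g \<in> T" for f g
  proof -
    obtain d d' where "f - (\<Sum>w\<in>W. scaleA (d w) (E w)) \<in> G" "g - (\<Sum>w\<in>W. scaleA (d' w) (E w)) \<in> G"
      using fg by (auto simp: T_def)
    from G_add[OF this] show ?thesis
      unfolding T_def by (intro CollectI exI[of _ "\<lambda>w. d w + d' w"])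
        (simp add: algebra_simps sum.distrib flip: fps_const_add)
  qed
  have T_scale: "scaleA k f \<in> T" if f: "f \<in> T" for k f
  proof -
    obtain d where "f - (\<Sum>w\<in>W. scaleA (d w) (E w)) \<in> G" using f by (auto simp: T_def)
    from G_mult[OF this, of "fps_const (fps_const k)"] show ?thesis
      unfolding T_def by (intro CollectI exI[of _ "\<lambda>w. k * d w"])
        (simp add: right_diff_distrib sum_distrib_left mult.assoc flip: fps_const_mult)
  qed
  have E_T: "E w \<in> T" if "fst w < s" for w
  proof (cases "w \<in> W")
    case True
    have "(\<Sum>w'\<in>W. scaleA (if w' = w then 1 else 0) (E w')) = E w"
      using finW True by (subst sum.remove[OF finW True]) simp
    then show ?thesis
      unfolding T_def using G_0
      by (intro CollectI exI[of _ "\<lambda>w'. if w' = w then 1 else 0"]) simp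
  next
    case False
    then have "c \<le> wt w" using that by (cases w) (auto simp: W_def)
    then show ?thesis by (rule G_T[OF E_G])
  qed
  have monomial: "fps_X ^ a * Y_A ^ b * h ^ k \<in> T" for a b k
  proof (induction a arbitrary: b k rule: less_induct)
    case (less a)
    show ?case
    proof (cases "a < s")
      case True
      then show ?thesis using E_T[of "(a, b, k)"] by (simp add: E_def)
    next
      case False
      \<comment> \<open>Trading x^s for h + e y^r lowers the exponent of x, while the exponents of y
        and h may grow freely.\<close>
      then have "fps_X ^ a = fps_X ^ (a - s) * fps_X ^ s" by (simp flip: power_add)
      also have "fps_X ^ s = h + scaleA e (Y_A ^ r)" by (simp add: h_def)
      finally have "fps_X ^ a * Y_A ^ b * h ^ k = fps_X ^ (a - s) * (h + scaleA e (Y_A ^ r)) * Y_A ^ b * h ^ k"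
        by (rule arg_cong)
      also have "\<dots> = fps_X ^ (a - s) * Y_A ^ b * h ^ Suc k + scaleA e (fps_X ^ (a - s) * Y_A ^ (b + r) * h ^ k)"
        unfolding power_add power_Suc by (simp only: distrib_left distrib_right mult_ac)
      also have "\<dots> \<in> T" using False s by (intro T_add T_scale less.IH) simp_all
      finally show ?thesis .
    qed
  qed
  have T: "f \<in> T" for f
  proof (rule fps_fps_eq_UNIV[where N = c])
    fix k a b
    show "scaleA k (fps_X ^ a * Y_A ^ b) \<in> T" using T_scale[OF monomial[of a b 0]] by simp
  next
    fix f
    \<comment> \<open>As x and y have positive order on both curves, their c-th powers already lie
      in G.\<close>
    have "c \<le> c * \<alpha>" "c \<le> c * \<beta>" using x y by auto
    then have "E (c, 0, 0) \<in> G" "E (0, c, 0) \<in> G" by (auto intro!: E_G simp: wt_def)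
    then have "fps_X ^ c \<in> G" "Y_A ^ c \<in> G" by (simp_all add: E_def del: fps_const_power)
    from this[THEN G_mult, THEN G_T, of f] show "fps_X ^ c * f \<in> T" "Y_A ^ c * f \<in> T"
      by (simp_all only: mult.commute)
  qed (rule T_add)
  show ?thesis
  proof
    fix f assume f: "f \<in> vanishing_ideal c x y"
    obtain d where d: "f - (\<Sum>w\<in>W. scaleA (d w) (E w)) \<in> G" using T[of f] by (auto simp: T_def)
    then have "fps_X ^ c dvd subst2 x y f - subst2 x y (f - (\<Sum>w\<in>W. scaleA (d w) (E w)))"
      using f by (intro dvd_diff) (auto simp: G_def vanishing_ideal_def)
    then have "fps_X ^ c dvd (\<Sum>w\<in>W. scaleO (d w) (subst2 x y (E w)))"
      by (simp add: subst2_diff subst2_sum subst2_scale)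
    \<comment> \<open>The combination vanishes to order c on the first curve while its terms have
      distinct orders below c. So f lies in G, and therefore in the second ideal.\<close>
    then have "d w = 0" if "w \<in> W" for w
      using that by (rule independent_subdegrees[OF finW injW, rotated]) (use E in \<open>auto simp: W_def\<close>)
    then have "f \<in> G" using d by simp
    then show "f \<in> vanishing_ideal c x' y'" by (simp add: G_def)
  qed
qed

lemma power_one_plus_expand: "\<exists>Q. (1 + v) ^ n = 1 + of_nat n * v + v ^ 2 * (Q :: 'a::comm_ring_1)"
proof (induction n)
  case (Suc n)
  then obtain Q where "(1 + v) ^ n = 1 + of_nat n * v + v ^ 2 * Q" by blast
  then have "(1 + v) ^ Suc n = 1 + of_nat (Suc n) * v + v ^ 2 * (of_nat n + Q + v * Q)"
    by (simp add: algebra_simps power2_eq_square)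
  then show ?case by blast
qed (auto intro: exI[of _ 0])

text \<open>With x = z^a (1 + v) and v of order p, the leading term of x^s - z^(a s) is s z^(a s +
  p), which is nonzero because s is invertible.\<close>

lemma subdegree_power_diff:
  fixes x g :: "'a::field fps"
  assumes x: "x = fps_X ^ a + fps_X ^ (a + p) + g" and g: "fps_X ^ (a + p + 1) dvd g"
    and s: "of_nat s \<noteq> (0::'a)" and p: "0 < p"
  shows "x ^ s - fps_X ^ (a * s) \<noteq> 0 \<and> subdegree (x ^ s - fps_X ^ (a * s)) = a * s + p"
proof -
  obtain t where t: "g = fps_X ^ (a + p + 1) * t" using g by (auto elim: dvdE)
  define v where "v = fps_X ^ p * (1 + fps_X * t)"
  have xv: "x = fps_X ^ a * (1 + v)" by (simp add: x t v_def algebra_simps power_add)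
  obtain Q where Q: "(1 + v) ^ s = 1 + of_nat s * v + v ^ 2 * Q" using power_one_plus_expand by blast
  define u where "u = of_nat s * (1 + fps_X * t) + fps_X ^ p * (1 + fps_X * t) ^ 2 * Q"
  have "x ^ s - fps_X ^ (a * s) = fps_X ^ (a * s) * (of_nat s * v + v ^ 2 * Q)"
    unfolding xv power_mult_distrib Q by (simp add: power_mult algebra_simps)
  also have "of_nat s * v + v ^ 2 * Q = fps_X ^ p * u"
    by (simp add: v_def u_def algebra_simps power2_eq_square)
  finally have eq: "x ^ s - fps_X ^ (a * s) = fps_X ^ (a * s + p) * u"
    by (simp add: power_add mult.assoc)
  have "fps_nth u 0 = of_nat s" using p by (simp add: u_def fps_of_nat[symmetric] del: fps_of_nat)
  then have "subdegree u = 0" "u \<noteq> 0" using s by auto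
  then show ?thesis unfolding eq by (simp add: fps_X_power_subdegree)
qed

lemma presentation_semigroup:
  assumes "presentation \<Gamma> \<upsilon> r s p g x y"
  shows "two_pair_semigroup \<upsilon> r s p"
  using assms by (simp add: presentation_def two_pair_semigroup_def)

lemma presentation_branch:
  fixes x y g :: "'a::{field,finite} fps"
  assumes pres: "presentation \<Gamma> \<upsilon> r s p g x y"
  shows "plane_branch x y (2 * card (- \<Gamma>))"
proof -
  interpret two_pair_semigroup \<upsilon> r s p using presentation_semigroup[OF pres] .
  have P: "fps_X ^ (\<upsilon> * r + p + 1) dvd g" "x = fps_X ^ (\<upsilon> * r) + fps_X ^ (\<upsilon> * r + p) + g" "y = fps_X ^ (\<upsilon> * s)"
    "value_semigroup (curve_ring x y) = \<Gamma>" and \<Gamma>: "\<Gamma> = gen_semigroup (\<upsilon> * s) (\<upsilon> * r) \<gamma>"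
    using pres unfolding presentation_def \<gamma>_def by blast+
  have "fps_nth g 0 = 0" using P(1) unfolding X_power_dvd_iff by simp
  moreover have "0 < r" using s_less_r by simp
  ultimately have "fps_nth x 0 = 0" "fps_nth y 0 = 0" "y \<noteq> 0"
    using \<upsilon>_pos s_pos p_pos by (simp_all add: P(2,3))
  then show ?thesis
    using c_le c_gap card_gaps by unfold_locales (simp_all add: P(4) \<Gamma>)
qed

text \<open>\<open>fps_const (fps_X ^ r)\<close> is y^r in A. For s \<noteq> 1 the map is the
  identity, which spares a case distinction later.\<close>

definition shear :: "nat \<Rightarrow> nat \<Rightarrow> 'a::field fps fps \<Rightarrow> 'a fps fps" where
  "shear r s = subst_A (fps_X + fps_const (if s = 1 then fps_X ^ r else 0)) Y_A"

lemma local_automorphism_shear: "0 < r \<Longrightarrow> local_automorphism (shear r s)"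
  unfolding shear_def by (rule local_automorphism_subst_A) simp

text \<open>Evaluating the sheared series at (x - y^r, y) gives the value of the original one at (x,
  y).\<close>

lemma shear_conductor_preimage:
  fixes x y g :: "'a::{field,finite} fps"
  assumes pres: "presentation \<Gamma> \<upsilon> r s p g x y"
  shows "shear r s ` conductor_preimage x y
    = vanishing_ideal (2 * card (- \<Gamma>)) (if s = 1 then x - y ^ r else x) y"
proof -
  interpret plane_branch x y "2 * card (- \<Gamma>)" using presentation_branch[OF pres] .
  have r: "0 < r" using pres by (auto simp: presentation_def)
  define x1 where "x1 = (if s = 1 then x - y ^ r else x)"
  define w :: "'a fps" where "w = (if s = 1 then fps_X ^ r else 0)"
  have w: "fps_nth w 0 = 0" using r by (simp add: w_def)
  have x1: "fps_nth x1 0 = 0" using x_0 y_0 r by (simp add: x1_def)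
  have "subst2 x1 y (fps_const w) = x - x1"
    using subst2_power[OF x1 y_0, of Y_A r] subst2_Y[OF x1 y_0]
    by (cases "s = 1") (simp_all add: w_def x1_def)
  then have "subst2 x1 y (shear r s f) = subst2 x y f" for f
    unfolding shear_def w_def[symmetric] using w
    by (simp add: subst2_subst_A[OF x1 y_0] order_ge_1_iff subst2_add subst2_X[OF x1 y_0] subst2_Y[OF x1 y_0])
  then have "f \<in> conductor_preimage x y \<longleftrightarrow> shear r s f \<in> vanishing_ideal (2 * card (- \<Gamma>)) x1 y" for f
    by (simp add: C_iff vanishing_ideal_def)
  moreover have "local_automorphism (shear r s :: 'a fps fps \<Rightarrow> _)"
    by (rule local_automorphism_shear[OF r])
  then have "bij (shear r s :: 'a fps fps \<Rightarrow> _)"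
    by (simp add: local_automorphism_def algebra_automorphism_def)
  ultimately show ?thesis
    unfolding x1_def[symmetric] by (auto simp: image_iff) (metis bij_pointE)
qed

text \<open>One inclusion suffices, since the two presentations can be exchanged. After the shear,
  the first coordinate has order \<open>second\<close> in each presentation.\<close>

lemma vanishing_ideal_presentation_subset:
  fixes x y g x' y' g' :: "'a::{field,finite} fps"
  assumes pres: "presentation \<Gamma> \<upsilon> r s p g x y" and pres': "presentation \<Gamma> \<upsilon>' r' s' p' g' x' y'"
  shows "vanishing_ideal (2 * card (- \<Gamma>)) (if s = 1 then x - y ^ r else x) y
    \<subseteq> vanishing_ideal (2 * card (- \<Gamma>)) (if s' = 1 then x' - y' ^ r' else x') y'"
    (is "vanishing_ideal ?c ?x y \<subseteq> vanishing_ideal _ ?x' y'")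
proof -
  interpret A: two_pair_semigroup \<upsilon> r s p using presentation_semigroup[OF pres] .
  interpret B: two_pair_semigroup \<upsilon>' r' s' p' using presentation_semigroup[OF pres'] .
  have \<Gamma>: "\<Gamma> = A.\<Gamma>" "\<Gamma> = B.\<Gamma>"
    using pres pres' by (simp_all add: presentation_def A.\<gamma>_def B.\<gamma>_def)
  have c: "?c = A.c" "?c = B.c" using A.card_gaps B.card_gaps \<Gamma> by auto
  have eq: "gen_semigroup (\<upsilon> * s) (\<upsilon> * r) (\<upsilon> * r * s + p) = gen_semigroup (\<upsilon>' * s') (\<upsilon>' * r') (\<upsilon>' * r' * s' + p')"
    using pres pres' by (simp add: presentation_def)
  note det = two_pair_semigroup_determined[OF presentation_semigroup[OF pres] presentation_semigroup[OF pres'] eq]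
  have x: "z \<noteq> 0 \<and> subdegree z = \<upsilon> * r" "w = fps_X ^ (\<upsilon> * s)"
    "z ^ s - w ^ r \<noteq> 0 \<and> subdegree (z ^ s - w ^ r) = \<upsilon> * r * s + p" "w \<noteq> 0 \<and> subdegree w = \<upsilon> * s"
    if "presentation \<Gamma> \<upsilon> r s p h z w" for \<upsilon> r s p and h z w :: "'a fps"
  proof -
    have P: "fps_X ^ (\<upsilon> * r + p + 1) dvd h" "z = fps_X ^ (\<upsilon> * r) + fps_X ^ (\<upsilon> * r + p) + h" "w = fps_X ^ (\<upsilon> * s)"
      "of_nat s \<noteq> (0 :: 'a)" "0 < p"
      using that unfolding presentation_def by blast+
    have h: "fps_nth h k = 0" if "k \<le> \<upsilon> * r" for k
      using P(1) that unfolding X_power_dvd_iff by simp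
    show "w = fps_X ^ (\<upsilon> * s)" by fact
    then show "w \<noteq> 0 \<and> subdegree w = \<upsilon> * s" by (simp add: fps_X_power_subdegree)
    have "fps_nth z (\<upsilon> * r) = 1"
      using P(5) h by (simp add: P(2))
    moreover have "fps_nth z k = 0" if "k < \<upsilon> * r" for k
      using h that by (simp add: P(2))
    ultimately show "z \<noteq> 0 \<and> subdegree z = \<upsilon> * r" by (auto intro!: subdegreeI)
    have "w ^ r = fps_X ^ (\<upsilon> * r * s)" by (simp add: P(3) mult_ac flip: power_mult)
    then show "z ^ s - w ^ r \<noteq> 0 \<and> subdegree (z ^ s - w ^ r) = \<upsilon> * r * s + p"
      using subdegree_power_diff[OF P(2,1,4,5)] by simp
  qed
  note xA = x[OF pres] and xB = x[OF pres']
  have \<beta>: "0 < \<upsilon> * s" "0 < \<upsilon> * r" "0 < \<upsilon>' * r'" using A.\<upsilon>_pos A.s_pos A.s_less_r B.\<upsilon>_pos B.s_less_r by auto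
  have zero: "fps_nth ?x 0 = 0" "fps_nth y 0 = 0" "fps_nth ?x' 0 = 0" "fps_nth y' 0 = 0"
    using presentation_branch[OF pres] presentation_branch[OF pres'] A.s_less_r B.s_less_r
    by (auto simp: plane_branch_def)
  have sec: "?x \<noteq> 0 \<and> subdegree ?x = A.second" "?x' \<noteq> 0 \<and> subdegree ?x' = B.second"
    using xA(1,3) xB(1,3) by (auto simp: A.second_def B.second_def)
  show ?thesis
  proof (cases "\<upsilon> * s = 1")
    case True
    \<comment> \<open>Multiplicity 1 means no gaps, and then both ideals are all of A.\<close>
    then have "?c = 0" using A.int_c c by simp
    then show ?thesis by (simp add: vanishing_ideal_def)
  next
    case False
    then have m: "1 < \<upsilon> * s" using \<beta> by linarith
    have second: "A.second = B.second" using det(2)[OF m] by (simp only: A.second_def B.second_def)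
    show ?thesis
    proof (cases "1 < \<upsilon> \<and> 1 < s")
      case True
      \<comment> \<open>In the genuine two-pair case the parameters are forced to agree, so the same
        h serves both curves.\<close>
      then have same: "\<upsilon>' = \<upsilon>" "r' = r" "s' = s" "p' = p" using det(3) by auto
      have xs: "?x = x" "?x' = x'" using True same by auto
      have h: "subst2 z w (fps_X ^ s - scaleA 1 (Y_A ^ r)) = z ^ s - w ^ r"
        if "fps_nth z 0 = 0" "fps_nth w 0 = 0" for z w :: "'a fps"
        by (simp add: subst2_diff subst2_power[OF that] subst2_X[OF that] subst2_Y[OF that] del: fps_const_power)
      note z = zero[unfolded xs]
      show ?thesis
        unfolding xs
      proof (rule vanishing_ideal_subset[where s = s and r = r and e = 1 and \<alpha> = "\<upsilon> * r" and \<beta> = "\<upsilon> * s" and \<gamma> = A.\<gamma>])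
        show "x \<noteq> 0" "subdegree x = \<upsilon> * r" "x' \<noteq> 0" "subdegree x' = \<upsilon> * r"
          "y \<noteq> 0" "subdegree y = \<upsilon> * s" "y' \<noteq> 0" "subdegree y' = \<upsilon> * s"
          using xA(1,4) xB(1,4) unfolding same by simp_all
        show "subst2 x y (fps_X ^ s - scaleA 1 (Y_A ^ r)) \<noteq> 0"
          "subdegree (subst2 x y (fps_X ^ s - scaleA 1 (Y_A ^ r))) = A.\<gamma>"
          unfolding h[OF z(1,2)] A.\<gamma>_def using xA(3) by simp_all
        show "subst2 x' y' (fps_X ^ s - scaleA 1 (Y_A ^ r)) \<noteq> 0"
          "subdegree (subst2 x' y' (fps_X ^ s - scaleA 1 (Y_A ^ r))) = A.\<gamma>"
          unfolding h[OF z(3,4)] A.\<gamma>_def using xB(3) unfolding same by simp_all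
        show "0 < \<upsilon> * r" "0 < \<upsilon> * s" "0 < A.\<gamma>" "0 < s" using \<beta> A.s_pos A.p_pos by (simp_all add: A.\<gamma>_def)
      qed (use A.weight_inj c(1) in metis)
    next
      case False
      then have "\<upsilon> = 1 \<or> s = 1" using A.\<upsilon>_pos A.s_pos by auto
      \<comment> \<open>Here the semigroup is generated by \<upsilon> s and \<open>second\<close>
        alone, so monomials in two coordinates have distinct orders below c.\<close>
      have inj: "j = j' \<and> k = k'"
        if "j * (\<upsilon> * s) + k * A.second = j' * (\<upsilon> * s) + k' * A.second" "j * (\<upsilon> * s) + k * A.second < A.c" for j k j' k'
      proof (cases "s = 1")
        case True
        show ?thesis
          using A.weight_inj[of 0 j k 0 j' k'] that A.s_pos unfolding A.second_eq_\<gamma>[OF True] by simp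
      next
        case False
        then have \<upsilon>: "\<upsilon> = 1" using \<open>\<upsilon> = 1 \<or> s = 1\<close> by simp
        have "int A.c = (int s - 1) * int r - int s + 1" unfolding A.int_c by (simp add: \<upsilon>)
        \<comment> \<open>For \<upsilon> = 1 the conductor is (s - 1)(r - 1) < s r, so an order
          below c leaves fewer than s factors x.\<close>
        then have "int A.c \<le> int (s * r)" using A.s_pos by (simp add: algebra_simps)
        then have "A.c \<le> s * r" by linarith
        moreover have "A.second = r" unfolding A.second_eq[OF False] by (simp add: \<upsilon>)
        note that[unfolded this]
        ultimately have "k * r < s * r" "k' * r < s * r" by linarith+
        then have "k < s" "k' < s" by simp_all
        then show ?thesis using A.weight_inj[of k j 0 k' j' 0] that by (simp add: A.second_eq[OF False] add.commute)
      qed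
      \<comment> \<open>A degenerate choice of parameters, s = 1 and e = 0, makes h equal to x and
        turns the spanning elements into monomials x^k y^j.\<close>
      have h: "subst2 z w (fps_X ^ 1 - scaleA 0 (Y_A ^ 0)) = z"
        if "fps_nth z 0 = 0" "fps_nth w 0 = 0" for z w :: "'a fps"
        by (simp add: subst2_X[OF that])
      have "0 < A.second" using \<beta> by (auto simp: A.second_def)
      show ?thesis
      proof (rule vanishing_ideal_subset[where s = 1 and r = 0 and e = 0 and \<alpha> = A.second and \<beta> = "\<upsilon> * s" and \<gamma> = A.second])
        show "?x \<noteq> 0" "subdegree ?x = A.second" using sec(1) by blast+
        show "?x' \<noteq> 0" "subdegree ?x' = A.second" using sec(2) second by metis+
        show "y \<noteq> 0" "subdegree y = \<upsilon> * s" using xA(4) by blast+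
        show "y' \<noteq> 0" "subdegree y' = \<upsilon> * s" using xB(4) det(1) by metis+
        show "subst2 ?x y (fps_X ^ 1 - scaleA 0 (Y_A ^ 0)) \<noteq> 0"
          "subdegree (subst2 ?x y (fps_X ^ 1 - scaleA 0 (Y_A ^ 0))) = A.second"
          unfolding h[OF zero(1,2)] using sec(1) by blast+
        show "subst2 ?x' y' (fps_X ^ 1 - scaleA 0 (Y_A ^ 0)) \<noteq> 0"
          "subdegree (subst2 ?x' y' (fps_X ^ 1 - scaleA 0 (Y_A ^ 0))) = A.second"
          unfolding h[OF zero(3,4)] using sec(2) second by metis+
        show "0 < A.second" "0 < A.second" "0 < \<upsilon> * s" "(0::nat) < 1" using \<open>0 < A.second\<close> \<beta> by simp_all
        fix i j k i' j' k' :: nat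
        assume "i < 1" "i' < 1" and e: "i * A.second + j * (\<upsilon> * s) + k * A.second = i' * A.second + j' * (\<upsilon> * s) + k' * A.second"
          "i * A.second + j * (\<upsilon> * s) + k * A.second < ?c"
        then have i: "i = 0" "i' = 0" by simp_all
        show "i = i' \<and> j = j' \<and> k = k'" using inj[of j k j' k'] e unfolding i c(1) by simp
      qed
    qed
  qed
qed

theorem corollary7p4:
  fixes x y g x' y' g' :: "'a::{field,finite} fps"
    and \<Gamma> :: "nat set"
    and \<upsilon> r s p \<upsilon>' r' s' p' :: nat
  assumes "presentation \<Gamma> \<upsilon> r s p g x y"
    and "presentation \<Gamma> \<upsilon>' r' s' p' g' x' y'"
  shows "((\<upsilon>, r, s) = (\<upsilon>', r', s') \<longrightarrow> instanton_slice x y = instanton_slice x' y') \<and>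
         (\<exists>\<psi>. algebra_automorphism \<psi> \<and>
            (\<lambda>I. \<psi> ` I) ` instanton_slice x y = instanton_slice x' y') \<and>
         H_inst x y = H_inst x' y' \<and>
         H_mot (curve_ring x y) = H_mot (curve_ring x' y')"
proof -
  let ?c = "2 * card (- \<Gamma>)"
  interpret A: plane_branch x y ?c using presentation_branch[OF assms(1)] .
  interpret B: plane_branch x' y' ?c using presentation_branch[OF assms(2)] .
  have r: "0 < r" "0 < r'" using assms by (auto simp: presentation_def)
  define \<tau> \<tau>' :: "'a fps fps \<Rightarrow> 'a fps fps" where "\<tau> = shear r s" and "\<tau>' = shear r' s'"
  have \<tau>: "local_automorphism \<tau>" "local_automorphism \<tau>'"
    using local_automorphism_shear r by (auto simp: \<tau>_def \<tau>'_def)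
  then have bij: "bij \<tau>" "bij \<tau>'" by (auto simp: local_automorphism_def algebra_automorphism_def)
  have eq: "\<tau> ` conductor_preimage x y = \<tau>' ` conductor_preimage x' y'"
    using vanishing_ideal_presentation_subset[OF assms] vanishing_ideal_presentation_subset[OF assms(2,1)]
    unfolding \<tau>_def \<tau>'_def shear_conductor_preimage[OF assms(1)] shear_conductor_preimage[OF assms(2)] by blast
  \<comment> \<open>Passing through the common sheared ideal matches C with C'.\<close>
  define \<psi> where "\<psi> = inv \<tau>' \<circ> \<tau>"
  have \<psi>: "local_automorphism \<psi>"
    unfolding \<psi>_def using local_automorphism_comp local_automorphism_inv \<tau> by blast
  have C: "\<psi> ` conductor_preimage x y = conductor_preimage x' y'"
    unfolding \<psi>_def image_comp[symmetric] eq using bij(2) by (simp add: bij_is_inj image_inv_f_f)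
  have slice: "bij_betw (\<lambda>I. \<psi> ` I) (instanton_slice x y) (instanton_slice x' y')"
    using instanton_slice_image[OF \<psi> C] .
  have "instanton_slice x y = instanton_slice x' y'" if "(\<upsilon>, r, s) = (\<upsilon>', r', s')"
  proof -
    \<comment> \<open>Equal triples give the same shear, which can be cancelled, so the two ideals C
      are literally equal.\<close>
    have "\<tau>' = \<tau>" using that by (simp add: \<tau>_def \<tau>'_def)
    then have "conductor_preimage x y = conductor_preimage x' y'"
      using eq bij by (simp add: bij_is_inj inj_image_eq_iff)
    then show ?thesis by (simp add: instanton_slice_def)
  qed
  moreover have "algebra_automorphism \<psi>" using \<psi> by (simp add: local_automorphism_def)
  moreover have "H_inst x y = H_inst x' y'" by (rule H_inst_image[OF \<psi> C])
  moreover have "H_mot (curve_ring x y) = H_mot (curve_ring x' y')"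
  proof -
    have UNIV: "quotient_dim scaleA UNIV (\<psi> ` I) = quotient_dim scaleA UNIV I" for I
      using quotient_dim_image[OF \<psi>, of UNIV I] \<psi>
      by (simp add: local_automorphism_def algebra_automorphism_def bij_is_surj)
    \<comment> \<open>Both polynomials are now sums over slices with the same c, and \<psi>
      preserves codimensions and socles.\<close>
    show ?thesis
      unfolding A.H_mot_slice B.H_mot_slice sum.reindex_bij_betw[OF slice, symmetric]
      by (simp add: UNIV colon_image[OF \<psi>] quotient_dim_image[OF \<psi>])
  qed
  ultimately show ?thesis using slice by (auto simp: bij_betw_def)
qed

end
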